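(* For real $x>0$, let $\lambda=\lambda(x)$ be the unique real number such that $$\int_{0}^{1}\frac{1}{y(1+e^{\lambda/y})}\,dy = x,$$ and define $$c_x := \int_{0}^{1}h\left(\frac{1}{1+e^{\lambda/y}}\right)dy .$$ Then for any fixed positive rational number $x$, the number of subsets $A\subseteq [n]$ with $\sum_{a\in A}\frac1a = x$ is $2^{c_x n + o(n)}$ as $n\to\infty$. In particular, $c_x$ is a strictly increasing function of $x$, with $c_0=0$ (where $c_0:=\lim_{x\to 0^+}c_x$), $c_1\approx 0.91117$ (in the sense that $|c_1-0.91117|<10^{-5}$), and $c_x\to 1$ as $x\to\infty$.
   Context: $[n]=\{1,2,\dots,n\}$. The function $h:[0,1]\to\mathbb{R}$ is the binary entropy function $h(p) = -p\log_2 p-(1-p)\log_2(1-p)$ for $p\in(0,1)$, with $h(0)=h(1)=0$. In the asymptotic statement $x$ is fixed and $o(n)$ denotes a quantity (possibly depending on $x$) whose quotient by $n$ tends to $0$ as $n\to\infty$. The existence and uniqueness of $\lambda$ are part of the assertion. *)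

theory Defs
  imports "HOL-Analysis.Analysis" "HOL-Library.Landau_Symbols"
begin

definition binary_entropy :: "real \<Rightarrow> real" where
  "binary_entropy p =
     (if p = 0 \<or> p = 1 then 0 else - p * log 2 p - (1 - p) * log 2 (1 - p))"

(* Stating the equation with has_integral makes convergence of the integral part of the
   condition: for l \<le> 0 the integral diverges, so no such l is a solution.  The value
   of the integrand at y = 0, where division by zero yields 0, does not matter. *)
definition is_multiplier :: "real \<Rightarrow> real \<Rightarrow> bool" where
  "is_multiplier x l \<longleftrightarrow>
     ((\<lambda>y. 1 / (y * (1 + exp (l / y)))) has_integral x) {0..1}"

definition multiplier :: "real \<Rightarrow> real" where
  "multiplier x = (THE l. is_multiplier x l)"

definition growth_const :: "real \<Rightarrow> real" where
  "growth_const x =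
     integral {0..1} (\<lambda>y. binary_entropy (1 / (1 + exp (multiplier x / y))))"

definition unit_fraction_sets :: "real \<Rightarrow> nat \<Rightarrow> nat set set" where
  "unit_fraction_sets x n = {A. A \<subseteq> {1..n} \<and> (\<Sum>a\<in>A. 1 / real a) = x}"

end

theory Submission
  imports Defs "HOL-Computational_Algebra.Primes"
begin

text \<open>
  Write \<open>F l\<close> for the integral defining the multiplier.  Since \<open>y * ln (1 + exp (- l / y))\<close> is an
  antiderivative of \<open>ln 2\<close> times the entropy integrand, the growth constant is
  \<open>log 2 (1 + exp (- l))\<close> with \<open>F l = x\<close>.  So monotonicity and limits follow from those of \<open>F\<close>,
  and the value at \<open>x = 1\<close> amounts to \<open>F 0.1272 < 1 < F 0.12718\<close>.

  The upper bound for the number of sets is the exponential Markov inequality with tilt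
  \<open>exp (- l * n / a)\<close>.

  For the lower bound, take only numbers \<open>a\<close> dividing \<open>W * \<Prod>P\<close>, where \<open>W\<close> is a fixed integer and
  \<open>P\<close> is the set of primes in \<open>{P0<..y}\<close> with \<open>y\<close> about \<open>n powr (1 - \<epsilon>)\<close>; these are almost all
  numbers up to \<open>n\<close>.  Exponentially many sets \<open>A\<close> have a sum slightly below
  \<open>x\<close>, and each can be completed to a sum exactly \<open>x\<close> by a sparse reserved set of denominators.
  Namely, let \<open>M\<close> consist of boundedly many powers, each about \<open>n powr \<epsilon>'\<close>, of distinct fixed odd
  primes, with \<open>\<Prod>M \<ge> n\<close>.  By partial fractions and binary expansion every
  \<open>u / (2 ^ S * \<Prod>M)\<close> in a suitable range is a sum of distinct \<open>1 / (2 ^ j * m)\<close> with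
  \<open>m \<in> insert 1 M\<close>.  As \<open>u\<close> covers all residues modulo \<open>p\<close>, multiples of \<open>p\<close> of this form remove
  every \<open>p \<in> P\<close> from the denominator of \<open>x - (\<Sum>a\<in>A. 1 / a)\<close>, independently of each other, and
  multiples of \<open>W\<close> of this form represent what is left.
\<close>

section \<open>The multiplier and the closed form of the growth constant\<close>

text \<open>The obstacle is a prime \<open>p\<close> near the cut-off
  \<open>n div 2 ^ (4 * L)\<close>: its multiples up to \<open>n\<close> are \<open>p * b\<close>
  with \<open>b\<close> at most a small power of \<open>n\<close>, yet sums of the
  \<open>1 / b\<close> must reach every residue modulo \<open>p\<close>. So a common denominator
  exceeding \<open>p\<close> has to be built from tiny pieces: \<open>\<Prod>M \<ge> n\<close>
  although each \<open>m \<in> M\<close> is at most \<open>2 ^ L\<close>. This dictates the cut-off,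
  because the multipliers \<open>2 ^ j * m\<close> go up to \<open>2 ^ (4 * L)\<close>. The
  corrections at the primes use only exponents \<open>j \<ge> L\<close>. Hence they are multiples of
  \<open>2 ^ L\<close>, their total is at most \<open>1 / (4 * W)\<close>, and what is left stays
  between \<open>1 / (4 * W)\<close> and \<open>1 / W\<close> whatever residues had to be corrected.
  The sets \<open>A\<close> contain no multiple of \<open>2 ^ L\<close> or of \<open>W\<close>,
  whereas a completion contains nothing else. So \<open>A\<close> can be read off from the completed
  set, and distinct \<open>A\<close> give distinct solutions. All this costs little because
  \<open>L = N div T\<close> with \<open>2 ^ N \<le> n\<close> and \<open>T\<close> fixed: the
  numbers with a prime factor above the cut-off have density at most \<open>20 / T\<close>.\<close>

definition mult_fun :: "real \<Rightarrow> real \<Rightarrow> real" where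
  "mult_fun l y = 1 / (y * (1 + exp (l / y)))"

lemma exp_neg_le_quadratic:
  fixes s :: real assumes "s > 0" shows "exp (- s) \<le> 2 / s\<^sup>2"
proof -
  have "s\<^sup>2 / 2 \<le> exp s"
    using exp_lower_Taylor_quadratic[of s] assms by simp
  then have "s\<^sup>2 \<le> 2 * exp s" by simp
  then have "s\<^sup>2 * exp (-s) \<le> 2 * exp s * exp (-s)"
    by (intro mult_right_mono) auto
  also have "\<dots> = 2" by (simp add: exp_minus)
  finally show ?thesis using assms by (simp add: field_simps)
qed

text \<open>The functions below involve \<open>l / y\<close>, which is \<open>0\<close> at
  \<open>y = 0\<close> by convention. A linear bound gives continuity there, so that integrability
  and the fundamental theorem apply on closed intervals starting at \<open>0\<close>.\<close>

lemma continuous_on_linear_vanish: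
  fixes g :: "real \<Rightarrow> real"
  assumes "continuous_on {0<..b} g" "\<And>y. 0 < y \<Longrightarrow> y \<le> b \<Longrightarrow> \<bar>g y\<bar> \<le> C * y" "g 0 = 0"
  shows "continuous_on {0..b} g"
proof (unfold continuous_on_eq_continuous_within, intro ballI)
  fix y assume y: "y \<in> {0..b}"
  show "continuous (at y within {0..b}) g"
  proof (cases "y = 0")
    case True
    have "((\<lambda>y. C * y) \<longlongrightarrow> C * 0) (at 0 within {0..b})"
      by (intro tendsto_intros)
    then have "((\<lambda>y. C * y) \<longlongrightarrow> 0) (at 0 within {0..b})" by simp
    moreover have "\<forall>\<^sub>F x in at 0 within {0..b}. norm (g x) \<le> C * x"
      unfolding eventually_at_filter using assms(2) by (auto intro!: always_eventually)
    ultimately have "(g \<longlongrightarrow> 0) (at 0 within {0..b})"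
      by (rule Lim_null_comparison[rotated])
    then show ?thesis using True assms(3) by (simp add: continuous_within)
  next
    case False
    then have "y \<in> {0<..b}" using y by auto
    then have "continuous (at y within {0<..b}) g"
      using assms(1) by (simp add: continuous_on_eq_continuous_within)
    moreover have "at y within {0..b} = at y within {0<..b}"
      by (rule at_within_nhd[of _ "{0<..}"]) (use y False in auto)
    ultimately show ?thesis by (simp add: continuous_within)
  qed
qed

lemma inverse_one_plus_exp_le: "1 / (1 + exp s) \<le> exp (- s)" for s :: real
  by (simp add: exp_minus inverse_eq_divide frac_le)

lemma mult_fun_bound:
  assumes "l > 0" "y > 0" shows "0 \<le> mult_fun l y" "mult_fun l y \<le> 2 / l\<^sup>2 * y"
proof -
  show "0 \<le> mult_fun l y" using assms by (simp add: mult_fun_def add_nonneg_nonneg)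
  have "mult_fun l y = 1 / (1 + exp (l / y)) / y" by (simp add: mult_fun_def)
  also have "\<dots> \<le> (2 / (l / y)\<^sup>2) / y"
    using inverse_one_plus_exp_le[of "l / y"] exp_neg_le_quadratic[of "l / y"] assms
    by (intro divide_right_mono) auto
  also have "\<dots> = 2 / l\<^sup>2 * y" using assms by (simp add: field_simps power2_eq_square)
  finally show "mult_fun l y \<le> 2 / l\<^sup>2 * y" .
qed

lemma one_plus_exp_neq_0 [simp]: "1 + exp s \<noteq> (0::real)"
  using exp_gt_zero[of s] by linarith

lemma continuous_on_mult_fun:
  assumes "l > 0" shows "continuous_on {0..b} (mult_fun l)"
proof (rule continuous_on_linear_vanish)
  show "continuous_on {0<..b} (mult_fun l)"
    unfolding mult_fun_def by (intro continuous_intros) auto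
  show "\<bar>mult_fun l y\<bar> \<le> 2 / l\<^sup>2 * y" if "0 < y" "y \<le> b" for y
    using mult_fun_bound[OF assms that(1)] by simp
qed (simp add: mult_fun_def)

section \<open>The multiplier integral as a function of the tilt; existence and uniqueness of the
  multiplier\<close>

definition mult_int :: "real \<Rightarrow> real" where
  "mult_int l = integral {0..1} (mult_fun l)"

lemma mult_fun_integrable: "l > 0 \<Longrightarrow> mult_fun l integrable_on {a..b}" if "0 \<le> a"
  by (rule integrable_continuous_interval)
     (rule continuous_on_subset[OF continuous_on_mult_fun[of l b]], use that in auto)

text \<open>For \<open>l \<le> 0\<close> the integrand is at least \<open>1 / (2 * y)\<close>, whose
  integral over \<open>{e..1}\<close> is unbounded as \<open>e\<close> tends to
  \<open>0\<close>.\<close>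

lemma multiplier_pos:
  assumes "is_multiplier x l" shows "l > 0"
proof (rule ccontr)
  assume "\<not> l > 0"
  then have l: "l \<le> 0" by simp
  have int: "(mult_fun l has_integral x) {0..1}"
    using assms by (simp add: is_multiplier_def mult_fun_def [abs_def])
  have nn: "mult_fun l y \<ge> 0" if "y \<in> {0..1}" for y
    using that by (auto simp: mult_fun_def add_nonneg_nonneg)
  have bound: "ln (1 / e) \<le> 2 * x" if e: "0 < e" "e < 1" for e
  proof -
    have "((\<lambda>y. 1 / 2 * (1 / y)) has_integral (1 / 2 * ln 1 - 1 / 2 * ln e)) {e..1}"
      using e by (intro fundamental_theorem_of_calculus)
        (auto intro!: derivative_eq_intros simp: has_real_derivative_iff_has_vector_derivative[symmetric])
    moreover have "mult_fun l integrable_on {e..1}"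
      using integrable_on_subinterval[of "mult_fun l" "{0..1}" e 1] int e by auto
    moreover have "1 / 2 * (1 / y) \<le> mult_fun l y" if "y \<in> {e..1}" for y
    proof -
      have "exp (l / y) \<le> 1" using that e l by (simp add: divide_nonpos_pos)
      then have "y * (1 + exp (l / y)) \<le> y * 2" using that e by (intro mult_left_mono) auto
      moreover have "y * (1 + exp (l / y)) > 0" using that e by (intro mult_pos_pos add_pos_pos) auto
      ultimately have "1 / (y * 2) \<le> mult_fun l y"
        unfolding mult_fun_def by (intro divide_left_mono) (use that e in auto)
      then show ?thesis by (simp add: mult.commute)
    qed
    ultimately have "1 / 2 * ln 1 - 1 / 2 * ln e \<le> integral {e..1} (mult_fun l)"
      by (meson has_integral_le integrable_integral)
    also have "\<dots> \<le> integral {0..1} (mult_fun l)"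
      using e int nn \<open>mult_fun l integrable_on {e..1}\<close>
      by (intro integral_subset_le) auto
    also have "\<dots> = x" using int by (rule integral_unique)
    finally show ?thesis using e by (simp add: ln_div)
  qed
  \<comment> \<open>The logarithm equals \<open>2 * \<bar>x\<bar> + 1\<close>, which exceeds
    \<open>2 * x\<close>.\<close>
  have "ln (1 / exp (- (2 * \<bar>x\<bar> + 1))) \<le> 2 * x"
    by (rule bound) auto
  then show False by (simp add: ln_div)
qed

lemma is_multiplier_iff: "is_multiplier x l \<longleftrightarrow> l > 0 \<and> mult_int l = x"
proof
  assume *: "is_multiplier x l"
  then show "l > 0 \<and> mult_int l = x"
    using multiplier_pos[OF *]
    by (auto simp: is_multiplier_def mult_int_def mult_fun_def [abs_def] intro: integral_unique)
next
  assume "l > 0 \<and> mult_int l = x"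
  then show "is_multiplier x l"
    using integrable_integral[OF mult_fun_integrable[of 0 l 1]]
    by (auto simp: is_multiplier_def mult_int_def mult_fun_def [abs_def])
qed

text \<open>Strictness comes from continuity: a continuous nonnegative difference with integral
  \<open>0\<close> would vanish everywhere, but at \<open>y = 1\<close> it is positive.\<close>

lemma mult_int_strict_antimono:
  assumes "0 < l" "l < m" shows "mult_int m < mult_int l"
proof -
  let ?g = "\<lambda>y. mult_fun l y - mult_fun m y"
  have cont: "continuous_on {0..1} ?g"
    using assms by (intro continuous_intros continuous_on_mult_fun) auto
  have lt: "mult_fun m y < mult_fun l y" if "y > 0" for y
    unfolding mult_fun_def using that assms
    by (intro divide_strict_left_mono mult_strict_left_mono) (auto simp: divide_strict_right_mono add_pos_pos)
  have eq: "integral {0..1} ?g = mult_int l - mult_int m"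
    unfolding mult_int_def using assms
    by (intro integral_diff mult_fun_integrable) auto
  have nn: "?g y \<ge> 0" if "y \<in> {0..1}" for y
    using that lt[of y] by (cases "y = 0") (auto simp: mult_fun_def less_imp_le)
  have "integral {0..1} ?g \<ge> 0"
    using nn integrable_continuous_interval[OF cont] by (intro integral_nonneg) auto
  moreover have "integral {0..1} ?g \<noteq> 0"
  proof
    assume "integral {0..1} ?g = 0"
    then have "?g 1 = 0"
      using integral_eq_0_iff[OF cont _ nn] by auto
    then show False using lt[of 1] by simp
  qed
  ultimately show ?thesis using eq by simp
qed

lemma mult_int_antimono: "mult_int m \<le> mult_int l" if "0 < l" "l \<le> m"
  using mult_int_strict_antimono[of l m] that by (cases "l = m") auto

text \<open>Follows from \<open>l / y \<le> exp (l / y)\<close>. It supplies the right endpoint for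
  the intermediate value theorem and later the bound
  \<open>multiplier x \<le> 1 / x\<close>.\<close>

lemma mult_int_le:
  assumes "l > 0" shows "mult_int l \<le> 1 / l"
proof -
  have "mult_int l \<le> integral {0..1} (\<lambda>y::real. 1 / l)"
    unfolding mult_int_def
  proof (rule integral_le)
    show "mult_fun l integrable_on {0..1}" using assms by (intro mult_fun_integrable) auto
    fix y :: real assume y: "y \<in> {0..1}"
    show "mult_fun l y \<le> 1 / l"
    proof (cases "y = 0")
      case False
      then have "y > 0" using y by auto
      have "l / y \<le> exp (l / y)" using exp_ge_add_one_self[of "l / y"] by linarith
      then have "l \<le> y * (1 + exp (l / y))"
        using \<open>y > 0\<close> by (simp add: field_simps)
      then show ?thesis unfolding mult_fun_def using assms \<open>y > 0\<close>
        by (intro divide_left_mono) (auto simp: add_pos_pos)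
    qed (use assms in \<open>simp add: mult_fun_def\<close>)
  qed auto
  then show ?thesis by simp
qed

text \<open>On \<open>{l..1}\<close> the exponential is at most \<open>exp 1 \<le> 3\<close>, so the
  integrand is at least \<open>1 / (4 * y)\<close>. The logarithmic growth as \<open>l\<close> tends
  to \<open>0\<close> gives the left endpoint for the intermediate value theorem.\<close>

lemma mult_int_ge:
  assumes "0 < l" "l < 1" shows "mult_int l \<ge> ln (1 / l) / 4"
proof -
  have "((\<lambda>y. 1 / 4 * (1 / y)) has_integral (1 / 4 * ln 1 - 1 / 4 * ln l)) {l..1}"
    using assms by (intro fundamental_theorem_of_calculus)
      (auto intro!: derivative_eq_intros simp: has_real_derivative_iff_has_vector_derivative[symmetric])
  moreover have int: "mult_fun l integrable_on {l..1}"
    using assms by (intro mult_fun_integrable) auto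
  moreover have "1 / 4 * (1 / y) \<le> mult_fun l y" if "y \<in> {l..1}" for y
  proof -
    have "exp (l / y) \<le> exp 1" using that assms by simp
    then have "exp (l / y) \<le> 3" using exp_le by linarith
    then have "y * (1 + exp (l / y)) \<le> y * 4" using that assms by (intro mult_left_mono) auto
    moreover have "y * (1 + exp (l / y)) > 0" using that assms by (intro mult_pos_pos add_pos_pos) auto
    ultimately have "1 / (y * 4) \<le> mult_fun l y"
      unfolding mult_fun_def by (intro divide_left_mono) (use that assms in auto)
    then show ?thesis by (simp add: mult.commute)
  qed
  ultimately have "1 / 4 * ln 1 - 1 / 4 * ln l \<le> integral {l..1} (mult_fun l)"
    by (meson has_integral_le integrable_integral)
  also have "\<dots> \<le> mult_int l"
    unfolding mult_int_def
  proof (rule integral_subset_le)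
    show "mult_fun l integrable_on {0..1}" using assms by (intro mult_fun_integrable) auto
    have "0 \<le> mult_fun l y" if "y \<in> {0..1}" for y
      using that mult_fun_bound(1)[of l y] assms by (cases "y = 0") (auto simp: mult_fun_def)
    then show "\<forall>y\<in>{0..1}. 0 \<le> mult_fun l y" by blast
  qed (use assms int in auto)
  finally show ?thesis using assms by (simp add: ln_div)
qed

text \<open>Mean value theorem in \<open>l\<close> at fixed \<open>y\<close>: the derivative is at
  most \<open>exp (- z / y) / y^2\<close> in absolute value, and the quadratic decay of
  \<open>exp\<close> cancels \<open>y^2\<close>, leaving a bound uniform in
  \<open>y\<close>.\<close>

lemma mult_int_lipschitz:
  assumes "0 < a" "a \<le> l" "l \<le> m"
  shows "mult_int l - mult_int m \<le> 2 / a\<^sup>2 * (m - l)"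
proof -
  have "mult_int l - mult_int m = integral {0..1} (\<lambda>y. mult_fun l y - mult_fun m y)"
    unfolding mult_int_def using assms
    by (intro integral_diff[symmetric] mult_fun_integrable) auto
  also have "\<dots> \<le> integral {0..1} (\<lambda>y::real. 2 / a\<^sup>2 * (m - l))"
  proof (rule integral_le)
    show "(\<lambda>y. mult_fun l y - mult_fun m y) integrable_on {0..1}"
      using assms by (intro integrable_diff mult_fun_integrable) auto
    fix y :: real assume y: "y \<in> {0..1}"
    show "mult_fun l y - mult_fun m y \<le> 2 / a\<^sup>2 * (m - l)"
    proof (cases "y = 0")
      case False
      then have "y > 0" using y by auto
      have "\<exists>z\<ge>l. z \<le> m \<and> mult_fun l y - mult_fun m y = (m - l) * (exp (z / y) / (y * (1 + exp (z / y)))\<^sup>2)"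
      proof (cases "l = m")
        case False
        then have "l < m" using assms by simp
        have "\<And>z. ((\<lambda>l. - mult_fun l y) has_real_derivative exp (z / y) / (y * (1 + exp (z / y)))\<^sup>2) (at z)"
          unfolding mult_fun_def using \<open>y > 0\<close>
          by (auto intro!: derivative_eq_intros simp: power2_eq_square divide_simps)
        from MVT2[OF \<open>l < m\<close> this] show ?thesis by (auto intro: less_imp_le)
      qed (auto intro!: exI[of _ m])
      then obtain z where z: "l \<le> z" "mult_fun l y - mult_fun m y = (m - l) * (exp (z / y) / (y * (1 + exp (z / y)))\<^sup>2)"
        by blast
      have "exp (z / y) / (y * (1 + exp (z / y)))\<^sup>2 \<le> exp (z / y) / (y * exp (z / y))\<^sup>2"
        using \<open>y > 0\<close> by (intro divide_left_mono power_mono mult_left_mono) (auto simp: add_pos_pos)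
      also have "\<dots> = exp (- (z / y)) / y\<^sup>2"
        by (simp add: power2_eq_square exp_minus field_simps)
      also have "\<dots> \<le> 2 / (z / y)\<^sup>2 / y\<^sup>2"
        using exp_neg_le_quadratic[of "z / y"] \<open>y > 0\<close> z assms by (intro divide_right_mono) auto
      also have "\<dots> = 2 / z\<^sup>2" using \<open>y > 0\<close> by (simp add: field_simps)
      also have "\<dots> \<le> 2 / a\<^sup>2"
        using z assms by (intro divide_left_mono power_mono) auto
      finally have "(m - l) * (exp (z / y) / (y * (1 + exp (z / y)))\<^sup>2) \<le> (m - l) * (2 / a\<^sup>2)"
        using assms by (intro mult_left_mono) auto
      then show ?thesis using z by (simp add: mult.commute)
    qed (use assms in \<open>simp add: mult_fun_def\<close>)
  qed auto
  finally show ?thesis by simp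
qed

lemma continuous_on_mult_int:
  assumes "0 < a" shows "continuous_on {a..b} mult_int"
proof (rule lipschitz_on_continuous_on[of "2 / a\<^sup>2"], rule lipschitz_onI)
  fix l m assume lm: "l \<in> {a..b}" "m \<in> {a..b}"
  have mono: "mult_int m \<le> mult_int l" if "0 < l" "l \<le> m" for l m
    using mult_int_strict_antimono[of l m] that by (cases "l = m") auto
  show "dist (mult_int l) (mult_int m) \<le> 2 / a\<^sup>2 * dist l m"
  proof (cases "l \<le> m")
    case True
    then show ?thesis
      using mult_int_lipschitz[OF assms, of l m] mono[of l m] lm assms by (auto simp: dist_real_def)
  next
    case False
    then show ?thesis
      using mult_int_lipschitz[OF assms, of m l] mono[of m l] lm assms by (auto simp: dist_real_def)
  qed
qed auto

lemma multiplier_ex1: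
  assumes "x > 0" shows "\<exists>!l. is_multiplier x l"
proof -
  \<comment> \<open>Chosen so that \<open>mult_int_ge\<close> yields
    \<open>mult_int a \<ge> (4 * x + 1) / 4\<close>.\<close>
  define a where "a = exp (- 4 * x - 1)"
  define b where "b = max 1 (1 / x)"
  have a: "0 < a" "a < 1" using assms by (auto simp: a_def)
  have b: "b > 0" "1 / b \<le> x" using assms by (auto simp: b_def max_def field_simps)
  have "a \<le> b" using a by (auto simp: b_def)
  have "mult_int a \<ge> x" using mult_int_ge[OF a] by (simp add: a_def ln_div)
  moreover have "mult_int b \<le> x" using mult_int_le[OF b(1)] b by linarith
  ultimately obtain l where "a \<le> l" "mult_int l = x"
    using IVT2'[of mult_int b x a] \<open>a \<le> b\<close> continuous_on_mult_int[OF a(1)] by auto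
  then have "is_multiplier x l" using a by (simp add: is_multiplier_iff)
  moreover have "m = l" if "is_multiplier x m" "is_multiplier x l" for m l
    using that mult_int_strict_antimono[of m l] mult_int_strict_antimono[of l m]
    by (auto simp: is_multiplier_iff intro: ccontr) (metis linorder_neq_iff)
  ultimately show ?thesis by blast
qed

lemma multiplier:
  assumes "x > 0" shows "multiplier x > 0" "mult_int (multiplier x) = x"
  using theI'[OF multiplier_ex1[OF assms]] by (auto simp: multiplier_def is_multiplier_iff)

lemma multiplier_strict_antimono:
  assumes "0 < x" "x < z" shows "multiplier z < multiplier x"
proof (rule ccontr)
  assume "\<not> multiplier z < multiplier x"
  then have "multiplier x \<le> multiplier z" by simp
  then have "mult_int (multiplier z) \<le> mult_int (multiplier x)"
    using mult_int_strict_antimono[of "multiplier x" "multiplier z"] multiplier(1)[of x] assms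
    by (cases "multiplier x = multiplier z") auto
  then show False using multiplier(2)[of x] multiplier(2)[of z] assms by simp
qed

section \<open>Entropy integral, closed form and limits of the growth constant\<close>

text \<open>With \<open>p = 1 / (1 + exp s)\<close> one has
  \<open>- ln p = s + ln (1 + exp (- s))\<close> and
  \<open>- ln (1 - p) = ln (1 + exp (- s))\<close>; averaging leaves log partition function plus
  \<open>s\<close> times mean. For \<open>s = l / y\<close> this is the derivative of
  \<open>y * ln (1 + exp (- l / y))\<close>.\<close>

lemma entropy_fermi:
  fixes s :: real
  shows "binary_entropy (1 / (1 + exp s)) * ln 2 = ln (1 + exp (- s)) + s / (1 + exp s)"
proof -
  have q: "1 - 1 / (1 + exp s) = 1 / (1 + exp (- s))"
    by (simp add: exp_minus field_simps)
  have p: "0 < 1 / (1 + exp s)" "1 / (1 + exp s) \<noteq> 1" by (auto simp: add_pos_pos)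
  have "ln (1 / (1 + exp s)) = - s - ln (1 + exp (- s))"
  proof -
    have "1 + exp s = exp s * (1 + exp (- s))" by (simp add: exp_minus field_simps)
    then have "ln (1 + exp s) = s + ln (1 + exp (- s))"
      by (simp add: ln_mult add_pos_pos)
    then show ?thesis by (simp add: ln_div add_pos_pos)
  qed
  moreover have "ln (1 / (1 + exp (- s))) = - ln (1 + exp (- s))"
    by (simp add: ln_div add_pos_pos)
  ultimately have "binary_entropy (1 / (1 + exp s)) * ln 2
     = - (1 / (1 + exp s)) * (- s - ln (1 + exp (- s))) - (1 / (1 + exp (- s))) * (- ln (1 + exp (- s)))"
  proof -
    have *: "binary_entropy (1 / (1 + exp s)) = - (1 / (1 + exp s)) * log 2 (1 / (1 + exp s))
        - (1 / (1 + exp (- s))) * log 2 (1 / (1 + exp (- s)))"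
      using p unfolding binary_entropy_def q by simp
    have "log 2 z * ln 2 = ln z" for z :: real by (simp add: log_def)
    then show ?thesis unfolding * \<open>ln (1 / (1 + exp s)) = _\<close> [symmetric]
        \<open>ln (1 / (1 + exp (- s))) = _\<close> [symmetric]
      by (simp only: left_diff_distrib mult.assoc)
  qed
  also have "\<dots> = s / (1 + exp s) + (1 / (1 + exp s) + 1 / (1 + exp (- s))) * ln (1 + exp (- s))"
    by (simp add: algebra_simps)
  also have "1 / (1 + exp s) + 1 / (1 + exp (- s)) = 1" using q by simp
  finally show ?thesis by simp
qed

lemma entropy_integral:
  assumes "l > 0"
  shows "((\<lambda>y. binary_entropy (1 / (1 + exp (l / y)))) has_integral log 2 (1 + exp (- l))) {0..1}"
proof -
  define g where "g y = y * ln (1 + exp (- (l / y)))" for y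
  define h where "h y = binary_entropy (1 / (1 + exp (l / y)))" for y
  have cont: "continuous_on {0..1} g"
  proof (rule continuous_on_linear_vanish)
    show "continuous_on {0<..1} g"
      unfolding g_def by (intro continuous_intros) auto
    show "\<bar>g y\<bar> \<le> ln 2 * y" if "0 < y" "y \<le> 1" for y
    proof -
      have "ln (1 + exp (- (l / y))) \<le> ln 2" using that assms by (simp add: add_pos_pos)
      moreover have "ln (1 + exp (- (l / y))) \<ge> 0" by simp
      ultimately show ?thesis using that by (simp add: g_def abs_mult mult.commute)
    qed
  qed (simp add: g_def)
  have "(g has_vector_derivative h y * ln 2) (at y)" if "y \<in> {0<..<1}" for y
  proof -
    have "(g has_real_derivative (ln (1 + exp (- (l / y))) + y * (exp (- (l / y)) * (l / y\<^sup>2) / (1 + exp (- (l / y)))))) (at y)"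
      unfolding g_def using that by (auto intro!: derivative_eq_intros simp: power2_eq_square add_pos_pos)
    also have "y * (exp (- (l / y)) * (l / y\<^sup>2) / (1 + exp (- (l / y)))) = (l / y) / (1 + exp (l / y))"
    proof -
      have "exp (- (l / y)) / (1 + exp (- (l / y))) = 1 / (1 + exp (l / y))"
        by (simp add: exp_minus field_simps)
      moreover have "y * (exp (- (l / y)) * (l / y\<^sup>2) / (1 + exp (- (l / y))))
          = (l / y) * (exp (- (l / y)) / (1 + exp (- (l / y))))"
        using that by (simp add: power2_eq_square)
      ultimately show ?thesis by simp
    qed
    finally show ?thesis
      using entropy_fermi[of "l / y"] by (simp add: h_def has_real_derivative_iff_has_vector_derivative)
  qed
  then have "((\<lambda>y. h y * ln 2) has_integral (g 1 - g 0)) {0..1}"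
    using cont by (intro fundamental_theorem_of_calculus_interior) auto
  then have "((\<lambda>y. h y * ln 2 * (1 / ln 2)) has_integral (g 1 - g 0) * (1 / ln 2)) {0..1}"
    by (rule has_integral_mult_left)
  then show ?thesis by (simp add: h_def [abs_def] g_def log_def)
qed

lemma growth_const_eq:
  "growth_const x = log 2 (1 + exp (- multiplier x))" if "x > 0"
  unfolding growth_const_def using entropy_integral[OF multiplier(1)[OF that]] by (rule integral_unique)

lemma growth_const_strict_mono: "strict_mono_on {0<..} growth_const"
proof (rule strict_mono_onI)
  fix r s :: real assume "r \<in> {0<..}" "s \<in> {0<..}" "r < s"
  then show "growth_const r < growth_const s"
    using multiplier_strict_antimono[of r s] by (simp add: growth_const_eq add_pos_pos)
qed

lemma growth_const_tendsto_0: "(growth_const \<longlongrightarrow> 0) (at_right 0)"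
proof -
  have lim: "filterlim multiplier at_top (at_right 0)"
    unfolding filterlim_at_top
  proof
    fix Z :: real
    define b where "b = max Z 1"
    have "b > 0" by (simp add: b_def)
    \<comment> \<open>Strict comparison with a nonnegative value is the quickest way to
      \<open>mult_int b > 0\<close>; then every \<open>x\<close> below \<open>mult_int b\<close> has
      a multiplier of at least \<open>b\<close>.\<close>
    then have "mult_int b > mult_int (b + 1)" by (intro mult_int_strict_antimono) auto
    moreover have "mult_int (b + 1) \<ge> 0"
      unfolding mult_int_def
    proof (rule integral_nonneg)
      show "mult_fun (b + 1) integrable_on {0..1}" using \<open>b > 0\<close> by (intro mult_fun_integrable) auto
      show "0 \<le> mult_fun (b + 1) y" if "y \<in> {0..1}" for y
        using that mult_fun_bound(1)[of "b + 1" y] \<open>b > 0\<close> by (cases "y = 0") (auto simp: mult_fun_def)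
    qed
    ultimately have pos: "mult_int b > 0" by linarith
    have "Z \<le> multiplier x" if "0 < x" "x < mult_int b" for x
    proof (rule ccontr)
      assume "\<not> Z \<le> multiplier x"
      then have "multiplier x < b" by (simp add: b_def)
      then have "mult_int b < x"
        using mult_int_strict_antimono[of "multiplier x" b] multiplier[OF that(1)] by simp
      then show False using that by simp
    qed
    then show "\<forall>\<^sub>F x in at_right 0. Z \<le> multiplier x"
      unfolding eventually_at_right_field using pos by blast
  qed
  have "((\<lambda>x. log 2 (1 + exp (- multiplier x))) \<longlongrightarrow> log 2 (1 + 0)) (at_right 0)"
    by (intro tendsto_intros filterlim_compose[OF exp_at_bot] filterlim_compose[OF filterlim_uminus_at_bot_at_top] lim) auto
  then have "((\<lambda>x. log 2 (1 + exp (- multiplier x))) \<longlongrightarrow> 0) (at_right 0)" by simp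
  moreover have "\<forall>\<^sub>F x in at_right 0. log 2 (1 + exp (- multiplier x)) = growth_const x"
    unfolding eventually_at_right_field by (auto intro!: exI[of _ 1] simp: growth_const_eq)
  ultimately show ?thesis by (rule Lim_transform_eventually)
qed

lemma growth_const_tendsto_1: "(growth_const \<longlongrightarrow> 1) at_top"
proof -
  have lim: "(multiplier \<longlongrightarrow> 0) at_top"
  proof (rule tendsto_sandwich[of "\<lambda>_. 0" _ _ "\<lambda>x. 1 / x"])
    show "\<forall>\<^sub>F x in at_top. 0 \<le> multiplier x"
      using eventually_gt_at_top[of 0] by eventually_elim (use multiplier(1) in \<open>auto intro: less_imp_le\<close>)
    show "\<forall>\<^sub>F x in at_top. multiplier x \<le> 1 / x"
      using eventually_gt_at_top[of 0]
    proof eventually_elim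
      case (elim x)
      then have "x \<le> 1 / multiplier x" using mult_int_le[OF multiplier(1)[of x]] multiplier(2)[of x] by simp
      then show ?case using elim multiplier(1)[of x] by (simp add: field_simps)
    qed
    show "((\<lambda>x::real. 1 / x) \<longlongrightarrow> 0) at_top"
      by (intro tendsto_divide_0[OF tendsto_const] filterlim_at_top_imp_at_infinity filterlim_ident)
  qed auto
  have "((\<lambda>x. log 2 (1 + exp (- multiplier x))) \<longlongrightarrow> log 2 (1 + exp (- 0))) at_top"
    by (intro tendsto_intros lim) auto
  then have "((\<lambda>x. log 2 (1 + exp (- multiplier x))) \<longlongrightarrow> 1) at_top" by simp
  moreover have "\<forall>\<^sub>F x in at_top. log 2 (1 + exp (- multiplier x)) = growth_const x"
    using eventually_gt_at_top[of 0] by eventually_elim (simp add: growth_const_eq)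
  ultimately show ?thesis by (rule Lim_transform_eventually)
qed

section \<open>Tilted counting\<close>

lemma sum_Pow_insert:
  assumes "finite M" "b \<notin> M"
  shows "(\<Sum>A\<in>Pow (insert b M). f A) = (\<Sum>A\<in>Pow M. f A) + (\<Sum>A\<in>Pow M. f (insert b A))"
proof -
  have "inj_on (insert b) (Pow M)" using assms by (auto simp: inj_on_def)
  moreover have "Pow M \<inter> insert b ` Pow M = {}" using assms by auto
  ultimately show ?thesis
    using assms by (simp add: Pow_insert sum.union_disjoint sum.reindex)
qed

lemma sum_Pow_prod:
  fixes w :: "'a \<Rightarrow> real"
  assumes "finite M"
  shows "(\<Sum>A\<in>Pow M. \<Prod>a\<in>A. w a) = (\<Prod>a\<in>M. 1 + w a)"
  using assms
proof (induction M)
  case (insert b M)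
  have "(\<Sum>A\<in>Pow M. \<Prod>a\<in>insert b A. w a) = (\<Sum>A\<in>Pow M. w b * (\<Prod>a\<in>A. w a))"
    using insert by (intro sum.cong refl prod.insert) (auto intro: finite_subset)
  then show ?case
    using insert by (simp add: sum_Pow_insert sum_distrib_left[symmetric] algebra_simps)
qed simp

text \<open>Up to the factor \<open>\<Prod>(1 + w a)\<close>, this is the second moment about \<open>t\<close> of the sum of \<open>f\<close> over
  the random set containing each \<open>a\<close> independently with probability \<open>w a / (1 + w a)\<close>.\<close>

lemma second_moment_Pow:
  fixes w f :: "'a \<Rightarrow> real"
  assumes "finite M" "\<And>a. a \<in> M \<Longrightarrow> w a > 0"
  shows "(\<Sum>A\<in>Pow M. (\<Prod>a\<in>A. w a) * (sum f A - t)\<^sup>2) =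
    (\<Prod>a\<in>M. 1 + w a) * ((\<Sum>a\<in>M. w a * (f a)\<^sup>2 / (1 + w a)\<^sup>2) + ((\<Sum>a\<in>M. w a * f a / (1 + w a)) - t)\<^sup>2)"
  using assms
proof (induction M arbitrary: t)
  case (insert b M)
  have fin: "finite A" if "A \<in> Pow M" for A using that insert.hyps by (auto intro: finite_subset)
  have nb: "b \<notin> A" if "A \<in> Pow M" for A using that insert.hyps by auto
  define P where "P = (\<Prod>a\<in>M. 1 + w a)"
  define V where "V = (\<Sum>a\<in>M. w a * (f a)\<^sup>2 / (1 + w a)\<^sup>2)"
  define m where "m = (\<Sum>a\<in>M. w a * f a / (1 + w a))"
  have IH: "(\<Sum>A\<in>Pow M. (\<Prod>a\<in>A. w a) * (sum f A - t)\<^sup>2) = P * (V + (m - t)\<^sup>2)" for t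
    using insert by (simp add: P_def V_def m_def)
  have "(\<Sum>A\<in>Pow M. (\<Prod>a\<in>insert b A. w a) * (sum f (insert b A) - t)\<^sup>2)
     = (\<Sum>A\<in>Pow M. w b * ((\<Prod>a\<in>A. w a) * (sum f A - (t - f b))\<^sup>2))"
    using fin nb by (intro sum.cong refl) (simp add: algebra_simps)
  also have "\<dots> = w b * (P * (V + (m - (t - f b))\<^sup>2))"
    by (simp only: sum_distrib_left[symmetric] IH)
  finally have "(\<Sum>A\<in>Pow (insert b M). (\<Prod>a\<in>A. w a) * (sum f A - t)\<^sup>2)
     = P * (V + (m - t)\<^sup>2) + w b * (P * (V + (m - (t - f b))\<^sup>2))"
    using insert.hyps by (subst sum_Pow_insert) (simp_all only: IH not_False_eq_True)
  also have "\<dots> = ((1 + w b) * P) * ((w b * (f b)\<^sup>2 / (1 + w b)\<^sup>2 + V) + ((w b * f b / (1 + w b) + m) - t)\<^sup>2)"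
  proof -
    have "w b > 0" using insert.prems by simp
    define c where "c = 1 + w b"
    have c: "c \<noteq> 0" "w b = c - 1" using \<open>w b > 0\<close> by (auto simp: c_def)
    \<comment> \<open>Bias-variance decomposition for one variable with values \<open>0\<close> and
      \<open>f b\<close> of weights \<open>1\<close> and \<open>w b\<close>.\<close>
    have "(m - t)\<^sup>2 + w b * (m - (t - f b))\<^sup>2 = c * (w b * (f b)\<^sup>2 / c\<^sup>2 + ((w b * f b / c + m) - t)\<^sup>2)"
      using c(1) unfolding c(2) by (simp add: divide_simps) algebra
    then show ?thesis unfolding c_def [symmetric] using c(2) by algebra
  qed
  finally show ?case using insert.hyps by (simp add: P_def V_def m_def)
qed auto

lemma prod_exp_neg_sum:
  fixes u :: real
  shows "finite A \<Longrightarrow> (\<Prod>a\<in>A. exp (- u / real a)) = exp (- u * (\<Sum>a\<in>A. 1 / real a))"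
  by (simp add: exp_sum [symmetric] sum_distrib_left)

lemma card_sum_eq_le:
  assumes "finite M"
  shows "real (card {A. A \<subseteq> M \<and> (\<Sum>a\<in>A. 1 / real a) = x}) \<le> (\<Prod>a\<in>M. 1 + exp (- u / real a)) * exp (u * x)"
proof -
  let ?S = "{A. A \<subseteq> M \<and> (\<Sum>a\<in>A. 1 / real a) = x}"
  have fin: "finite A" if "A \<subseteq> M" for A using that assms by (rule finite_subset)
  have "real (card ?S) * exp (- u * x) = (\<Sum>A\<in>?S. exp (- u * x))" by simp
  also have "\<dots> = (\<Sum>A\<in>?S. (\<Prod>a\<in>A. exp (- u / real a)))"
  proof (intro sum.cong refl)
    fix A assume "A \<in> ?S"
    then show "exp (- u * x) = (\<Prod>a\<in>A. exp (- u / real a))"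
      using prod_exp_neg_sum[OF fin, of A u] by simp
  qed
  also have "\<dots> \<le> (\<Sum>A\<in>Pow M. (\<Prod>a\<in>A. exp (- u / real a)))"
    using assms by (intro sum_mono2) (auto intro: prod_nonneg)
  also have "\<dots> = (\<Prod>a\<in>M. 1 + exp (- u / real a))"
    using assms by (rule sum_Pow_prod)
  finally have "real (card ?S) * exp (- u * x) * exp (u * x) \<le> (\<Prod>a\<in>M. 1 + exp (- u / real a)) * exp (u * x)"
    by (intro mult_right_mono) auto
  then show ?thesis by (simp add: mult.assoc flip: exp_add)
qed

text \<open>Chebyshev's inequality under the tilted measure: the hypothesis on \<rho> puts at least
  half of the total weight on sums within \<rho> of the mean, and each such set has weight at most
  \<open>exp (- u * (m - \<rho>))\<close>.\<close>

lemma card_sum_near_mean_ge: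
  fixes u \<rho> :: real
  assumes "finite M" "u \<ge> 0" "\<rho> > 0"
    and m: "m = (\<Sum>a\<in>M. 1 / real a / (1 + exp (u / real a)))"
    and v: "2 * (\<Sum>a\<in>M. exp (- u / real a) / (real a)\<^sup>2) \<le> \<rho>\<^sup>2"
  shows "(\<Prod>a\<in>M. 1 + exp (- u / real a)) / 2 * exp (u * (m - \<rho>))
     \<le> real (card {A. A \<subseteq> M \<and> \<bar>(\<Sum>a\<in>A. 1 / real a) - m\<bar> \<le> \<rho>})"
proof -
  define w where "w a = exp (- u / real a)" for a
  define f where "f a = 1 / real a" for a
  define Z where "Z = (\<Prod>a\<in>M. 1 + w a)"
  define G where "G = {A. A \<subseteq> M \<and> \<bar>sum f A - m\<bar> \<le> \<rho>}"
  have Zpos: "Z > 0" unfolding Z_def w_def by (intro prod_pos) (auto intro: add_pos_pos)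
  have GP: "G \<subseteq> Pow M" "finite (Pow M)" using assms(1) by (auto simp: G_def)
  have wf: "w a * f a / (1 + w a) = 1 / real a / (1 + exp (u / real a))" for a
    unfolding w_def f_def by (simp add: exp_minus field_simps)
  have "(\<Sum>A\<in>Pow M. (\<Prod>a\<in>A. w a) * (sum f A - m)\<^sup>2) = Z * (\<Sum>a\<in>M. w a * (f a)\<^sup>2 / (1 + w a)\<^sup>2)"
    using second_moment_Pow[OF assms(1), of w f m] unfolding wf m[symmetric]
    by (simp add: Z_def w_def)
  also have "(\<Sum>a\<in>M. w a * (f a)\<^sup>2 / (1 + w a)\<^sup>2) \<le> (\<Sum>a\<in>M. w a * (f a)\<^sup>2 / 1)"
    by (intro sum_mono divide_left_mono one_le_power) (auto simp: w_def intro!: mult_nonneg_nonneg add_pos_pos)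
  also have "\<dots> \<le> \<rho>\<^sup>2 / 2" using v by (simp add: w_def f_def power_divide)
  finally have var: "(\<Sum>A\<in>Pow M. (\<Prod>a\<in>A. w a) * (sum f A - m)\<^sup>2) \<le> Z * (\<rho>\<^sup>2 / 2)"
    using Zpos by simp
  have "\<rho>\<^sup>2 * (\<Sum>A\<in>Pow M - G. \<Prod>a\<in>A. w a) = (\<Sum>A\<in>Pow M - G. (\<Prod>a\<in>A. w a) * \<rho>\<^sup>2)"
    by (simp add: sum_distrib_left mult.commute)
  also have "\<dots> \<le> (\<Sum>A\<in>Pow M - G. (\<Prod>a\<in>A. w a) * (sum f A - m)\<^sup>2)"
  proof (intro sum_mono mult_left_mono prod_nonneg)
    fix A assume "A \<in> Pow M - G"
    then have "\<rho> \<le> \<bar>sum f A - m\<bar>" by (auto simp: G_def)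
    then show "\<rho>\<^sup>2 \<le> (sum f A - m)\<^sup>2" using assms(3) by (simp add: abs_le_square_iff[symmetric])
  qed (auto simp: w_def)
  also have "\<dots> \<le> (\<Sum>A\<in>Pow M. (\<Prod>a\<in>A. w a) * (sum f A - m)\<^sup>2)"
    using GP by (intro sum_mono2) (auto intro!: prod_nonneg mult_nonneg_nonneg simp: w_def)
  also note var
  finally have "(\<Sum>A\<in>Pow M - G. \<Prod>a\<in>A. w a) \<le> Z / 2" using assms(3) by simp
  moreover have "(\<Sum>A\<in>Pow M - G. \<Prod>a\<in>A. w a) + (\<Sum>A\<in>G. \<Prod>a\<in>A. w a) = Z"
    unfolding Z_def sum_Pow_prod[OF assms(1), symmetric] using GP
    by (intro sum.subset_diff[symmetric]) auto
  ultimately have "Z / 2 \<le> (\<Sum>A\<in>G. \<Prod>a\<in>A. w a)" by simp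
  also have "\<dots> \<le> (\<Sum>A\<in>G. exp (- u * (m - \<rho>)))"
  proof (intro sum_mono)
    fix A assume "A \<in> G"
    then have A: "finite A" "m - \<rho> \<le> sum f A" using assms(1) by (auto simp: G_def intro: finite_subset)
    have "u * (m - \<rho>) \<le> u * sum f A" using A assms by (intro mult_left_mono) auto
    then show "(\<Prod>a\<in>A. w a) \<le> exp (- u * (m - \<rho>))"
      unfolding w_def prod_exp_neg_sum[OF A(1)] by (simp add: f_def)
  qed
  also have "\<dots> = real (card G) * exp (- u * (m - \<rho>))" by simp
  finally have "Z / 2 * exp (u * (m - \<rho>)) \<le> real (card G) * exp (- u * (m - \<rho>)) * exp (u * (m - \<rho>))"
    by (intro mult_right_mono) auto
  also have "\<dots> = real (card G)" by (simp add: mult.assoc flip: exp_add)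
  finally show ?thesis by (simp add: Z_def G_def w_def f_def)
qed

section \<open>Riemann sums and the exponential rate of the partition function\<close>

text \<open>For a monotone function the error telescopes to \<open>f 1 - f 0\<close>, independent of
  \<open>n\<close>. For \<open>log_part_fun\<close> this is at most \<open>ln 2\<close>, which is
  why the partition function is determined up to a factor \<open>2\<close>.\<close>

lemma mono_riemann_sum:
  fixes f :: "real \<Rightarrow> real"
  assumes mono: "mono_on {0..1} f" and cont: "continuous_on {0..1} f" and "n > 0"
  shows "real n * integral {0..1} f \<le> (\<Sum>a=1..n. f (real a / real n))"
    and "(\<Sum>a=1..n. f (real a / real n)) \<le> real n * integral {0..1} f + f 1 - f 0"
proof -
  have int: "f integrable_on {a..b}" if "0 \<le> a" "b \<le> 1" for a b
    by (rule integrable_continuous_interval, rule continuous_on_subset[OF cont]) (use that in auto)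
  have step: "f (real m / real n) \<le> real n * integral {real m / real n..real (Suc m) / real n} f \<and>
     real n * integral {real m / real n..real (Suc m) / real n} f \<le> f (real (Suc m) / real n)"
    if "Suc m \<le> n" for m
  proof -
    define a b where "a = real m / real n" "b = real (Suc m) / real n"
    have ab: "0 \<le> a" "a \<le> b" "b \<le> 1" "b - a = 1 / real n"
      using that \<open>n > 0\<close> by (auto simp: a_b_def divide_simps)
    have "integral {a..b} (\<lambda>_. f a) \<le> integral {a..b} f"
      using ab by (intro integral_le int) (auto intro!: mono_onD[OF mono])
    moreover have "integral {a..b} f \<le> integral {a..b} (\<lambda>_. f b)"
      using ab by (intro integral_le int) (auto intro!: mono_onD[OF mono])
    ultimately show ?thesis unfolding a_b_def[symmetric] using ab \<open>n > 0\<close> by (simp add: field_simps)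
  qed
  have "real n * integral {0..real m / real n} f \<le> (\<Sum>a=1..m. f (real a / real n)) \<and>
     (\<Sum>a=1..m. f (real a / real n)) \<le> real n * integral {0..real m / real n} f + f (real m / real n) - f 0"
    if "m \<le> n" for m
    using that
  proof (induction m)
    case (Suc m)
    have "integral {0..real m / real n} f + integral {real m / real n..real (Suc m) / real n} f
       = integral {0..real (Suc m) / real n} f"
      using Suc.prems \<open>n > 0\<close> by (intro Henstock_Kurzweil_Integration.integral_combine int)
        (auto simp: divide_simps)
    then have "real n * integral {0..real (Suc m) / real n} f =
        real n * integral {0..real m / real n} f + real n * integral {real m / real n..real (Suc m) / real n} f"
      by (simp flip: distrib_left)
    then show ?case using Suc.IH Suc.prems step[of m] by simp
  qed simp
  from this[of n] show "real n * integral {0..1} f \<le> (\<Sum>a=1..n. f (real a / real n))"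
    and "(\<Sum>a=1..n. f (real a / real n)) \<le> real n * integral {0..1} f + f 1 - f 0"
    using \<open>n > 0\<close> by auto
qed

text \<open>The case distinction makes the function continuous at \<open>0\<close>, where \<open>- l / 0 = 0\<close>.\<close>

definition log_part_fun :: "real \<Rightarrow> real \<Rightarrow> real" where
  "log_part_fun l y = (if y = 0 then 0 else ln (1 + exp (- l / y)))"

definition log_part_int :: "real \<Rightarrow> real" where
  "log_part_int l = integral {0..1} (log_part_fun l)"

lemma log_part_fun_bounds: "0 \<le> log_part_fun l y" "log_part_fun l y \<le> exp (- l / y)"
  by (auto simp: log_part_fun_def ln_add_one_self_le_self)

lemma continuous_on_log_part_fun:
  assumes "l > 0" shows "continuous_on {0..1} (log_part_fun l)"
proof (rule continuous_on_linear_vanish)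
  have "continuous_on {0<..1} (\<lambda>y. ln (1 + exp (- l / y)))"
    by (intro continuous_intros) (auto simp: add_pos_pos)
  then show "continuous_on {0<..1} (log_part_fun l)"
    by (rule continuous_on_eq) (auto simp: log_part_fun_def)
  fix y :: real assume y: "0 < y" "y \<le> 1"
  have "log_part_fun l y \<le> exp (- (l / y))" using log_part_fun_bounds(2)[of l y] by simp
  also have "\<dots> \<le> 2 / (l / y)\<^sup>2" using y assms by (intro exp_neg_le_quadratic) auto
  also have "\<dots> = 2 / l\<^sup>2 * y * y" by (simp add: power2_eq_square)
  also have "\<dots> \<le> 2 / l\<^sup>2 * y * 1" using y by (intro mult_left_mono) auto
  finally show "\<bar>log_part_fun l y\<bar> \<le> 2 / l\<^sup>2 * y" using log_part_fun_bounds(1)[of l y] by simp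
qed (simp add: log_part_fun_def)

lemma mono_log_part_fun:
  assumes "l > 0" shows "mono_on {0..1} (log_part_fun l)"
proof (rule mono_onI)
  fix y z :: real assume "y \<in> {0..1}" "z \<in> {0..1}" "y \<le> z"
  then show "log_part_fun l y \<le> log_part_fun l z"
    using log_part_fun_bounds(1)[of l z] assms
    by (cases "y = 0") (auto simp: log_part_fun_def add_pos_pos intro!: divide_left_mono)
qed

lemma partition_function_bounds:
  assumes "l > 0" "n > 0"
  shows "exp (real n * log_part_int l) \<le> (\<Prod>a=1..n. 1 + exp (- (l * real n) / real a))"
    and "(\<Prod>a=1..n. 1 + exp (- (l * real n) / real a)) \<le> 2 * exp (real n * log_part_int l)"
proof -
  have pos: "(\<Prod>a=1..n. 1 + exp (- (l * real n) / real a)) > 0"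
    by (intro prod_pos) (auto simp: add_pos_pos)
  have "ln (\<Prod>a=1..n. 1 + exp (- (l * real n) / real a)) = (\<Sum>a=1..n. ln (1 + exp (- (l * real n) / real a)))"
    by (intro ln_prod) (auto simp: add_pos_pos)
  also have "\<dots> = (\<Sum>a=1..n. log_part_fun l (real a / real n))"
    using assms by (intro sum.cong) (auto simp: log_part_fun_def)
  finally have eq: "ln (\<Prod>a=1..n. 1 + exp (- (l * real n) / real a)) = \<dots>" .
  note R = mono_riemann_sum[OF mono_log_part_fun continuous_on_log_part_fun, OF assms(1,1,2)]
  have "real n * log_part_int l \<le> ln (\<Prod>a=1..n. 1 + exp (- (l * real n) / real a))"
    unfolding eq log_part_int_def by (rule R(1))
  then show "exp (real n * log_part_int l) \<le> (\<Prod>a=1..n. 1 + exp (- (l * real n) / real a))"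
    using pos by (simp add: ln_ge_iff)
  have "log_part_fun l 1 \<le> ln 2" using assms by (auto simp: log_part_fun_def add_pos_pos)
  then have "ln (\<Prod>a=1..n. 1 + exp (- (l * real n) / real a)) \<le> real n * log_part_int l + ln 2"
    using R(2) unfolding eq log_part_int_def by (simp add: log_part_fun_def)
  then have "(\<Prod>a=1..n. 1 + exp (- (l * real n) / real a)) \<le> exp (real n * log_part_int l + ln 2)"
    using pos by (metis exp_le_cancel_iff exp_ln)
  then show "(\<Prod>a=1..n. 1 + exp (- (l * real n) / real a)) \<le> 2 * exp (real n * log_part_int l)"
    by (simp add: exp_add mult.commute)
qed

text \<open>The convex function \<open>ln (1 + exp (- r))\<close> lies above its tangent at
  \<open>s\<close>, whose slope is \<open>- 1 / (1 + exp s)\<close>. This is Gibbs' inequality for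
  one Bernoulli variable, with entropy on the left and cross entropy on the right; the proof is
  two-point convexity of \<open>exp\<close>.\<close>

lemma softplus_tangent:
  fixes s r :: real
  shows "ln (1 + exp (- s)) + s / (1 + exp s) \<le> ln (1 + exp (- r)) + r / (1 + exp s)"
proof -
  define p where "p = 1 / (1 + exp s)"
  have p: "0 < p" "p < 1" by (auto simp: p_def add_pos_pos)
  have p': "p = exp (- s) / (1 + exp (- s))" "1 - p = 1 / (1 + exp (- s))"
    by (simp_all add: p_def exp_minus field_simps)
  have "exp (p * (s - r)) \<le> (1 - p) * exp 0 + p * exp (s - r)"
    using convex_onD[OF exp_convex, of p 0 "s - r"] p by simp
  also have "\<dots> = (1 + exp (- r)) / (1 + exp (- s))"
  proof -
    have "exp (s - r) = exp (- r) / exp (- s)" by (simp flip: exp_diff)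
    then show ?thesis unfolding p'(2) unfolding p'(1) by (simp add: add_divide_distrib)
  qed
  finally have "p * (s - r) \<le> ln ((1 + exp (- r)) / (1 + exp (- s)))"
    by (subst ln_ge_iff) (auto simp: add_pos_pos)
  also have "\<dots> = ln (1 + exp (- r)) - ln (1 + exp (- s))"
    by (simp add: ln_div add_pos_pos)
  finally show ?thesis by (simp add: p_def algebra_simps diff_divide_distrib)
qed

text \<open>Legendre duality: \<open>growth_const x * ln 2\<close> is the minimum over
  \<open>l\<close> of \<open>log_part_int l + l * x\<close>, attained at the multiplier. The
  equality serves the upper bound on the count, the inequality the lower bound.\<close>

lemma log_part_ge_growth:
  assumes "x > 0" "l > 0"
  shows "growth_const x * ln 2 \<le> log_part_int l + l * x"
    and "l = multiplier x \<Longrightarrow> growth_const x * ln 2 = log_part_int l + l * x"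
proof -
  define k where "k = multiplier x"
  have k: "k > 0" "mult_int k = x" using multiplier[OF assms(1)] by (auto simp: k_def)
  have H: "((\<lambda>y. binary_entropy (1 / (1 + exp (k / y))) * ln 2) has_integral growth_const x * ln 2) {0..1}"
    unfolding growth_const_eq[OF assms(1)] k_def[symmetric]
    by (rule has_integral_mult_left[OF entropy_integral[OF k(1)]])
  have L: "((\<lambda>y. log_part_fun l y + l * mult_fun k y) has_integral log_part_int l + l * x) {0..1}" if "l > 0" for l
  proof (intro has_integral_add has_integral_mult_right)
    show "(log_part_fun l has_integral log_part_int l) {0..1}"
      unfolding log_part_int_def
      by (intro integrable_integral integrable_continuous_interval continuous_on_log_part_fun that)
    show "(mult_fun k has_integral x) {0..1}"
      using integrable_integral[OF mult_fun_integrable[of 0 k 1]] k by (simp add: mult_int_def)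
  qed
  \<comment> \<open>At \<open>y = 0\<close> the entropy integrand is
    \<open>binary_entropy (1 / 2) = 1\<close>, while the function it is compared with is
    \<open>0\<close> there.\<close>
  have H': "((\<lambda>y. if y = 0 then 0 else binary_entropy (1 / (1 + exp (k / y))) * ln 2) has_integral growth_const x * ln 2) {0..1}"
    by (rule has_integral_spike[OF negligible_sing[of 0] _ H]) auto
  show "growth_const x * ln 2 \<le> log_part_int l + l * x"
  proof (rule has_integral_le[OF H' L[OF assms(2)]])
    fix y :: real
    show "(if y = 0 then 0 else binary_entropy (1 / (1 + exp (k / y))) * ln 2) \<le> log_part_fun l y + l * mult_fun k y"
      using softplus_tangent[of "k / y" "l / y"]
      by (auto simp: entropy_fermi log_part_fun_def mult_fun_def)
  qed
  show "growth_const x * ln 2 = log_part_int l + l * x" if "l = multiplier x"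
  proof -
    have eq: "(\<lambda>y. if y = 0 then 0 else binary_entropy (1 / (1 + exp (k / y))) * ln 2) = (\<lambda>y. log_part_fun k y + k * mult_fun k y)"
      by (auto simp: entropy_fermi log_part_fun_def mult_fun_def)
    show ?thesis using has_integral_unique[OF H'[unfolded eq] L[OF k(1)]] that by (simp add: k_def)
  qed
qed

lemma card_unit_fraction_sets_le:
  assumes "x > 0" "n > 0"
  shows "real (card (unit_fraction_sets x n)) \<le> 2 * 2 powr (growth_const x * real n)"
proof -
  define l where "l = multiplier x"
  have l: "l > 0" using multiplier[OF assms(1)] by (simp add: l_def)
  have "real (card (unit_fraction_sets x n)) \<le> (\<Prod>a=1..n. 1 + exp (- (l * real n) / real a)) * exp ((l * real n) * x)"
    unfolding unit_fraction_sets_def by (rule card_sum_eq_le) simp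
  also have "\<dots> \<le> (2 * exp (real n * log_part_int l)) * exp ((l * real n) * x)"
    by (intro mult_right_mono partition_function_bounds l assms) auto
  also have "\<dots> = 2 * exp (real n * (log_part_int l + l * x))"
    by (simp add: exp_add [symmetric] algebra_simps)
  also have "\<dots> = 2 * exp (real n * (growth_const x * ln 2))"
    using log_part_ge_growth(2)[OF assms(1) l] by (simp add: l_def)
  also have "\<dots> = 2 * 2 powr (growth_const x * real n)"
    by (simp add: powr_def mult_ac)
  finally show ?thesis .
qed

section \<open>Completing a sum of unit fractions\<close>

text \<open>Bezout splits off one modulus at a time. Numerators are reduced into
  \<open>{0..<m}\<close>, so all excess and the sign go into the single integer
  \<open>w\<close>.\<close>

lemma partial_fractions:
  fixes u :: int and M :: "nat set"
  assumes "finite M" "\<And>m. m \<in> M \<Longrightarrow> m > 0" "pairwise coprime M"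
  shows "\<exists>(c :: nat \<Rightarrow> nat) (w :: int). (\<forall>m\<in>M. c m < m) \<and>
    of_int u / real (\<Prod>M) = of_int w + (\<Sum>m\<in>M. real (c m) / real m)"
  using assms
proof (induction M arbitrary: u)
  case empty
  show ?case by (auto intro!: exI[of _ u])
next
  case (insert m M)
  define V where "V = \<Prod>M"
  have V: "V > 0" unfolding V_def using insert.prems by (auto intro!: prod_pos)
  have m: "m > 0" using insert.prems by auto
  have "coprime m V"
    unfolding V_def using insert.hyps insert.prems(2) by (intro prod_coprime_right) (auto simp: pairwise_def)
  then obtain a b where "a * int m + b * int V = 1"
    using bezout_int[of "int m" "int V"] by (auto simp: coprime_iff_gcd_eq_1 [symmetric] gcd_int_int_eq)
  then have ab: "(u * a) * int m + (u * b) * int V = u" by algebra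
  obtain c w where c: "\<forall>m\<in>M. c m < m"
    "of_int (u * a) / real V = of_int w + (\<Sum>m\<in>M. real (c m) / real m)"
    unfolding V_def using insert.IH[of "u * a"] insert.prems by (auto simp: pairwise_insert)
  define r where "r = nat ((u * b) mod int m)"
  have r: "r < m" "int r = (u * b) mod int m" using m by (auto simp: r_def nat_less_iff)
  have ub: "u * b = (u * b) div int m * int m + int r" using r(2) by simp
  have "of_int u / real (V * m) = of_int (u * a) / real V + of_int (u * b) / real m"
  proof -
    have "of_int u = real_of_int (u * a) * real m + real_of_int (u * b) * real V"
      using arg_cong[OF ab, of real_of_int] by (simp add: mult_ac)
    then show ?thesis using V m by (simp add: field_simps)
  qed
  also have "of_int (u * b) / real m = of_int ((u * b) div int m) + real r / real m"
  proof -
    have "real_of_int (u * b) = of_int ((u * b) div int m) * real m + real r"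
      using arg_cong[OF ub, of real_of_int] by (simp del: of_int_mult add: of_int_mult[of _ "int m"])
    then show ?thesis using m by (simp add: field_simps)
  qed
  finally have "of_int u / real (\<Prod>(insert m M)) = of_int (w + (u * b) div int m) +
      (\<Sum>k\<in>insert m M. real ((c(m := r)) k) / real k)"
  proof -
    assume *: "of_int u / real (V * m) = of_int (u * a) / real V + (of_int ((u * b) div int m) + real r / real m)"
    have "(\<Sum>k\<in>M. real ((c(m := r)) k) / real k) = (\<Sum>m\<in>M. real (c m) / real m)"
      using insert.hyps by (intro sum.cong) auto
    then show ?thesis using * c(2) insert.hyps by (simp add: V_def mult.commute)
  qed
  moreover have "\<forall>k\<in>insert m M. (c(m := r)) k < k" using c(1) r(1) by auto
  ultimately show ?case by blast
qed

text \<open>Binary digits of \<open>c\<close>: digit \<open>i\<close> contributes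
  \<open>1 / 2 ^ (S - i)\<close>, so \<open>B\<close> digits use the exponents from
  \<open>S - B + 1\<close> to \<open>S\<close>.\<close>

lemma dyadic_expansion:
  assumes "c < 2 ^ B" "B \<le> Suc S"
  shows "\<exists>J\<subseteq>{Suc S - B..S}. (\<Sum>j\<in>J. 1 / 2 ^ j) = (real c / 2 ^ S :: real)"
  using assms
proof (induction B arbitrary: c)
  case 0
  then show ?case by (intro exI[of _ "{}"]) simp
next
  case (Suc B)
  show ?case
  proof (cases "c < 2 ^ B")
    case True
    have "B \<le> Suc S" using Suc.prems by simp
    from Suc.IH[OF True this] obtain J where
      J: "J \<subseteq> {Suc S - B..S}" "(\<Sum>j\<in>J. 1 / 2 ^ j) = (real c / 2 ^ S :: real)" by blast
    have "{Suc S - B..S} \<subseteq> {Suc S - Suc B..S}" by auto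
    with J(1) have "J \<subseteq> {Suc S - Suc B..S}" by (rule order_trans)
    with J(2) show ?thesis by blast
  next
    case False
    have "c - 2 ^ B < 2 ^ B" "B \<le> Suc S" using Suc.prems by auto
    from Suc.IH[OF this] obtain J where
      J: "J \<subseteq> {Suc S - B..S}" "(\<Sum>j\<in>J. 1 / 2 ^ j) = (real (c - 2 ^ B) / 2 ^ S :: real)" by blast
    have "(2::real) ^ S = 2 ^ (S - B) * 2 ^ B" using Suc.prems by (simp flip: power_add)
    then have "1 / 2 ^ (S - B) = (2 ^ B / 2 ^ S :: real)" by simp
    moreover have "S - B \<notin> J" using subsetD[OF J(1), of "S - B"] Suc.prems by auto
    moreover have "finite J" using J(1) by (rule finite_subset) simp
    ultimately have "(\<Sum>j\<in>insert (S - B) J. 1 / 2 ^ j) = (real c / 2 ^ S :: real)"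
      using False by (simp add: J(2) of_nat_diff diff_divide_distrib)
    moreover have "insert (S - B) J \<subseteq> {Suc S - Suc B..S}"
    proof (rule insert_subsetI)
      have "{Suc S - B..S} \<subseteq> {Suc S - Suc B..S}" by auto
      with J(1) show "J \<subseteq> {Suc S - Suc B..S}" by (rule order_trans)
    qed simp
    ultimately show ?thesis by blast
  qed
qed

text \<open>Keeps the denominators arising from different moduli distinct, so that their dyadic
  expansions can be merged into one set.\<close>

lemma power2_mult_odd_inj:
  fixes m m' :: nat
  assumes "2 ^ j * m = 2 ^ j' * m'" "odd m" "odd m'"
  shows "j = j' \<and> m = m'"
proof -
  have *: "j' \<le> j" if "2 ^ j * m = 2 ^ j' * m'" "odd m" for j j' m m' :: nat
  proof (rule ccontr)
    assume "\<not> j' \<le> j"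
    then have j': "j' = j + Suc (j' - j - 1)" by simp
    have "2 ^ j' = (2::nat) ^ j * (2 * 2 ^ (j' - j - 1))"
      by (subst j', simp only: power_add power_Suc)
    then have "m = 2 * (2 ^ (j' - j - 1) * m')" using that(1) by (simp add: mult.assoc)
    then show False using that(2) by simp
  qed
  have "j = j'" using *[of j m j' m'] *[of j' m' j m] assms by simp
  then show ?thesis using assms(1) by simp
qed

text \<open>The window for \<open>u\<close> controls the integer part \<open>w\<close> in the
  partial fractions of \<open>u / \<Prod>M\<close>. The proper fractions total at most
  \<open>card M\<close>, so the lower bound gives \<open>w \<ge> 0\<close>; the upper bound gives
  \<open>w < 2 ^ B\<close>, so \<open>w\<close> fits into \<open>B\<close> binary digits like the
  other numerators.\<close>

lemma unit_fraction_expansion: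
  assumes M: "finite M" "\<And>m. m \<in> M \<Longrightarrow> odd m" "1 \<notin> M" "pairwise coprime M"
    and B: "B \<le> Suc S" "\<And>m. m \<in> M \<Longrightarrow> m \<le> 2 ^ B"
    and u: "card M * \<Prod>M \<le> u" "u < 2 ^ B * \<Prod>M"
  shows "\<exists>E\<subseteq>{2 ^ j * m |j m. Suc S - B \<le> j \<and> j \<le> S \<and> m \<in> insert 1 M}. finite E \<and>
     (\<Sum>e\<in>E. 1 / real e) = real u / (2 ^ S * real (\<Prod>M))"
proof -
  have Mpos: "m > 0" if "m \<in> M" for m using M(2)[OF that] by (rule odd_pos)
  define V where "V = \<Prod>M"
  have V: "V > 0" unfolding V_def using Mpos by (auto intro!: prod_pos)
  obtain c w where c: "\<forall>m\<in>M. c m < m"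
    "of_int (int u) / real V = of_int w + (\<Sum>m\<in>M. real (c m) / real m)"
    using partial_fractions[OF M(1) Mpos M(4), of "int u"] unfolding V_def[symmetric] by blast
  have cu: "real u / real V = of_int w + (\<Sum>m\<in>M. real (c m) / real m)"
    using c(2) by (simp only: of_int_of_nat_eq)
  have "(\<Sum>m\<in>M. real (c m) / real m) \<le> (\<Sum>m\<in>M. 1)"
    using c(1) Mpos by (intro sum_mono) (auto simp: divide_simps less_imp_le)
  moreover have "real (card M) \<le> real u / real V"
  proof -
    have "real (card M) * real V \<le> real u" using u(1) unfolding V_def [symmetric]
      by (simp only: of_nat_mult [symmetric] of_nat_le_iff)
    then show ?thesis using V by (simp add: field_simps)
  qed
  ultimately have w0: "w \<ge> 0" using cu by simp
  have "(\<Sum>m\<in>M. real (c m) / real m) \<ge> 0" by (intro sum_nonneg) auto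
  then have "of_int w \<le> real u / real V" using cu by simp
  also have "\<dots> < 2 ^ B"
  proof -
    have "real u < real (2 ^ B * V)" using u(2) unfolding V_def[symmetric] by (simp only: of_nat_less_iff)
    then have "real u < 2 ^ B * real V" by simp
    then show ?thesis using V by (simp add: field_simps)
  qed
  finally have w1: "w < 2 ^ B" by simp
  \<comment> \<open>The integer part is treated as the numerator belonging to the modulus
    \<open>1\<close>, a free slot because \<open>1 \<notin> M\<close>.\<close>
  define c' where "c' = c(1 := nat w)"
  have c'B: "c' m < 2 ^ B" if "m \<in> insert 1 M" for m
  proof (cases "m = 1")
    case True
    then show ?thesis using w0 w1 by (simp add: c'_def nat_less_iff)
  next
    case False
    then have "m \<in> M" using that by simp
    then have "c m < m" "m \<le> 2 ^ B" using c(1) B(2) by blast+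
    then show ?thesis using False by (simp add: c'_def)
  qed
  have "\<forall>m\<in>insert 1 M. \<exists>J. J \<subseteq> {Suc S - B..S} \<and> (\<Sum>j\<in>J. 1 / 2 ^ j) = (real (c' m) / 2 ^ S :: real)"
  proof
    fix m assume "m \<in> insert 1 M"
    then show "\<exists>J. J \<subseteq> {Suc S - B..S} \<and> (\<Sum>j\<in>J. 1 / 2 ^ j) = (real (c' m) / 2 ^ S :: real)"
      by (intro dyadic_expansion c'B B(1))
  qed
  then obtain J where J: "\<forall>m\<in>insert 1 M. J m \<subseteq> {Suc S - B..S} \<and> (\<Sum>j\<in>J m. 1 / 2 ^ j) = (real (c' m) / 2 ^ S :: real)"
    by (rule bchoice[THEN exE])
  have J1: "J m \<subseteq> {Suc S - B..S}" and J2: "(\<Sum>j\<in>J m. 1 / 2 ^ j) = (real (c' m) / 2 ^ S :: real)"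
    if "m \<in> insert 1 M" for m
    using bspec[OF J that] by (rule conjunct1, rule conjunct2)
  have fJ: "finite (J m)" if "m \<in> insert 1 M" for m
    using J1[OF that] by (rule finite_subset) simp
  define g where "g = (\<lambda>(m, j). 2 ^ j * m :: nat)"
  define D where "D = Sigma (insert 1 M) J"
  have inj: "inj_on g D"
  proof (rule inj_onI)
    fix y z assume yz: "y \<in> D" "z \<in> D" "g y = g z"
    obtain m j m' j' where [simp]: "y = (m, j)" "z = (m', j')" by (cases y, cases z) auto
    have "odd m" "odd m'" using yz M(2) by (auto simp: D_def)
    moreover have "2 ^ j * m = 2 ^ j' * m'" using yz(3) by (simp add: g_def)
    ultimately show "y = z" using power2_mult_odd_inj[of j m j' m'] by simp
  qed
  have "(\<Sum>e\<in>g ` D. 1 / real e) = (\<Sum>(m, j)\<in>D. 1 / 2 ^ j * (1 / real m))"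
    by (subst sum.reindex[OF inj]) (auto simp: g_def intro!: sum.cong)
  also have "\<dots> = (\<Sum>m\<in>insert 1 M. (\<Sum>j\<in>J m. 1 / 2 ^ j * (1 / real m)))"
    unfolding D_def using M(1) fJ by (subst sum.Sigma) auto
  also have "\<dots> = (\<Sum>m\<in>insert 1 M. (real (c' m) / 2 ^ S) * (1 / real m))"
    by (intro sum.cong refl) (simp only: sum_distrib_right [symmetric] J2)
  also have "\<dots> = real (c' 1) / 2 ^ S + (\<Sum>m\<in>M. (real (c m) / 2 ^ S) * (1 / real m))"
    using M(1,3) by (auto simp: c'_def intro!: sum.cong)
  also have "(\<Sum>m\<in>M. (real (c m) / 2 ^ S) * (1 / real m)) = (\<Sum>m\<in>M. real (c m) / real m) / 2 ^ S"
    by (simp add: sum_divide_distrib mult.commute)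
  also have "real (c' 1) / 2 ^ S + (\<Sum>m\<in>M. real (c m) / real m) / 2 ^ S = (real u / real V) / 2 ^ S"
    unfolding cu using w0 by (simp add: c'_def add_divide_distrib)
  finally have "(\<Sum>e\<in>g ` D. 1 / real e) = real u / (2 ^ S * real V)" by (simp add: mult.commute)
  moreover have "g ` D \<subseteq> {2 ^ j * m |j m. Suc S - B \<le> j \<and> j \<le> S \<and> m \<in> insert 1 M}"
  proof
    fix e assume "e \<in> g ` D"
    then obtain m j where e: "e = 2 ^ j * m" "m \<in> insert 1 M" "j \<in> J m" by (auto simp: g_def D_def)
    have "j \<in> {Suc S - B..S}" using J1[OF e(2)] e(3) by (rule subsetD)
    then show "e \<in> {2 ^ j * m |j m. Suc S - B \<le> j \<and> j \<le> S \<and> m \<in> insert 1 M}"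
      using e(1,2) by (intro CollectI exI[of _ j] exI[of _ m] conjI) auto
  qed
  moreover have "finite (g ` D)" unfolding D_def using M(1) fJ by auto
  ultimately show ?thesis unfolding V_def by blast
qed

lemma sum_mult_image_inverse:
  assumes "w > 0"
  shows "(\<Sum>b\<in>(*) w ` E. 1 / real b) = (\<Sum>e\<in>E. 1 / real e) / real w"
proof -
  have "inj_on ((*) w) E" using assms by (auto simp: inj_on_def)
  then have "(\<Sum>b\<in>(*) w ` E. 1 / real b) = (\<Sum>e\<in>E. 1 / real (w * e))" by (simp add: sum.reindex)
  then show ?thesis by (simp add: sum_divide_distrib mult.commute)
qed

text \<open>The multiples \<open>p * 2 ^ j * m\<close> of \<open>p\<close> cancel the part of the denominator at \<open>p\<close>; this leaves a
  denominator dividing \<open>W * 2 ^ (3 * L) * \<Prod>M\<close>, which the numbers \<open>W * 2 ^ j * m\<close> can represent.\<close>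

lemma unit_fraction_completion:
  fixes P M A :: "nat set" and W L n P0 :: nat and x :: real
  assumes P: "finite P" "\<And>p. p \<in> P \<Longrightarrow> prime p \<and> P0 < p \<and> p \<le> \<Prod>M \<and> p * 2 ^ (4 * L) \<le> n"
    and M: "finite M" "\<And>m. m \<in> M \<Longrightarrow> odd m" "1 \<notin> M" "pairwise coprime M" "\<And>m. m \<in> M \<Longrightarrow> m \<le> 2 ^ L"
    and W: "W > 0" "W * 2 ^ (4 * L) \<le> n" "x * real W \<in> \<int>"
    and P0: "2 \<le> P0" "\<And>q. prime q \<Longrightarrow> q dvd W \<Longrightarrow> q \<le> P0"
      "\<And>q m. m \<in> M \<Longrightarrow> prime q \<Longrightarrow> q dvd m \<Longrightarrow> q \<le> P0"
    and A: "finite A" "\<And>a. a \<in> A \<Longrightarrow> a dvd W * \<Prod>P"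
      "x - 1 / W \<le> (\<Sum>a\<in>A. 1 / real a)" "(\<Sum>a\<in>A. 1 / real a) \<le> x - 1 / (2 * W)"
    and small: "(\<Sum>b\<in>{b\<in>{1..n}. 2 ^ L dvd b}. 1 / real b) \<le> 1 / (4 * W)"
    and k: "4 * card M \<le> 2 ^ L"
  shows "\<exists>B\<subseteq>{1..n}. (\<forall>b\<in>B. 2 ^ L dvd b \<or> W dvd b) \<and> (\<Sum>a\<in>A. 1 / real a) + (\<Sum>b\<in>B. 1 / real b) = x"
proof -
  define V where "V = \<Prod>M"
  define k where "k = card M"
  \<comment> \<open>Exponents between \<open>L\<close> and \<open>3 * L\<close> leave room for
    \<open>2 * L + 1\<close> binary digits above the guaranteed factor \<open>2 ^ L\<close>; with
    \<open>m \<le> 2 ^ L\<close> every multiplier is at most \<open>2 ^ (4 * L)\<close>.\<close>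
  define S where "S = 3 * L"
  define Q where "Q = W * \<Prod>P"
  have Mpos: "m > 0" if "m \<in> M" for m using M(2)[OF that] by (rule odd_pos)
  have V: "V > 0" unfolding V_def using Mpos by (auto intro!: prod_pos)
  have Ppos: "p > 0" if "p \<in> P" for p using P(2)[OF that] by (auto intro: prime_gt_0_nat)
  have Q: "Q > 0" unfolding Q_def using Ppos W by (auto intro!: prod_pos)
  have L2: "(2::nat) ^ L \<le> 2 ^ (2 * L)" "(2::nat) ^ L \<le> 2 ^ (3 * L)" "(2::nat) ^ (4 * L) = 2 ^ L * 2 ^ S"
    by (auto intro!: power_increasing simp: S_def simp flip: power_add)

  \<comment> \<open>Multipliers have only prime factors up to \<open>P0\<close>. So an element of
    the correction for \<open>p\<close> has \<open>p\<close> as its only prime factor above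
    \<open>P0\<close>, which makes the corrections pairwise disjoint.\<close>
  have smooth: "q \<le> P0" if "prime q" "q dvd 2 ^ j * m" "m \<in> insert 1 M" for q j m :: nat
  proof -
    have "q dvd 2 \<or> q dvd m" using that by (auto simp: prime_dvd_mult_iff dest: prime_dvd_power)
    then show ?thesis using that P0 by (auto dest: dvd_imp_le prime_gt_1_nat)
  qed

  obtain r where r: "x * real W = of_int r" using W(3) by (auto elim: Ints_cases)
  have "x = of_int (r * int (\<Prod>P)) / real Q"
  proof -
    have "x * real Q = x * real W * real (\<Prod>P)" by (simp add: Q_def del: of_nat_prod)
    also have "\<dots> = of_int (r * int (\<Prod>P))" unfolding r by (simp del: of_nat_prod)
    finally show ?thesis using Q by (simp add: field_simps del: of_nat_prod of_int_mult)
  qed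
  moreover have "(\<Sum>a\<in>A. 1 / real a) = of_int (\<Sum>a\<in>A. int (Q div a)) / real Q"
  proof -
    have "1 / real a = of_int (int (Q div a)) / real Q" if "a \<in> A" for a
    proof -
      have "a dvd Q" using A(2)[OF that] by (simp add: Q_def)
      then have "real (Q div a) * real a = real Q" by (simp flip: of_nat_mult)
      moreover have "a > 0" using \<open>a dvd Q\<close> Q by (auto intro: Nat.gr0I)
      ultimately show ?thesis using Q by (simp add: field_simps)
    qed
    then show ?thesis by (simp add: sum_divide_distrib)
  qed
  ultimately obtain u :: int where u: "x - (\<Sum>a\<in>A. 1 / real a) = of_int u / real Q"
    by (metis diff_divide_distrib of_int_diff)

  have WP: "W \<notin> P" using P0(2)[of W] P(2)[of W] by auto
  have cop: "pairwise coprime (insert W P)"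
  proof -
    have "coprime p W" if "p \<in> P" for p
    proof -
      have "\<not> p dvd W" using P0(2)[of p] P(2)[OF that] by auto
      then show ?thesis using P(2)[OF that] by (simp add: prime_imp_coprime)
    qed
    moreover have "pairwise coprime P" using P(2) by (auto simp: pairwise_def primes_coprime)
    ultimately show ?thesis by (auto simp: pairwise_insert coprime_commute)
  qed
  have "\<Prod>(insert W P) = Q" using P(1) WP by (simp add: Q_def)
  moreover have "finite (insert W P)" "\<And>m. m \<in> insert W P \<Longrightarrow> m > 0" using P(1) Ppos W(1) by auto
  \<comment> \<open>The fraction still missing is separated into its parts at \<open>W\<close> and
    at each \<open>p\<close>; the numerators \<open>c p\<close> can then be treated
    independently.\<close>
  ultimately obtain c w where cw: "of_int u / real Q = of_int w + (\<Sum>m\<in>insert W P. real (c m) / real m)"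
    using partial_fractions[OF _ _ cop, of u] by metis

  have "\<exists>E (t::int). E \<subseteq> {2 ^ j * m |j m. L \<le> j \<and> j \<le> S \<and> m \<in> insert 1 M} \<and> finite E \<and>
      real (c p) - (\<Sum>e\<in>E. 1 / real e) = real p * of_int t / (2 ^ S * real V)" if "p \<in> P" for p
  proof -
    \<comment> \<open>\<open>v\<close> is the least number from \<open>k * V\<close> on that is
      congruent to \<open>c p * 2 ^ S * V\<close> modulo \<open>p\<close>. As
      \<open>p \<le> V\<close>, it stays below \<open>(k + 1) * V\<close> and hence in the window of
      \<open>unit_fraction_expansion\<close>; subtracting \<open>v / (2 ^ S * V)\<close> from
      \<open>c p\<close> leaves a numerator divisible by \<open>p\<close>.\<close>
    define z where "z = int (c p) * 2 ^ S * int V - int (k * V)"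
    define v where "v = k * V + nat (z mod int p)"
    have nz: "int (nat (z mod int p)) = z mod int p" using Ppos[OF that] by simp
    have "int (nat (z mod int p)) < int p" unfolding nz using Ppos[OF that] by simp
    then have "nat (z mod int p) < p" by (simp only: of_nat_less_iff)
    then have "nat (z mod int p) < V" using P(2)[OF that] unfolding V_def by (meson less_le_trans)
    then have "v < (k + 1) * V" by (simp add: v_def)
    also have "\<dots> \<le> 2 ^ (2 * L + 1) * V"
    proof (intro mult_right_mono)
      have "4 * k \<le> 2 ^ (2 * L)" using k L2(1) unfolding k_def by (rule order_trans)
      moreover have "(1::nat) \<le> 2 ^ (2 * L)" by simp
      ultimately show "k + 1 \<le> 2 ^ (2 * L + 1)" unfolding power_add power_one_right by linarith
    qed simp
    finally have "v < 2 ^ (2 * L + 1) * V" .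
    moreover have "k * V \<le> v" by (simp add: v_def)
    moreover have "m \<le> 2 ^ (2 * L + 1)" if "m \<in> M" for m
      using M(5)[OF that] power_increasing[of L "2 * L + 1" "2::nat"] by linarith
    moreover have "2 * L + 1 \<le> Suc S" by (simp add: S_def)
    ultimately obtain E where E: "E \<subseteq> {2 ^ j * m |j m. Suc S - (2 * L + 1) \<le> j \<and> j \<le> S \<and> m \<in> insert 1 M}"
       "finite E" "(\<Sum>e\<in>E. 1 / real e) = real v / (2 ^ S * real V)"
      using unit_fraction_expansion[OF M(1-4), of "2 * L + 1" S v] unfolding V_def k_def by blast
    have "int (c p) * 2 ^ S * int V - int v = int p * (z div int p)"
      unfolding v_def using nz by (simp add: z_def minus_mod_eq_mult_div [symmetric])
    from arg_cong[OF this, of real_of_int]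
    have "real (c p) * (2 ^ S * real V) - real v = real p * of_int (z div int p)" by (simp add: mult_ac)
    then have "real (c p) - (\<Sum>e\<in>E. 1 / real e) = real p * of_int (z div int p) / (2 ^ S * real V)"
      unfolding E(3) using V by (simp add: field_simps)
    \<comment> \<open>This lowest exponent makes every element of the correction a multiple of
      \<open>2 ^ L\<close>, so that hypothesis \<open>small\<close> bounds their total.\<close>
    moreover have "Suc S - (2 * L + 1) = L" by (simp add: S_def)
    ultimately show ?thesis using E(1,2) by auto
  qed
  then have "\<forall>p\<in>P. \<exists>E. \<exists>t::int. E \<subseteq> {2 ^ j * m |j m. L \<le> j \<and> j \<le> S \<and> m \<in> insert 1 M} \<and> finite E \<and>
      real (c p) - (\<Sum>e\<in>E. 1 / real e) = real p * of_int t / (2 ^ S * real V)"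
    by (rule ballI)
  then obtain E where "\<forall>p\<in>P. \<exists>t::int. E p \<subseteq> {2 ^ j * m |j m. L \<le> j \<and> j \<le> S \<and> m \<in> insert 1 M} \<and> finite (E p) \<and>
      real (c p) - (\<Sum>e\<in>E p. 1 / real e) = real p * of_int t / (2 ^ S * real V)"
    by (rule bchoice[THEN exE])
  then obtain t where Et: "\<forall>p\<in>P. E p \<subseteq> {2 ^ j * m |j m. L \<le> j \<and> j \<le> S \<and> m \<in> insert 1 M} \<and> finite (E p) \<and>
      real (c p) - (\<Sum>e\<in>E p. 1 / real e) = real p * of_int (t p) / (2 ^ S * real V)"
    by (rule bchoice[THEN exE])
  have E: "\<And>p. p \<in> P \<Longrightarrow> E p \<subseteq> {2 ^ j * m |j m. L \<le> j \<and> j \<le> S \<and> m \<in> insert 1 M}"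
      "\<And>p. p \<in> P \<Longrightarrow> finite (E p)"
    and t: "\<And>p. p \<in> P \<Longrightarrow> real (c p) - (\<Sum>e\<in>E p. 1 / real e) = real p * of_int (t p) / (2 ^ S * real V)"
    using Et by blast+

  define B where "B p = (*) p ` E p" for p
  have sumB: "(\<Sum>b\<in>B p. 1 / real b) = real (c p) / real p - of_int (t p) / (2 ^ S * real V)" if "p \<in> P" for p
  proof -
    have "(\<Sum>e\<in>E p. 1 / real e) = real (c p) - real p * of_int (t p) / (2 ^ S * real V)"
      using t[OF that] by simp
    then show ?thesis unfolding B_def sum_mult_image_inverse[OF Ppos[OF that]]
      using Ppos[OF that] by (simp add: diff_divide_distrib)
  qed
  have Bmem: "b \<in> {1..n} \<and> 2 ^ L dvd b \<and> (\<forall>q. prime q \<longrightarrow> q dvd b \<longrightarrow> q \<le> P0 \<or> q = p)" if "p \<in> P" "b \<in> B p" for p b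
  proof -
    note pP = that(1) and bB = that(2)
    obtain e where e: "e \<in> E p" "b = p * e" using bB by (auto simp: B_def)
    obtain j m where "e = 2 ^ j * m" "L \<le> j" "j \<le> S" "m \<in> insert 1 M"
      using subsetD[OF E(1)[OF pP] e(1)] by blast
    with e have b: "b = p * (2 ^ j * m)" "L \<le> j" "j \<le> S" "m \<in> insert 1 M" by simp_all
    have "m \<le> 2 ^ L" "m > 0" using b(4) M(5) Mpos by auto
    moreover have "(2::nat) ^ j \<le> 2 ^ S" using b(3) by (intro power_increasing) auto
    ultimately have "b \<le> p * (2 ^ S * 2 ^ L)" unfolding b(1) by (intro mult_le_mono) auto
    also have "\<dots> \<le> n" using P(2)[OF pP] L2(3) by (simp add: mult.commute)
    finally have "b \<le> n" .
    moreover have "b > 0" using b(1) \<open>m > 0\<close> Ppos[OF pP] by simp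
    moreover have "2 ^ L dvd b" unfolding b(1) using b(2) by (intro dvd_mult dvd_mult2 le_imp_power_dvd)
    moreover have "q \<le> P0 \<or> q = p" if "prime q" "q dvd b" for q
      using that smooth[OF that(1) _ b(4), of j] P(2)[OF pP] primes_dvd_imp_eq[of q p]
      unfolding b(1) by (auto simp: prime_dvd_mult_iff)
    ultimately show ?thesis by auto
  qed
  have pB: "p dvd b" if "b \<in> B p" for p b using that by (auto simp: B_def)
  have disj: "B p \<inter> B q = {}" if "p \<in> P" "q \<in> P" "p \<noteq> q" for p q
  proof (rule ccontr)
    assume "B p \<inter> B q \<noteq> {}"
    then obtain b where "b \<in> B p" "b \<in> B q" by auto
    then have "p \<le> P0 \<or> p = q" using Bmem[of q b] pB[of b p] that P(2)[of p] by auto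
    then show False using that P(2)[of p] by auto
  qed
  define BU where "BU = (\<Union>p\<in>P. B p)"
  have finB: "finite (B p)" if "p \<in> P" for p using E(2)[OF that] by (simp add: B_def)
  have sumBU: "(\<Sum>b\<in>BU. 1 / real b) = (\<Sum>p\<in>P. real (c p) / real p - of_int (t p) / (2 ^ S * real V))"
    unfolding BU_def using P(1) finB disj by (subst sum.UNION_disjoint) (auto simp: sumB)
  have BUn: "BU \<subseteq> {b\<in>{1..n}. 2 ^ L dvd b}" using Bmem by (fastforce simp: BU_def)
  then have "(\<Sum>b\<in>BU. 1 / real b) \<le> (\<Sum>b\<in>{b\<in>{1..n}. 2 ^ L dvd b}. 1 / real b)"
    by (intro sum_mono2) auto
  then have BUsmall: "(\<Sum>b\<in>BU. 1 / real b) \<le> 1 / (4 * W)" using small by simp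

  define v where "v = x - (\<Sum>a\<in>A. 1 / real a) - (\<Sum>b\<in>BU. 1 / real b)"
  define N where "N = (w * int W + int (c W)) * 2 ^ S * int V + (\<Sum>p\<in>P. t p) * int W"
  have "v = of_int w + real (c W) / real W + (\<Sum>p\<in>P. real (c p) / real p) - (\<Sum>b\<in>BU. 1 / real b)"
    unfolding v_def u cw using P(1) WP by simp
  also have "\<dots> = of_int w + real (c W) / real W + (\<Sum>p\<in>P. of_int (t p) / (2 ^ S * real V))"
    unfolding sumBU by (simp add: sum_subtractf)
  also have "\<dots> = of_int w + real (c W) / real W + of_int (\<Sum>p\<in>P. t p) / (2 ^ S * real V)"
    by (simp add: sum_divide_distrib)
  also have "\<dots> = of_int N / (2 ^ S * real V) / real W"
    using W(1) V by (simp add: N_def field_simps)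
  finally have vN: "v = of_int N / (2 ^ S * real V) / real W" .
  have v1: "1 / (4 * real W) \<le> v" and v2: "v \<le> 1 / real W"
  proof -
    have "1 / (2 * real W) - 1 / (4 * real W) = 1 / (4 * real W)" using W(1) by (simp add: field_simps)
    then show "1 / (4 * real W) \<le> v" using A(4) BUsmall unfolding v_def by simp
    have "(\<Sum>b\<in>BU. 1 / real b) \<ge> 0" by (intro sum_nonneg) auto
    then show "v \<le> 1 / real W" using A(3) unfolding v_def by simp
  qed
  have NV: "real_of_int N = v * real W * (2 ^ S * real V)" unfolding vN using W(1) V by simp
  \<comment> \<open>So \<open>N\<close> lies between \<open>2 ^ S * V / 4\<close> and
    \<open>2 ^ S * V\<close>. The hypothesis on \<open>card M\<close> puts this above
    \<open>k * V\<close>, and \<open>S + 1\<close> digits suffice; here all exponents from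
    \<open>0\<close> on are allowed, since membership is marked by the factor \<open>W\<close>
    instead of \<open>2 ^ L\<close>.\<close>
  have vW1: "1 / 4 \<le> v * real W" and vW2: "v * real W \<le> 1" using v1 v2 W(1) by (simp_all add: field_simps)
  have N1: "1 / 4 * (2 ^ S * real V) \<le> real_of_int N"
    unfolding NV using vW1 by (rule mult_right_mono) simp
  have N2: "real_of_int N \<le> 1 * (2 ^ S * real V)"
    unfolding NV using vW2 by (rule mult_right_mono) simp
  have "real_of_int N \<ge> 0" using N1 by (rule order_trans[rotated]) simp
  then have Nnat: "real (nat N) = of_int N" by simp
  have "4 * k \<le> 2 ^ S" using k L2(2) unfolding S_def k_def by (rule order_trans)
  then have "real (4 * k) \<le> real (2 ^ S)" by (simp only: of_nat_le_iff)
  then have "real k \<le> 2 ^ S / 4" by simp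
  then have "real k * real V \<le> 2 ^ S / 4 * real V" by (rule mult_right_mono) simp
  then have "real (k * V) \<le> real (nat N)" using N1 Nnat by simp
  then have "k * V \<le> nat N" by (simp only: of_nat_le_iff)
  moreover have "nat N < 2 ^ (S + 1) * V"
  proof -
    have "real (nat N) \<le> 2 ^ S * real V" using N2 Nnat by simp
    also have "\<dots> < 2 ^ (S + 1) * real V" using V by simp
    also have "\<dots> = real (2 ^ (S + 1) * V)" by simp
    finally show ?thesis by (simp only: of_nat_less_iff)
  qed
  moreover have "m \<le> 2 ^ (S + 1)" if "m \<in> M" for m
    using M(5)[OF that] by (rule order_trans) (rule power_increasing, simp_all add: S_def)
  moreover have "S + 1 \<le> Suc S" by simp
  ultimately obtain E0 where E0: "E0 \<subseteq> {2 ^ j * m |j m. Suc S - (S + 1) \<le> j \<and> j \<le> S \<and> m \<in> insert 1 M}"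
       "finite E0" "(\<Sum>e\<in>E0. 1 / real e) = real (nat N) / (2 ^ S * real V)"
    using unit_fraction_expansion[OF M(1-4), of "S + 1" S "nat N"] unfolding V_def k_def by blast
  define B0 where "B0 = (*) W ` E0"
  have sumB0: "(\<Sum>b\<in>B0. 1 / real b) = v"
    unfolding B0_def sum_mult_image_inverse[OF W(1)] E0(3) vN Nnat by simp
  have B0mem: "b \<in> {1..n} \<and> W dvd b \<and> (\<forall>q. prime q \<longrightarrow> q dvd b \<longrightarrow> q \<le> P0)" if "b \<in> B0" for b
  proof -
    from that obtain e where e: "e \<in> E0" "b = W * e" by (auto simp: B0_def)
    obtain j m where "e = 2 ^ j * m" "j \<le> S" "m \<in> insert 1 M"
      using subsetD[OF E0(1) e(1)] by blast
    with e have b: "b = W * (2 ^ j * m)" "j \<le> S" "m \<in> insert 1 M" by simp_all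
    have "m \<le> 2 ^ L" "m > 0" using b(3) M(5) Mpos by auto
    moreover have "(2::nat) ^ j \<le> 2 ^ S" using b(2) by (intro power_increasing) auto
    ultimately have "b \<le> W * (2 ^ S * 2 ^ L)" unfolding b(1) by (intro mult_le_mono) auto
    also have "\<dots> \<le> n" using W(2) L2(3) by (simp add: mult.commute)
    finally have "b \<le> n" .
    moreover have "q \<le> P0" if "prime q" "q dvd b" for q
      using that smooth[OF that(1) _ b(3), of j] P0(2)[of q] unfolding b(1) by (auto simp: prime_dvd_mult_iff)
    moreover have "b > 0" "W dvd b" using b(1) \<open>m > 0\<close> W(1) by auto
    ultimately show ?thesis by auto
  qed
  have "BU \<inter> B0 = {}"
  proof (rule ccontr)
    assume "BU \<inter> B0 \<noteq> {}"
    then obtain b p where "p \<in> P" "b \<in> B p" "b \<in> B0" by (auto simp: BU_def)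
    then have "p \<le> P0" using B0mem[of b] pB[of b p] P(2)[of p] by auto
    then show False using P(2)[of p] \<open>p \<in> P\<close> by auto
  qed
  moreover have "finite BU" "finite B0" using P(1) finB E0(2) by (auto simp: BU_def B0_def)
  ultimately have "(\<Sum>b\<in>BU \<union> B0. 1 / real b) = x - (\<Sum>a\<in>A. 1 / real a)"
    by (simp add: sum.union_disjoint sumB0 v_def)
  moreover have "BU \<union> B0 \<subseteq> {1..n}" "\<forall>b\<in>BU \<union> B0. 2 ^ L dvd b \<or> W dvd b"
    using BUn B0mem by auto
  ultimately show ?thesis by (intro exI[of _ "BU \<union> B0"]) auto
qed

section \<open>Density of the admissible denominators\<close>

lemma prod_primes_dvd:
  fixes S :: "nat set"
  assumes "finite S" "\<And>p. p \<in> S \<Longrightarrow> prime p \<and> p dvd n"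
  shows "\<Prod>S dvd n"
  using assms
proof (induction S)
  case (insert p S)
  have "coprime p (\<Prod>S)"
  proof (rule prod_coprime_right)
    fix q assume "q \<in> S"
    moreover from this have "p \<noteq> q" using insert.hyps by auto
    ultimately show "coprime p q" using insert.prems by (intro primes_coprime) auto
  qed
  moreover have "\<Prod>S dvd n" "p dvd n" using insert.IH insert.prems by auto
  ultimately have "p * \<Prod>S dvd n" by (intro divides_mult)
  then show ?case using insert.hyps by simp
qed simp

section \<open>Chebyshev-type bounds for reciprocals of primes\<close>

text \<open>Chebyshev's argument: with \<open>N = 2 ^ j\<close>, the primes in
  \<open>{N<..2 * N}\<close> all divide the central binomial coefficient, which is at most
  \<open>2 ^ (2 * N)\<close>. Hence there are at most \<open>2 * N / j\<close> of them, each with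
  reciprocal at most \<open>1 / N\<close>.\<close>

lemma primes_dyadic_le:
  assumes "j \<ge> 1"
  shows "(\<Sum>p\<in>{p::nat. prime p \<and> 2 ^ j < p \<and> p \<le> 2 ^ (j + 1)}. 1 / real p) \<le> 2 / real j"
proof -
  define N :: nat where "N = 2 ^ j"
  define S where "S = {p::nat. prime p \<and> 2 ^ j < p \<and> p \<le> 2 ^ (j + 1)}"
  have fin: "finite S" by (rule finite_subset[of _ "{..2 ^ (j + 1)}"]) (auto simp: S_def)
  have "p dvd (2 * N) choose N" if "p \<in> S" for p
  proof -
    have p: "prime p" "N < p" "p \<le> 2 * N" using that by (auto simp: S_def N_def)
    have "fact N * fact (2 * N - N) * ((2 * N) choose N) = (fact (2 * N) :: nat)"
      by (rule binomial_fact_lemma) simp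
    then have "p dvd fact N * fact N * ((2 * N) choose N)"
      using p prime_dvd_fact_iff[of p "2 * N"] by simp
    moreover have "\<not> p dvd fact N" using p prime_dvd_fact_iff[of p N] by simp
    ultimately show ?thesis using p(1) by (simp add: prime_dvd_mult_iff)
  qed
  then have "\<Prod>S dvd (2 * N) choose N" using fin by (intro prod_primes_dvd) (auto simp: S_def)
  then have "\<Prod>S \<le> (2 * N) choose N" by (rule dvd_imp_le) simp
  also have "\<dots> \<le> (\<Sum>k\<le>2 * N. (2 * N) choose k)" by (rule member_le_sum) auto
  also have "\<dots> = 2 ^ (2 * N)" by (rule choose_row_sum)
  finally have up: "\<Prod>S \<le> 2 ^ (2 * N)" .
  have "(2 ^ j) ^ card S = (\<Prod>p\<in>S. 2 ^ j)" by simp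
  also have "\<dots> \<le> \<Prod>S" by (intro prod_mono) (auto simp: S_def)
  also note up
  finally have "(2::nat) ^ (j * card S) \<le> 2 ^ (2 * N)" by (simp add: power_mult)
  then have "j * card S \<le> 2 * N" by (rule power_le_imp_le_exp[rotated]) simp
  then have "real (j * card S) \<le> real (2 * N)" by (simp only: of_nat_le_iff)
  then have cardS: "real (card S) \<le> 2 * real N / real j" using assms by (simp add: field_simps)
  have Npos: "real N > 0" by (simp add: N_def)
  have "(\<Sum>p\<in>S. 1 / real p) \<le> (\<Sum>p\<in>S. 1 / real N)"
  proof (rule sum_mono)
    fix p assume "p \<in> S"
    then have "N \<le> p" by (simp add: S_def N_def)
    then show "1 / real p \<le> 1 / real N" using Npos by (intro divide_left_mono) auto
  qed
  also have "\<dots> = real (card S) / real N" by simp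
  also have "\<dots> \<le> (2 * real N / real j) / real N" using cardS Npos by (intro divide_right_mono) auto
  also have "\<dots> = 2 / real j" using Npos by simp
  finally show ?thesis by (simp add: S_def)
qed

text \<open>Each of the \<open>b\<close> dyadic blocks contributes at most \<open>2 / a\<close>.
  This is weaker than a Mertens estimate but small whenever \<open>b / a\<close> is, as in the
  application with \<open>b\<close> about \<open>4 * N / T\<close>.\<close>

lemma primes_reciprocal_sum_le:
  fixes a b :: nat
  assumes "a \<ge> 1"
  shows "(\<Sum>p\<in>{p::nat. prime p \<and> 2 ^ a < p \<and> p \<le> 2 ^ (a + b)}. 1 / real p) \<le> real b * (2 / real a)"
proof (induction b)
  case 0
  have empty: "{p::nat. prime p \<and> 2 ^ a < p \<and> p \<le> 2 ^ (a + 0)} = {}" by auto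
  show ?case unfolding empty by simp
next
  case (Suc b)
  define X where "X = {p::nat. prime p \<and> 2 ^ a < p \<and> p \<le> 2 ^ (a + b)}"
  define S where "S = {p::nat. prime p \<and> 2 ^ (a + b) < p \<and> p \<le> 2 ^ (a + b + 1)}"
  have "X \<subseteq> {..2 ^ (a + b)}" "S \<subseteq> {..2 ^ (a + b + 1)}" unfolding X_def S_def by blast+
  then have fin: "finite X" "finite S" by (auto intro: finite_subset)
  have "{p::nat. prime p \<and> 2 ^ a < p \<and> p \<le> 2 ^ (a + Suc b)} = X \<union> S"
  proof -
    have split: "A < p \<and> p \<le> C \<longleftrightarrow> A < p \<and> p \<le> B \<or> B < p \<and> p \<le> C" if "A \<le> B" "B \<le> C" for A B C p :: nat
      using that by auto
    have h: "(2::nat) ^ a \<le> 2 ^ (a + b)" "(2::nat) ^ (a + b) \<le> 2 ^ (a + b + 1)"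
      by (rule power_increasing, simp_all)+
    show ?thesis
    proof (rule set_eqI)
      fix p :: nat
      show "p \<in> {p. prime p \<and> 2 ^ a < p \<and> p \<le> 2 ^ (a + Suc b)} \<longleftrightarrow> p \<in> X \<union> S"
        unfolding X_def S_def Un_iff mem_Collect_eq add_Suc_right Suc_eq_plus1
        add.assoc [symmetric]
        using split[OF h, of p] by blast
    qed
  qed
  moreover have "X \<inter> S = {}" by (auto simp: X_def S_def)
  ultimately have "(\<Sum>p\<in>{p::nat. prime p \<and> 2 ^ a < p \<and> p \<le> 2 ^ (a + Suc b)}. 1 / real p)
      = (\<Sum>p\<in>X. 1 / real p) + (\<Sum>p\<in>S. 1 / real p)"
    using sum.union_disjoint[OF fin] by simp
  also have "\<dots> \<le> real b * (2 / real a) + 2 / real a"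
  proof (rule add_mono)
    show "(\<Sum>p\<in>X. 1 / real p) \<le> real b * (2 / real a)" unfolding X_def by (rule Suc.IH)
    have "(\<Sum>p\<in>S. 1 / real p) \<le> 2 / real (a + b)"
      unfolding S_def using assms by (intro primes_dyadic_le) linarith
    also have "\<dots> \<le> 2 / real a" using assms by (intro divide_left_mono) auto
    finally show "(\<Sum>p\<in>S. 1 / real p) \<le> 2 / real a" .
  qed
  also have "\<dots> = real (Suc b) * (2 / real a)"
    by (simp only: of_nat_Suc distrib_right mult_1 add.commute)
  finally show ?case .
qed

lemma card_multiples_le: "real (card {a\<in>{1..n}. m dvd a}) \<le> real n / real m"
proof (cases "m = 0")
  case True
  then have empty: "{a\<in>{1..n}. m dvd a} = {}" by auto
  show ?thesis unfolding empty by simp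
next
  case False
  have "{a\<in>{1..n}. m dvd a} \<subseteq> (*) m ` {1..n div m}"
  proof
    fix a assume a: "a \<in> {a\<in>{1..n}. m dvd a}"
    then obtain k where k: "a = m * k" by auto
    then have "k \<ge> 1" using a by (auto intro: Nat.gr0I)
    moreover have "k \<le> n div m" using a k False by (simp add: less_eq_div_iff_mult_less_eq mult.commute)
    ultimately show "a \<in> (*) m ` {1..n div m}" using k by auto
  qed
  then have "card {a\<in>{1..n}. m dvd a} \<le> card ((*) m ` {1..n div m})" by (intro card_mono) auto
  also have "\<dots> \<le> n div m" using card_image_le[of "{1..n div m}" "(*) m"] by simp
  finally have "real (card {a\<in>{1..n}. m dvd a}) \<le> real (n div m)" by simp
  also have "\<dots> \<le> real n / real m" by (rule of_nat_div_le_of_nat)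
  finally show ?thesis .
qed

section \<open>Union bounds for the inadmissible denominators\<close>

lemma card_UN_multiples_le:
  assumes "finite I"
  shows "real (card {a\<in>{1..n}. \<exists>i\<in>I. f i dvd a}) \<le> (\<Sum>i\<in>I. real n / real (f i))"
proof -
  have "{a\<in>{1..n}. \<exists>i\<in>I. f i dvd a} = (\<Union>i\<in>I. {a\<in>{1..n}. f i dvd a})" by auto
  then have "card {a\<in>{1..n}. \<exists>i\<in>I. f i dvd a} \<le> (\<Sum>i\<in>I. card {a\<in>{1..n}. f i dvd a})"
    using card_UN_le[OF assms, of "\<lambda>i. {a\<in>{1..n}. f i dvd a}"] by simp
  then have "real (card {a\<in>{1..n}. \<exists>i\<in>I. f i dvd a}) \<le> (\<Sum>i\<in>I. real (card {a\<in>{1..n}. f i dvd a}))"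
    by (simp only: of_nat_le_iff flip: of_nat_sum)
  also have "\<dots> \<le> (\<Sum>i\<in>I. real n / real (f i))" by (intro sum_mono card_multiples_le)
  finally show ?thesis .
qed

lemma sum_inverse_squares_le:
  assumes "P \<ge> 1"
  shows "(\<Sum>m\<in>{P<..n}. 1 / (real m)\<^sup>2) \<le> 1 / real P"
proof -
  have "(\<Sum>m\<in>{P<..n}. 1 / (real m)\<^sup>2) \<le> 1 / real P - 1 / real n" if "P \<le> n"
    using that
  proof (induction n rule: dec_induct)
    case (step n)
    have "1 / (real (Suc n))\<^sup>2 \<le> 1 / real n - 1 / real (Suc n)"
    proof -
      have n: "real n > 0" using step.hyps(1) assms by simp
      then have "1 / (real (Suc n))\<^sup>2 \<le> 1 / (real n * real (Suc n))"
        unfolding power2_eq_square by (intro divide_left_mono mult_right_mono) auto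
      also have "\<dots> = 1 / real n - 1 / real (Suc n)" using n by (simp add: field_simps)
      finally show ?thesis .
    qed
    moreover have "{P<..Suc n} = insert (Suc n) {P<..n}" using step by auto
    ultimately show ?case using step.IH by simp
  qed simp
  moreover have "1 / real P - 1 / real n \<le> 1 / real P" by simp
  ultimately show ?thesis using assms by (cases "P \<le> n") (blast intro: order_trans, simp)
qed

text \<open>Compare multiplicities prime by prime: up to \<open>P0\<close> the product offers
  exponent at least \<open>e\<close>, between \<open>P0\<close> and \<open>y\<close> at least
  \<open>1\<close>, and above \<open>y\<close> nothing is guaranteed. The square case ranges over
  all integers \<open>p > P0\<close>, since the union bound over them already converges.\<close>

lemma not_dvd_smooth_cases:
  fixes a P0 y d e :: nat
  assumes a: "a > 0" "d > 0" and n: "\<not> a dvd (d * fact P0 ^ e) * \<Prod>{p. prime p \<and> P0 < p \<and> p \<le> y}"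
  shows "(\<exists>p. prime p \<and> y < p \<and> p dvd a) \<or> (\<exists>p>P0. p\<^sup>2 dvd a) \<or> (\<exists>p. prime p \<and> p \<le> P0 \<and> p ^ (e + 1) dvd a)"
proof (rule ccontr)
  assume H: "\<not> ?thesis"
  define S where "S = {p::nat. prime p \<and> P0 < p \<and> p \<le> y}"
  define Q where "Q = (d * fact P0 ^ e) * \<Prod>S"
  have fin: "finite S" by (rule finite_subset[of _ "{..y}"]) (auto simp: S_def)
  have "\<Prod>S > 0" by (rule prod_pos) (auto simp: S_def)
  then have Q: "Q \<noteq> 0" using a by (simp add: Q_def)
  have "multiplicity p a \<le> multiplicity p Q" if p: "prime p" for p
  proof -
    have np: "\<not> is_unit p" using p not_prime_unit by blast
    consider "p \<le> P0" | "P0 < p" "p \<le> y" | "p > y" by linarith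
    then show ?thesis
    proof cases
      case 1
      then have "\<not> p ^ (e + 1) dvd a" using H p by blast
      then have "multiplicity p a \<le> e"
        using power_dvd_iff_le_multiplicity[of a p "e + 1"] a np by simp
      moreover have "p dvd fact P0" using 1 p prime_dvd_fact_iff[of p P0] by simp
      then have "p ^ e dvd Q" unfolding Q_def by (intro dvd_mult2 dvd_mult dvd_power_same)
      then have "e \<le> multiplicity p Q" using Q np by (intro multiplicity_geI) auto
      ultimately show ?thesis by simp
    next
      case 2
      then have "\<not> p\<^sup>2 dvd a" using H by blast
      then have "multiplicity p a < 2"
        using power_dvd_iff_le_multiplicity[of a p 2] a np by simp
      moreover have "p dvd \<Prod>S" using 2 p fin by (intro dvd_prodI) (auto simp: S_def)
      then have "p ^ 1 dvd Q" unfolding Q_def by simp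
      then have "1 \<le> multiplicity p Q" using Q np by (intro multiplicity_geI) auto
      ultimately show ?thesis by simp
    next
      case 3
      then have "\<not> p dvd a" using H p by blast
      then show ?thesis by (simp add: not_dvd_imp_multiplicity_0)
    qed
  qed
  then have "a dvd Q" using a by (intro multiplicity_le_imp_dvd) auto
  then show False using n by (simp add: Q_def S_def)
qed

text \<open>The three terms are union bounds for the three failures in
  \<open>not_dvd_smooth_cases\<close>: a prime beyond the cut-off, a square beyond
  \<open>P0\<close>, and a high power of a prime up to \<open>P0\<close>.\<close>

lemma card_not_dvd_smooth_le:
  fixes n N L T d P0 e :: nat
  assumes N: "2 ^ N \<le> n" "n < 2 ^ (N + 1)" and T: "8 \<le> T" "T \<le> N" and L: "L = N div T"
    and P0: "P0 \<ge> 1" and d: "d > 0"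
  shows "real (card {a\<in>{1..n}. \<not> a dvd (d * fact P0 ^ e) * \<Prod>{p. prime p \<and> P0 < p \<and> p \<le> n div 2 ^ (4 * L)}})
     \<le> real n * (20 / real T + 1 / real P0 + real P0 / 2 ^ (e + 1))"
proof -
  define y where "y = n div 2 ^ (4 * L)"
  define I1 where "I1 = {p::nat. prime p \<and> y < p \<and> p \<le> n}"
  define I3 where "I3 = {p::nat. prime p \<and> p \<le> P0}"
  define S1 where "S1 = {a\<in>{1..n}. \<exists>p\<in>I1. p dvd a}"
  define S2 where "S2 = {a\<in>{1..n}. \<exists>p\<in>{P0<..n}. p\<^sup>2 dvd a}"
  define S3 where "S3 = {a\<in>{1..n}. \<exists>p\<in>I3. p ^ (e + 1) dvd a}"
  have "I1 \<subseteq> {..n}" "I3 \<subseteq> {..P0}" unfolding I1_def I3_def by blast+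
  then have fin: "finite I1" "finite I3" by (auto intro: finite_subset)
  have "{a\<in>{1..n}. \<not> a dvd (d * fact P0 ^ e) * \<Prod>{p. prime p \<and> P0 < p \<and> p \<le> y}} \<subseteq> S1 \<union> S2 \<union> S3"
  proof
    fix a assume "a \<in> {a\<in>{1..n}. \<not> a dvd (d * fact P0 ^ e) * \<Prod>{p. prime p \<and> P0 < p \<and> p \<le> y}}"
    then have a: "a \<in> {1..n}" "a > 0" "\<not> a dvd (d * fact P0 ^ e) * \<Prod>{p. prime p \<and> P0 < p \<and> p \<le> y}" by auto
    from not_dvd_smooth_cases[OF a(2) d a(3)]
    consider p where "prime p" "y < p" "p dvd a" | p where "p > P0" "p\<^sup>2 dvd a"
      | p where "prime p" "p \<le> P0" "p ^ (e + 1) dvd a" by blast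
    then show "a \<in> S1 \<union> S2 \<union> S3"
    proof cases
      case 1
      then have "p \<le> n" using a dvd_imp_le[of p a] by auto
      then have "p \<in> I1" using 1 by (simp add: I1_def)
      then have "a \<in> S1" using a(1) 1(3) unfolding S1_def by blast
      then show ?thesis by blast
    next
      case 2
      have "p dvd p\<^sup>2" by (simp add: power2_eq_square)
      then have "p \<le> n" using 2 a dvd_imp_le[of p a] by (auto dest: dvd_trans)
      then have "p \<in> {P0<..n}" using 2 by simp
      then have "a \<in> S2" using a(1) 2(2) unfolding S2_def by blast
      then show ?thesis by blast
    next
      case 3
      then have "p \<in> I3" by (simp add: I3_def)
      then have "a \<in> S3" using a(1) 3(3) unfolding S3_def by blast
      then show ?thesis by blast
    qed
  qed
  then have "card {a\<in>{1..n}. \<not> a dvd (d * fact P0 ^ e) * \<Prod>{p. prime p \<and> P0 < p \<and> p \<le> y}} \<le> card (S1 \<union> S2 \<union> S3)"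
    by (intro card_mono) (auto simp: S1_def S2_def S3_def)
  also have "\<dots> \<le> card S1 + card S2 + card S3"
    by (meson add_le_mono1 card_Un_le order_trans)
  finally have main: "real (card {a\<in>{1..n}. \<not> a dvd (d * fact P0 ^ e) * \<Prod>{p. prime p \<and> P0 < p \<and> p \<le> y}})
     \<le> real (card S1) + real (card S2) + real (card S3)" by linarith

  have LT: "L * T \<le> N" unfolding L by (rule div_times_less_eq_dividend)
  have "8 * L \<le> L * T" using T by simp
  then have L8: "8 * L \<le> N" using LT by (rule order_trans)
  have yge: "2 ^ (N - 4 * L) \<le> y"
  proof -
    have "(2::nat) ^ N div 2 ^ (4 * L) \<le> y" unfolding y_def using N by (intro div_le_mono)
    moreover have "(2::nat) ^ N div 2 ^ (4 * L) = 2 ^ (N - 4 * L)"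
      using L8 by (simp add: power_diff)
    ultimately show ?thesis by simp
  qed
  have "real (card S1) \<le> (\<Sum>p\<in>I1. real n / real p)"
    unfolding S1_def by (rule card_UN_multiples_le[OF fin(1)])
  also have "\<dots> = real n * (\<Sum>p\<in>I1. 1 / real p)" by (simp add: sum_distrib_left)
  also have "(\<Sum>p\<in>I1. 1 / real p) \<le> (\<Sum>p\<in>{p::nat. prime p \<and> 2 ^ (N - 4 * L) < p \<and> p \<le> 2 ^ ((N - 4 * L) + (4 * L + 1))}. 1 / real p)"
  proof (rule sum_mono2)
    have eq: "(N - 4 * L) + (4 * L + 1) = N + 1" using L8 by simp
    show "finite {p::nat. prime p \<and> 2 ^ (N - 4 * L) < p \<and> p \<le> 2 ^ ((N - 4 * L) + (4 * L + 1))}"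
      by (rule finite_subset[of _ "{..2 ^ ((N - 4 * L) + (4 * L + 1))}"]) auto
    show "I1 \<subseteq> {p::nat. prime p \<and> 2 ^ (N - 4 * L) < p \<and> p \<le> 2 ^ ((N - 4 * L) + (4 * L + 1))}"
      unfolding eq I1_def using yge N by auto
  qed auto
  also have "\<dots> \<le> real (4 * L + 1) * (2 / real (N - 4 * L))"
    using L8 T by (intro primes_reciprocal_sum_le) linarith
  \<comment> \<open>From \<open>L \<le> N / T\<close>, with \<open>1 \<le> N / T\<close> absorbing
    the summand \<open>1\<close>; and \<open>8 * L \<le> N\<close> keeps the denominator above
    \<open>N / 2\<close>.\<close>
  also have "\<dots> \<le> (5 * real N / real T) * (2 / (real N / 2))"
  proof (rule mult_mono)
    have "real (L * T) \<le> real N" using LT by (simp only: of_nat_le_iff)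
    then have "real L \<le> real N / real T" using T by (simp add: field_simps)
    moreover have "1 \<le> real N / real T" using T by simp
    ultimately show "real (4 * L + 1) \<le> 5 * real N / real T" by simp
    have "real N / 2 \<le> real (N - 4 * L)" using L8 by (simp add: of_nat_diff)
    then show "2 / real (N - 4 * L) \<le> 2 / (real N / 2)" using T by (intro divide_left_mono mult_pos_pos) auto
  qed (use T in auto)
  also have "\<dots> = 20 / real T" using T by simp
  finally have c1: "real (card S1) \<le> real n * (20 / real T)" by (simp add: mult_left_mono)

  have "real (card S2) \<le> (\<Sum>p\<in>{P0<..n}. real n / real (p\<^sup>2))"
    unfolding S2_def by (rule card_UN_multiples_le) simp
  also have "\<dots> = real n * (\<Sum>p\<in>{P0<..n}. 1 / (real p)\<^sup>2)" by (simp add: sum_distrib_left)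
  also have "\<dots> \<le> real n * (1 / real P0)" by (intro mult_left_mono sum_inverse_squares_le P0) auto
  finally have c2: "real (card S2) \<le> real n * (1 / real P0)" .

  have "real (card S3) \<le> (\<Sum>p\<in>I3. real n / real (p ^ (e + 1)))"
    unfolding S3_def by (rule card_UN_multiples_le[OF fin(2)])
  also have "\<dots> \<le> (\<Sum>p\<in>I3. real n / 2 ^ (e + 1))"
  proof (rule sum_mono)
    fix p assume "p \<in> I3"
    then have "p \<ge> 2" by (auto simp: I3_def prime_ge_2_nat)
    then have "(2::real) ^ (e + 1) \<le> real p ^ (e + 1)" by (intro power_mono) auto
    moreover have "real p > 0" using \<open>p \<ge> 2\<close> by simp
    ultimately show "real n / real (p ^ (e + 1)) \<le> real n / 2 ^ (e + 1)"
      unfolding of_nat_power by (intro divide_left_mono) auto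
  qed
  also have "\<dots> = real (card I3) * (real n / 2 ^ (e + 1))" by simp
  also have "\<dots> \<le> real P0 * (real n / 2 ^ (e + 1))"
  proof (intro mult_right_mono)
    have "I3 \<subseteq> {1..P0}" by (auto simp: I3_def Suc_le_eq prime_gt_0_nat)
    then have "card I3 \<le> P0" using card_mono[of "{1..P0}" I3] by simp
    then show "real (card I3) \<le> real P0" by simp
  qed auto
  finally have c3: "real (card S3) \<le> real n * (real P0 / 2 ^ (e + 1))" by (simp add: mult.commute)
  show ?thesis using main c1 c2 c3 unfolding y_def distrib_left by linarith
qed

text \<open>Take the largest power of each \<open>q\<close> not exceeding \<open>2 ^ L\<close>. It
  falls short of \<open>2 ^ L\<close> by a factor of at most \<open>P0\<close>, and
  \<open>P0^2 \<le> 2 ^ L\<close> makes it at least the square root of \<open>2 ^ L\<close>.\<close>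

lemma prime_power_moduli:
  fixes K :: "nat set" and L P0 :: nat
  assumes K: "finite K" "\<And>q. q \<in> K \<Longrightarrow> prime q \<and> odd q \<and> q \<le> P0" and L: "P0\<^sup>2 \<le> 2 ^ L"
  shows "\<exists>M. finite M \<and> card M = card K \<and> (\<forall>m\<in>M. odd m) \<and> 1 \<notin> M \<and> pairwise coprime M \<and>
    (\<forall>m\<in>M. m \<le> 2 ^ L \<and> 2 ^ L \<le> m\<^sup>2) \<and> (\<forall>m\<in>M. \<forall>q. prime q \<longrightarrow> q dvd m \<longrightarrow> q \<le> P0)"
proof -
  have "\<forall>q\<in>K. \<exists>e. q ^ e \<le> 2 ^ L \<and> 2 ^ L < q ^ (e + 1)"
  proof
    fix q assume "q \<in> K"
    then have "2 \<le> q" using K(2) prime_ge_2_nat by blast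
    then show "\<exists>e. q ^ e \<le> 2 ^ L \<and> 2 ^ L < q ^ (e + 1)" by (rule ex_power_ivl1) simp
  qed
  then obtain e where e: "\<forall>q\<in>K. q ^ e q \<le> 2 ^ L \<and> 2 ^ L < q ^ (e q + 1)" by (rule bchoice[THEN exE])
  define f where "f q = q ^ e q" for q
  have e0: "e q \<noteq> 0" if "q \<in> K" for q
  proof
    assume "e q = 0"
    then have "2 ^ L < q" using bspec[OF e that] by simp
    moreover have "q \<le> P0\<^sup>2" using K(2)[OF that] by (auto simp: power2_eq_square intro: order_trans[OF _ le_square])
    ultimately show False using L by simp
  qed
  have cop: "coprime (f q) (f q')" if "q \<in> K" "q' \<in> K" "q \<noteq> q'" for q q'
  proof -
    have "coprime q q'" using that K(2) by (intro primes_coprime) auto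
    then show ?thesis unfolding f_def by simp
  qed
  have f1: "f q \<noteq> 1" if "q \<in> K" for q
    using e0[OF that] K(2)[OF that] by (auto simp: f_def)
  then have f1': "Suc 0 \<noteq> f q" if "q \<in> K" for q using that by fastforce
  have inj: "inj_on f K"
  proof (rule inj_onI, rule ccontr)
    fix q q' assume "q \<in> K" "q' \<in> K" "f q = f q'" "q \<noteq> q'"
    then show False using cop[of q q'] f1[of q'] by simp
  qed
  have "2 ^ L \<le> (f q)\<^sup>2" if "q \<in> K" for q
  proof -
    have "2 ^ L < f q * q" using bspec[OF e that] by (simp add: f_def mult.commute)
    also have "\<dots> \<le> f q * P0" using K(2)[OF that] by simp
    finally have "(2 ^ L)\<^sup>2 \<le> (f q * P0)\<^sup>2" by (intro power_mono) auto
    also have "\<dots> = (f q)\<^sup>2 * P0\<^sup>2" by (rule power_mult_distrib)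
    also have "\<dots> \<le> (f q)\<^sup>2 * 2 ^ L" using L by (intro mult_left_mono) auto
    finally show ?thesis by (simp add: power2_eq_square)
  qed
  moreover have "r \<le> P0" if "q \<in> K" "prime r" "r dvd f q" for q r
  proof -
    have "r dvd q" using that(2,3) unfolding f_def by (rule prime_dvd_power)
    then have "r \<le> q" using K(2)[OF that(1)] by (intro dvd_imp_le) (auto intro: prime_gt_0_nat)
    then show ?thesis using K(2)[OF that(1)] by simp
  qed
  moreover have "pairwise coprime (f ` K)" using cop by (auto simp: pairwise_def)
  moreover have "card (f ` K) = card K" using inj by (rule card_image)
  moreover have "f q \<le> 2 ^ L" "odd (f q)" if "q \<in> K" for q
    using bspec[OF e that] K(2)[OF that] by (auto simp: f_def)
  ultimately show ?thesis using K(1) f1 by (intro exI[of _ "f ` K"]) (auto simp: image_iff f1')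
qed

section \<open>Many subsets with sum in a short interval\<close>

lemma harmonic_tail_ge:
  assumes "j \<le> n"
  shows "ln ((real n + 1) / (real j + 1)) \<le> (\<Sum>a\<in>{j<..n}. 1 / real a)"
  using assms
proof (induction n rule: dec_induct)
  case (step n)
  have ins: "{j<..Suc n} = insert (Suc n) {j<..n}" using step.hyps by auto
  have pos: "real n + 1 > 0" "real j + 1 > 0" by simp_all
  have "ln ((real (Suc n) + 1) / (real j + 1)) = ln ((real n + 1) / (real j + 1)) + ln (1 + 1 / (real n + 1))"
  proof -
    have "(real (Suc n) + 1) / (real j + 1) = (real n + 1) / (real j + 1) * (1 + 1 / (real n + 1))"
    proof -
      have "A / B * (1 + 1 / A) = (A + 1) / B" if "A \<noteq> 0" for A B :: real
        using that by (simp add: distrib_left add_divide_distrib)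
      from this[of "real n + 1" "real j + 1"] show ?thesis using pos(1) by (simp add: add.commute)
    qed
    moreover have "1 + 1 / (real n + 1) > 0" using pos by (intro add_pos_pos) auto
    moreover have "(real n + 1) / (real j + 1) > 0" using pos by (intro divide_pos_pos)
    ultimately show ?thesis by (simp only: ln_mult_pos)
  qed
  also have "ln (1 + 1 / (real n + 1)) \<le> 1 / (real n + 1)"
    by (intro ln_add_one_self_le_self) simp
  also have "ln ((real n + 1) / (real j + 1)) \<le> (\<Sum>a\<in>{j<..n}. 1 / real a)" by (rule step.IH)
  finally show ?case unfolding ins by (simp add: add.commute)
qed simp

text \<open>The tilt is the \<open>u / n\<close> for which the expected sum is \<open>x - 3 / (4 * W)\<close>.  By
  Gibbs' inequality any tilt gives at least the exponent \<open>growth_const x\<close>, so it need not be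
  compared with \<open>multiplier x\<close>.\<close>

lemma card_subset_sum_interval_ge:
  fixes x W \<delta> s :: real and M :: "nat set" and n :: nat
  assumes x: "x > 0" and s: "s = exp (- 4 * x - 1) / 2" and \<delta>: "0 \<le> \<delta>" "\<delta> \<le> s\<^sup>2"
    and W: "W > 0" "3 / (2 * x) \<le> W" and n: "1 / s \<le> real n" "64 * W\<^sup>2 \<le> s\<^sup>2 * real n"
    and M: "M \<subseteq> {1..n}" "real (card ({1..n} - M)) \<le> \<delta> * real n"
  shows "exp (real n * (growth_const x * ln 2 - \<delta> * ln 2 - 2 / (x * W))) / 2
    \<le> real (card {A. A \<subseteq> M \<and> x - 1 / W \<le> (\<Sum>a\<in>A. 1 / real a) \<and> (\<Sum>a\<in>A. 1 / real a) \<le> x - 1 / (2 * W)})"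
proof -
  have fin: "finite M" using M(1) by (rule finite_subset) simp
  have Mpos: "a \<ge> 1" "a \<le> n" if "a \<in> M" for a using M(1) that by auto
  have "exp (- 4 * x - 1) < 1" using x by simp
  then have s0: "0 < s" "s < 1" unfolding s by (simp, linarith)
  have n0: "n > 0" using n(1) s0 by (cases "n = 0") auto
  have sn: "1 \<le> s * real n" using n(1) s0 by (simp add: field_simps)
  define m where "m l = (\<Sum>a\<in>M. 1 / real a / (1 + exp (l * real n / real a)))" for l

  \<comment> \<open>Origin of \<open>s\<close>. For \<open>a > s * n\<close> the factor
    \<open>1 / (1 + exp (s * n / a))\<close> is at least \<open>1 / 4\<close>; the harmonic sum over
    these \<open>a\<close> is at least \<open>ln (1 / (2 * s)) = 4 * x + 1\<close>, and the elements
    missing from \<open>M\<close> cost at most \<delta> \<open>/ s\<close>, hence at most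
    \<open>1\<close>.\<close>
  have ms: "x \<le> m s"
  proof -
    define j where "j = nat \<lfloor>s * real n\<rfloor>"
    have j1: "real j \<le> s * real n" using s0 by (simp add: j_def)
    have j2: "s * real n < real a" if "j < a" for a
    proof -
      have "\<lfloor>s * real n\<rfloor> < int a" using that unfolding j_def by linarith
      then show ?thesis by (simp add: floor_less_iff)
    qed
    have "s * real n \<le> 1 * real n" using s0 by (intro mult_right_mono) auto
    then have jn: "j \<le> n" using j1 by simp
    have "1 / (2 * s) \<le> (real n + 1) / (real j + 1)"
    proof -
      have "(real j + 1) * 1 \<le> (real n + 1) * (2 * s)" using j1 sn s0 by (simp add: algebra_simps)
      then show ?thesis using s0 by (simp add: field_simps)
    qed
    then have "ln (1 / (2 * s)) \<le> ln ((real n + 1) / (real j + 1))"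
      using s0 by (intro ln_mono) auto
    also have "\<dots> \<le> (\<Sum>a\<in>{j<..n}. 1 / real a)" by (rule harmonic_tail_ge[OF jn])
    also have "\<dots> = (\<Sum>a\<in>{j<..n} \<inter> M. 1 / real a) + (\<Sum>a\<in>{j<..n} - M. 1 / real a)"
      by (simp add: sum.Int_Diff)
    also have "(\<Sum>a\<in>{j<..n} - M. 1 / real a) \<le> (\<Sum>a\<in>{j<..n} - M. 1 / (s * real n))"
    proof (rule sum_mono)
      fix a assume "a \<in> {j<..n} - M"
      then have "s * real n \<le> real a" using j2[of a] by simp
      then show "1 / real a \<le> 1 / (s * real n)" using sn by (intro divide_left_mono) auto
    qed
    also have "\<dots> = real (card ({j<..n} - M)) / (s * real n)" by simp
    also have "\<dots> \<le> (\<delta> * real n) / (s * real n)"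
    proof (rule divide_right_mono)
      have "card ({j<..n} - M) \<le> card ({1..n} - M)" by (intro card_mono) auto
      then show "real (card ({j<..n} - M)) \<le> \<delta> * real n" using M(2) by simp
    qed (use s0 in simp)
    also have "\<dots> = \<delta> / s" using n0 by simp
    also have "\<dots> \<le> s\<^sup>2 / s" using \<delta> s0 by (intro divide_right_mono) auto
    also have "\<dots> \<le> 1" using s0 by (simp add: power2_eq_square)
    also have "(\<Sum>a\<in>{j<..n} \<inter> M. 1 / real a) \<le> 4 * m s"
    proof -
      have "(\<Sum>a\<in>{j<..n} \<inter> M. 1 / real a) \<le> (\<Sum>a\<in>{j<..n} \<inter> M. 4 * (1 / real a / (1 + exp (s * real n / real a))))"
      proof (rule sum_mono)
        fix a assume "a \<in> {j<..n} \<inter> M"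
        then have a: "s * real n \<le> real a" "a \<ge> 1" using j2[of a] Mpos[of a] by auto
        have "exp (s * real n / real a) \<le> exp 1" using a by simp
        then have "1 + exp (s * real n / real a) \<le> 4" using exp_le by linarith
        then have "1 / real a / 4 \<le> 1 / real a / (1 + exp (s * real n / real a))"
          by (intro divide_left_mono) (auto simp: add_pos_pos)
        moreover have "z \<le> 4 * w" if "z / 4 \<le> w" for z w :: real using that by simp
        ultimately show "1 / real a \<le> 4 * (1 / real a / (1 + exp (s * real n / real a)))" by blast
      qed
      also have "\<dots> \<le> (\<Sum>a\<in>M. 4 * (1 / real a / (1 + exp (s * real n / real a))))"
      proof (rule sum_mono2[OF fin])
        fix a assume "a \<in> M - {j<..n} \<inter> M"
        have "0 \<le> 1 + exp (s * real n / real a)" by (simp add: add_nonneg_nonneg)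
        then show "0 \<le> 4 * (1 / real a / (1 + exp (s * real n / real a)))" by simp
      qed auto
      also have "\<dots> = 4 * m s" by (simp add: m_def sum_distrib_left)
      finally show ?thesis .
    qed
    finally have "ln (1 / (2 * s)) \<le> 4 * m s + 1" by simp
    moreover have "ln (1 / (2 * s)) = 4 * x + 1" using x by (simp add: s ln_div)
    ultimately show ?thesis by simp
  qed

  \<comment> \<open>The other end for the intermediate value theorem:
    \<open>1 / (1 + exp t) \<le> 1 / t\<close> bounds every term by
    \<open>x / (2 * n)\<close>.\<close>
  have mx: "m (2 / x) \<le> x / 2"
  proof -
    have "m (2 / x) \<le> (\<Sum>a\<in>M. x / 2 / real n)"
      unfolding m_def
    proof (rule sum_mono)
      fix a assume a: "a \<in> M"
      define t where "t = 2 / x * real n / real a"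
      have t: "t > 0" using x n0 Mpos[OF a] by (simp add: t_def)
      have "t \<le> 1 + exp t" using exp_ge_add_one_self[of t] by linarith
      then have "1 / (1 + exp t) \<le> 1 / t" using t by (intro divide_left_mono) (auto simp: add_pos_pos)
      then have "1 / real a * (1 / (1 + exp t)) \<le> 1 / real a * (1 / t)" by (intro mult_left_mono) auto
      also have "\<dots> = x / 2 / real n" using x n0 Mpos[OF a] by (simp add: t_def)
      finally show "1 / real a / (1 + exp (2 / x * real n / real a)) \<le> x / 2 / real n" by (simp add: t_def)
    qed
    also have "\<dots> = real (card M) * (x / 2 / real n)" by simp
    also have "\<dots> \<le> real n * (x / 2 / real n)"
    proof (rule mult_right_mono)
      show "real (card M) \<le> real n" using card_mono[OF _ M(1)] by simp
    qed (use x in simp)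
    also have "\<dots> = x / 2" using n0 by simp
    finally show ?thesis .
  qed

  have "continuous_on {s..2 / x} m"
    unfolding m_def by (intro continuous_intros) (auto dest!: Mpos(1))
  moreover have "s \<le> 2 / x"
  proof -
    have "exp (- 4 * x - 1) * (4 * x) \<le> exp (- (4 * x)) * exp (4 * x)"
    proof (rule mult_mono)
      show "4 * x \<le> exp (4 * x)" using exp_ge_add_one_self[of "4 * x"] by linarith
    qed (use x in auto)
    also have "\<dots> = 1" by (simp flip: exp_add)
    finally have "exp (- 4 * x - 1) * x \<le> 1 / 4" by linarith
    then have "s * x \<le> 2" by (simp add: s)
    then show ?thesis using x by (simp add: field_simps)
  qed
  moreover have "m (2 / x) \<le> x - 3 / (4 * W)"
  proof -
    have "3 / (4 * W) \<le> x / 2" using W x by (simp add: field_simps)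
    then show ?thesis using mx by linarith
  qed
  moreover have "x - 3 / (4 * W) \<le> m s" using ms W(1) by (intro order_trans[OF _ ms]) simp
  ultimately obtain l where l: "s \<le> l" "l \<le> 2 / x" "m l = x - 3 / (4 * W)"
    using IVT2'[of m "2 / x" "x - 3 / (4 * W)" s] by auto
  have l0: "l > 0" using l s0 by linarith

  define u where "u = l * real n"
  \<comment> \<open>The target interval has midpoint \<open>x - 3 / (4 * W)\<close>, which is the
    mean at tilt \<open>l\<close>, and half-width \<open>1 / (4 * W)\<close>. Each variance term is
    at most \<open>2 / (s * n)^2\<close>, so \<open>64 * W^2 \<le> s^2 * n\<close> is exactly what
    Chebyshev needs.\<close>
  define \<rho> where "\<rho> = 1 / (4 * W)"
  have u: "u > 0" "s * real n \<le> u" using l l0 n0 by (auto simp: u_def)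
  have "2 * (\<Sum>a\<in>M. exp (- u / real a) / (real a)\<^sup>2) \<le> \<rho>\<^sup>2"
  proof -
    have "(\<Sum>a\<in>M. exp (- u / real a) / (real a)\<^sup>2) \<le> (\<Sum>a\<in>M. 2 / (s * real n)\<^sup>2)"
    proof (rule sum_mono)
      fix a assume a: "a \<in> M"
      have "exp (- (u / real a)) \<le> 2 / (u / real a)\<^sup>2"
        using u Mpos[OF a] by (intro exp_neg_le_quadratic) auto
      then have "exp (- u / real a) / (real a)\<^sup>2 \<le> 2 / (u / real a)\<^sup>2 / (real a)\<^sup>2"
        by (intro divide_right_mono) auto
      also have "\<dots> = 2 / u\<^sup>2" using Mpos[OF a] by (simp add: power_divide)
      also have "\<dots> \<le> 2 / (s * real n)\<^sup>2"
      proof (intro divide_left_mono power_mono)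
        have "0 < u\<^sup>2" "0 < (s * real n)\<^sup>2" using u sn by (intro zero_less_power; linarith)+
        then show "0 < u\<^sup>2 * (s * real n)\<^sup>2" by (rule mult_pos_pos)
      qed (use u sn in auto)
      finally show "exp (- u / real a) / (real a)\<^sup>2 \<le> 2 / (s * real n)\<^sup>2" .
    qed
    also have "\<dots> = real (card M) * (2 / (s * real n)\<^sup>2)" by simp
    also have "\<dots> \<le> real n * (2 / (s * real n)\<^sup>2)"
    proof (rule mult_right_mono)
      show "real (card M) \<le> real n" using card_mono[OF _ M(1)] by simp
    qed simp
    also have "\<dots> = 2 / (s\<^sup>2 * real n)" using n0 by (simp add: power2_eq_square)
    also have "\<dots> \<le> 2 / (64 * W\<^sup>2)" using n(2) W(1) s0 n0 by (intro divide_left_mono) auto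
    finally show ?thesis by (simp add: \<rho>_def power_divide power_mult_distrib)
  qed
  then have "(\<Prod>a\<in>M. 1 + exp (- u / real a)) / 2 * exp (u * (m l - \<rho>))
     \<le> real (card {A. A \<subseteq> M \<and> \<bar>(\<Sum>a\<in>A. 1 / real a) - m l\<bar> \<le> \<rho>})"
    using u W(1) by (intro card_sum_near_mean_ge fin) (auto simp: m_def u_def \<rho>_def)
  also have "{A. A \<subseteq> M \<and> \<bar>(\<Sum>a\<in>A. 1 / real a) - m l\<bar> \<le> \<rho>}
     = {A. A \<subseteq> M \<and> x - 1 / W \<le> (\<Sum>a\<in>A. 1 / real a) \<and> (\<Sum>a\<in>A. 1 / real a) \<le> x - 1 / (2 * W)}"
  proof -
    have "\<bar>z - m l\<bar> \<le> \<rho> \<longleftrightarrow> x - 1 / W \<le> z \<and> z \<le> x - 1 / (2 * W)" for z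
    proof -
      have "m l - \<rho> = x - 1 / W" "m l + \<rho> = x - 1 / (2 * W)"
        unfolding l(3) \<rho>_def using W(1) by (simp_all add: field_simps)
      then show ?thesis by (simp add: abs_le_iff) linarith
    qed
    then show ?thesis by simp
  qed
  finally have main: "(\<Prod>a\<in>M. 1 + exp (- u / real a)) / 2 * exp (u * (m l - \<rho>)) \<le>
    real (card {A. A \<subseteq> M \<and> x - 1 / W \<le> (\<Sum>a\<in>A. 1 / real a) \<and> (\<Sum>a\<in>A. 1 / real a) \<le> x - 1 / (2 * W)})" .

  have "exp (real n * log_part_int l) \<le> (\<Prod>a=1..n. 1 + exp (- u / real a))"
    unfolding u_def by (rule partition_function_bounds(1)[OF l0 n0])
  also have "\<dots> = (\<Prod>a\<in>{1..n} - M. 1 + exp (- u / real a)) * (\<Prod>a\<in>M. 1 + exp (- u / real a))"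
    using M(1) by (intro prod.subset_diff) auto
  also have "\<dots> \<le> 2 powr (\<delta> * real n) * (\<Prod>a\<in>M. 1 + exp (- u / real a))"
  proof (rule mult_right_mono)
    \<comment> \<open>Passing from \<open>{1..n}\<close> to \<open>M\<close> removes few factors,
      each at most \<open>2\<close>.\<close>
    have "(\<Prod>a\<in>{1..n} - M. 1 + exp (- u / real a)) \<le> (\<Prod>a\<in>{1..n} - M. 2)"
      using u by (intro prod_mono) (auto simp: add_nonneg_nonneg)
    also have "\<dots> = 2 powr real (card ({1..n} - M))" by (simp add: powr_realpow)
    also have "\<dots> \<le> 2 powr (\<delta> * real n)" using M(2) by (intro powr_mono) auto
    finally show "(\<Prod>a\<in>{1..n} - M. 1 + exp (- u / real a)) \<le> 2 powr (\<delta> * real n)" .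
    show "0 \<le> (\<Prod>a\<in>M. 1 + exp (- u / real a))" by (intro prod_nonneg) (simp add: add_nonneg_nonneg)
  qed
  finally have Z: "exp (real n * log_part_int l) \<le> exp (\<delta> * real n * ln 2) * (\<Prod>a\<in>M. 1 + exp (- u / real a))"
    by (simp add: powr_def)
  have "real n * (growth_const x * ln 2 - \<delta> * ln 2 - 2 / (x * W))
      \<le> real n * (log_part_int l - \<delta> * ln 2 + l * (x - 1 / W))"
  proof (rule mult_left_mono)
    have "l * (1 / W) \<le> 2 / x * (1 / W)" using l(2) W(1) by (intro mult_right_mono) auto
    then have "l / W \<le> 2 / (x * W)" by simp
    moreover have "growth_const x * ln 2 \<le> log_part_int l + l * x" by (rule log_part_ge_growth(1)[OF x l0])
    ultimately show "growth_const x * ln 2 - \<delta> * ln 2 - 2 / (x * W) \<le> log_part_int l - \<delta> * ln 2 + l * (x - 1 / W)"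
      by (simp add: right_diff_distrib)
  qed simp
  also have "\<dots> = real n * log_part_int l + (- (\<delta> * real n * ln 2) + u * (x - 1 / W))"
    by (simp add: u_def algebra_simps)
  finally have "exp (real n * (growth_const x * ln 2 - \<delta> * ln 2 - 2 / (x * W)))
      \<le> exp (real n * log_part_int l) * (exp (- (\<delta> * real n * ln 2)) * exp (u * (x - 1 / W)))"
    by (simp flip: exp_add)
  also have "\<dots> \<le> (exp (\<delta> * real n * ln 2) * (\<Prod>a\<in>M. 1 + exp (- u / real a))) * (exp (- (\<delta> * real n * ln 2)) * exp (u * (x - 1 / W)))"
    using Z by (intro mult_right_mono) auto
  also have "\<dots> = (\<Prod>a\<in>M. 1 + exp (- u / real a)) * exp (u * (x - 1 / W)) * (exp (\<delta> * real n * ln 2) * exp (- (\<delta> * real n * ln 2)))"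
    by (simp only: mult_ac)
  also have "exp (\<delta> * real n * ln 2) * exp (- (\<delta> * real n * ln 2)) = 1" by (simp flip: exp_add)
  also have "x - 1 / W = m l - \<rho>" unfolding l(3) \<rho>_def using W(1) by (simp add: field_simps)
  finally show ?thesis using main unfolding l(3) \<rho>_def by (simp add: mult.commute)
qed

section \<open>The number of representations\<close>

lemma harmonic_sum_le:
  assumes "n < 2 ^ N"
  shows "(\<Sum>a\<in>{1..n}. 1 / real a) \<le> real N"
proof -
  have "(\<Sum>a\<in>{1..<2 ^ N}. 1 / real a) \<le> real N"
  proof (induction N)
    case (Suc N)
    have "{1..<2 ^ Suc N} = {1..<2 ^ N} \<union> {2 ^ N..<2 ^ Suc N :: nat}"
      by (rule ivl_disj_un_two(3)[symmetric]) auto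
    moreover have "{1..<2 ^ N} \<inter> {2 ^ N..<2 ^ Suc N :: nat} = {}" by auto
    ultimately have "(\<Sum>a\<in>{1..<2 ^ Suc N}. 1 / real a)
        = (\<Sum>a\<in>{1..<2 ^ N}. 1 / real a) + (\<Sum>a\<in>{2 ^ N..<2 ^ Suc N}. 1 / real a)"
      using sum.union_disjoint[of "{1..<2 ^ N}" "{2 ^ N..<2 ^ Suc N :: nat}" "\<lambda>a. 1 / real a"] by simp
    also have "(\<Sum>a\<in>{2 ^ N..<2 ^ Suc N}. 1 / real a) \<le> (\<Sum>a\<in>{2 ^ N..<2 ^ Suc N :: nat}. 1 / 2 ^ N)"
    proof (rule sum_mono)
      fix a :: nat assume "a \<in> {2 ^ N..<2 ^ Suc N}"
      then have "real (2 ^ N) \<le> real a" by (simp only: of_nat_le_iff atLeastLessThan_iff)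
      then have "2 ^ N \<le> real a" by simp
      moreover have "(0::real) < 2 ^ N" by simp
      ultimately show "1 / real a \<le> 1 / 2 ^ N" by (intro divide_left_mono mult_pos_pos) linarith+
    qed
    also have "\<dots> = 1" by simp
    finally show ?case using Suc.IH by simp
  qed simp
  moreover have "(\<Sum>a\<in>{1..n}. 1 / real a) \<le> (\<Sum>a\<in>{1..<2 ^ N}. 1 / real a)"
    using assms by (intro sum_mono2) auto
  ultimately show ?thesis by linarith
qed

lemma sum_inverse_multiples_le:
  assumes "n < 2 ^ N" "w > 0"
  shows "(\<Sum>b\<in>{b\<in>{1..n}. w dvd b}. 1 / real b) \<le> real N / real w"
proof -
  have "{b\<in>{1..n}. w dvd b} \<subseteq> (*) w ` {1..n}"
  proof
    fix b assume "b \<in> {b\<in>{1..n}. w dvd b}"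
    then obtain k where k: "b = w * k" "1 \<le> b" "b \<le> n" by auto
    then have "1 \<le> k" "k \<le> n" using assms(2) by (auto intro: Nat.gr0I order_trans[of k "w * k" n])
    then show "b \<in> (*) w ` {1..n}" unfolding k(1) by (intro imageI) simp
  qed
  then have "(\<Sum>b\<in>{b\<in>{1..n}. w dvd b}. 1 / real b) \<le> (\<Sum>b\<in>(*) w ` {1..n}. 1 / real b)"
    by (intro sum_mono2) auto
  also have "\<dots> = (\<Sum>a\<in>{1..n}. 1 / real a) / real w" by (rule sum_mult_image_inverse[OF assms(2)])
  also have "\<dots> \<le> real N / real w" by (intro divide_right_mono harmonic_sum_le assms) simp
  finally show ?thesis .
qed

lemma eventually_linear_le_power2: "\<exists>L0. \<forall>L\<ge>L0. B * (real L + 1) \<le> 2 ^ L"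
proof -
  have "(\<lambda>n. real n / 2 ^ n) \<longlonglongrightarrow> 0" using lim_n_over_pown[of "2::real"] by simp
  moreover have "(\<lambda>n. 1 / 2 ^ n) \<longlonglongrightarrow> (0::real)"
    using LIMSEQ_power_zero[of "1 / 2 :: real"] by (simp add: power_divide)
  ultimately have "(\<lambda>n. B * (real n / 2 ^ n + 1 / 2 ^ n)) \<longlonglongrightarrow> B * (0 + 0)" by (intro tendsto_intros)
  then have "\<forall>\<^sub>F n in sequentially. B * (real n / 2 ^ n + 1 / 2 ^ n) < 1" by (rule order_tendstoD) simp
  then obtain L0 where L0: "\<forall>n\<ge>L0. B * (real n / 2 ^ n + 1 / 2 ^ n) < 1"
    unfolding eventually_sequentially by blast
  have "B * (real L + 1) \<le> 2 ^ L" if "L \<ge> L0" for L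
  proof -
    have "B * (real L / 2 ^ L + 1 / 2 ^ L) = B * (real L + 1) / 2 ^ L" by (simp add: add_divide_distrib distrib_left)
    then have "B * (real L + 1) / 2 ^ L < 1" using L0 that by auto
    then show ?thesis by (simp add: field_simps)
  qed
  then show ?thesis by blast
qed

text \<open>The parameters \<delta>, \<open>T\<close>, \<open>K\<close>, \<open>P0\<close>,
  \<open>e\<close>, \<open>W\<close> are fixed in this order and depend only on \<open>x\<close> and
  \<eta>. Only \<open>L\<close>, \<open>M\<close> and the set of primes vary with \<open>n\<close>,
  and \<open>2 ^ L\<close> eventually exceeds any multiple of \<open>L + 1\<close> formed from the
  fixed parameters.\<close>

lemma card_unit_fraction_sets_ge:
  fixes x \<eta> :: real
  assumes x: "x > 0" "x \<in> \<rat>" and \<eta>: "\<eta> > 0"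
  shows "\<forall>\<^sub>F n in sequentially. 2 powr ((growth_const x - \<eta>) * real n) \<le> real (card (unit_fraction_sets x n))"
proof -
  define s where "s = exp (- 4 * x - 1) / 2"
  have s0: "s > 0" by (simp add: s_def)
  define \<delta> where "\<delta> = min (s\<^sup>2) (\<eta> / 4)"
  have \<delta>: "\<delta> > 0" "\<delta> \<le> s\<^sup>2" "\<delta> \<le> \<eta> / 4" using s0 \<eta> by (auto simp: \<delta>_def)
  \<comment> \<open>Makes the density \<open>20 / T\<close> lost to large primes at most \<delta>
    \<open>/ 8\<close>; the summand \<open>8\<close> secures \<open>T \<ge> 8\<close>, which gives
    \<open>8 * L \<le> N\<close>.\<close>
  define T where "T = nat \<lceil>160 / \<delta>\<rceil> + 8"
  have T: "T \<ge> 8" by (simp add: T_def)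
  have "160 / \<delta> \<le> real T" unfolding T_def using real_nat_ceiling_ge[of "160 / \<delta>"] by simp
  then have T1: "20 / real T \<le> \<delta> / 8" using T \<delta>(1) by (simp add: field_simps)
  have "infinite ({p::nat. prime p} - {2})" using primes_infinite by simp
  then obtain K where K: "finite K" "card K = 4 * T" "K \<subseteq> {p::nat. prime p} - {2}"
    using infinite_arbitrarily_large by blast
  obtain r d0 where rd: "d0 > 0" "x = of_int r / of_int d0" using x(2) by (rule Rats_cases')
  define d where "d = nat d0"
  have d: "d > 0" "x * real d = of_int r" using rd by (auto simp: d_def)
  \<comment> \<open>A sum of everything \<open>P0\<close> must dominate: \<open>d\<close> and
    \<open>K\<close> keep \<open>W\<close> and the moduli \<open>P0\<close>-smooth,
    \<open>8 /\<close> \<delta> controls the loss \<open>1 / P0\<close> from squares, and the last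
    two summands pass to \<open>W\<close> through \<open>P0 \<le> W\<close>.\<close>
  define P0 where "P0 = 2 + d + \<Sum>K + nat \<lceil>8 / \<delta>\<rceil> + nat \<lceil>3 / (2 * x)\<rceil> + nat \<lceil>8 / (x * \<eta> * ln 2)\<rceil>"
  have P0: "2 \<le> P0" "d \<le> P0" by (auto simp: P0_def)
  have P0r: "8 / \<delta> \<le> real P0" "3 / (2 * x) \<le> real P0" "8 / (x * \<eta> * ln 2) \<le> real P0"
    using real_nat_ceiling_ge[of "8 / \<delta>"] real_nat_ceiling_ge[of "3 / (2 * x)"]
      real_nat_ceiling_ge[of "8 / (x * \<eta> * ln 2)"] unfolding P0_def by linarith+
  have KP0: "q \<le> P0" if "q \<in> K" for q
    using member_le_sum[of q K "\<lambda>q. q"] that K(1) unfolding P0_def by simp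
  have Kprime: "prime q \<and> odd q \<and> q \<le> P0" if "q \<in> K" for q
    using K(3) that KP0[OF that] primes_dvd_imp_eq[of 2 q] two_is_prime_nat by blast
  obtain e0 where "8 * real P0 / \<delta> < 2 ^ e0" using real_arch_pow[of 2 "8 * real P0 / \<delta>"] by auto
  \<comment> \<open>The summand \<open>1\<close> guarantees a nonzero exponent, so that
    \<open>P0 \<le> fact P0 \<le> W\<close>.\<close>
  define e where "e = e0 + 1"
  have "8 * real P0 / \<delta> \<le> 2 ^ (e + 1)" using \<open>8 * real P0 / \<delta> < 2 ^ e0\<close>
    by (rule order_trans[OF less_imp_le]) (rule power_increasing, simp_all add: e_def)
  then have e1: "real P0 / 2 ^ (e + 1) \<le> \<delta> / 8" using \<delta>(1) by (simp add: field_simps)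
  define W where "W = d * fact P0 ^ e"
  have W0: "W > 0" using d by (simp add: W_def)
  have "P0 \<le> fact P0" by (rule fact_ge_self)
  also have "fact P0 \<le> (fact P0 ^ e :: nat)" using fact_ge_1[of P0] by (intro self_le_power) (auto simp: e_def)
  also have "\<dots> \<le> W" using d by (simp add: W_def)
  finally have WP0: "P0 \<le> W" .
  have WP0r: "real P0 \<le> real W" using WP0 by simp
  have Wprimes: "q \<le> P0" if "prime q" "q dvd W" for q
  proof -
    have "q dvd d \<or> q dvd fact P0" using that unfolding W_def
      by (auto simp: prime_dvd_mult_iff dest: prime_dvd_power)
    then show ?thesis using that(1) P0(2) d dvd_imp_le[of q d] prime_dvd_fact_iff[of q P0] by auto
  qed
  have xW: "x * real W \<in> \<int>"
  proof -
    have "x * real W = x * real d * real (fact P0 ^ e)" by (simp add: W_def)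
    also have "\<dots> = of_int (r * fact P0 ^ e)" unfolding d(2) by simp
    finally show ?thesis by (metis Ints_of_int)
  qed
  have W1: "1 / real W \<le> \<delta> / 8"
  proof -
    have "8 / \<delta> \<le> real W" using P0r(1) WP0r by linarith
    then show ?thesis using \<delta>(1) W0 by (simp add: field_simps)
  qed

  \<comment> \<open>Adding up all quantities that \<open>2 ^ L\<close> must exceed. The factor
    \<open>L + 1\<close> in the growth condition serves the last summand, through
    \<open>N + 1 \<le> (L + 1) * T\<close>.\<close>
  define B where "B = real (P0\<^sup>2) + real W + 16 * real T + 8 / \<delta> + 4 * real W * real T"
  obtain L0 where L0: "\<And>L. L \<ge> L0 \<Longrightarrow> B * (real L + 1) \<le> 2 ^ L"
    using eventually_linear_le_power2[of B] by blast
  define n0 where "n0 = 2 ^ (T * (L0 + 1)) + nat \<lceil>1 / s\<rceil> + nat \<lceil>64 * (real W)\<^sup>2 / s\<^sup>2\<rceil> + nat \<lceil>2 / \<eta>\<rceil>"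

  have "2 powr ((growth_const x - \<eta>) * real n) \<le> real (card (unit_fraction_sets x n))" if n: "n \<ge> n0" for n
  proof -
    have n1: "2 ^ (T * (L0 + 1)) \<le> n" using n by (simp add: n0_def)
    have n2: "1 / s \<le> real n" "64 * (real W)\<^sup>2 / s\<^sup>2 \<le> real n" "2 / \<eta> \<le> real n"
      using n real_nat_ceiling_ge[of "1 / s"] real_nat_ceiling_ge[of "64 * (real W)\<^sup>2 / s\<^sup>2"]
        real_nat_ceiling_ge[of "2 / \<eta>"] unfolding n0_def by linarith+
    have "1 \<le> n" using n1 by (rule order_trans[rotated]) simp
    from ex_power_ivl1[OF order_refl this] obtain N where N: "2 ^ N \<le> n" "n < 2 ^ (N + 1)" by blast
    define L where "L = N div T"
    have "(2::nat) ^ (T * (L0 + 1)) < 2 ^ (N + 1)" using n1 N(2) by (rule le_less_trans)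
    then have "T * (L0 + 1) < N + 1" by (rule power_less_imp_less_exp[rotated]) simp
    then have "L0 + 1 \<le> L" unfolding L_def using T by (simp add: less_eq_div_iff_mult_less_eq mult.commute)
    then have L: "L0 \<le> L" "1 \<le> L" by simp_all
    have LT: "L * T \<le> N" unfolding L_def by (rule div_times_less_eq_dividend)
    have "T \<le> L * T" using L(2) by simp
    then have TN: "T \<le> N" using LT by (rule order_trans)
    have NLT: "N + 1 \<le> (L + 1) * T"
      using T dividend_less_div_times[of T N] unfolding L_def by simp
    have "L * 8 \<le> L * T" using T by (rule mult_le_mono2)
    then have L8: "L * 8 \<le> N" using LT by (rule order_trans)

    have BL: "B * (real L + 1) \<le> 2 ^ L" using L0 L(1) .
    have Bpos: "B \<ge> 0" using \<delta>(1) by (simp add: B_def)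
    have "B * 1 \<le> B * (real L + 1)" using Bpos by (intro mult_left_mono) auto
    then have B2L: "B \<le> 2 ^ L" using BL by simp
    have parts: "real (P0\<^sup>2) \<le> B" "real W \<le> B" "16 * real T \<le> B" "8 / \<delta> \<le> B" "4 * real W * real T \<le> B"
      unfolding B_def using \<delta>(1) by (simp_all add: add_nonneg_nonneg)
    have "real (2 ^ L) = 2 ^ L" "real (16 * T) = 16 * real T" by simp_all
    then have "real (P0\<^sup>2) \<le> real (2 ^ L)" "real W \<le> real (2 ^ L)" "real (16 * T) \<le> real (2 ^ L)"
      using order_trans[OF parts(1) B2L] order_trans[OF parts(2) B2L] order_trans[OF parts(3) B2L]
      by (simp_all only:)
    then have c1: "P0\<^sup>2 \<le> 2 ^ L" and c2: "W \<le> 2 ^ L" and c3: "16 * T \<le> 2 ^ L"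
      by (simp_all only: of_nat_le_iff)
    have c4: "1 / 2 ^ L \<le> \<delta> / 8"
    proof -
      have "8 / \<delta> \<le> 2 ^ L" using parts(4) B2L by linarith
      then show ?thesis using \<delta>(1) by (simp add: field_simps)
    qed
    have c5: "real (N + 1) / 2 ^ L \<le> 1 / (4 * real W)"
    proof -
      have "real (N + 1) \<le> real ((L + 1) * T)" using NLT by (simp only: of_nat_le_iff)
      then have "4 * real W * real (N + 1) \<le> 4 * real W * real ((L + 1) * T)" by (intro mult_left_mono) auto
      also have "\<dots> = 4 * real W * real T * (real L + 1)" by (simp add: algebra_simps)
      also have "\<dots> \<le> B * (real L + 1)" using parts(5) by (intro mult_right_mono) auto
      also note BL
      finally show ?thesis using W0 by (simp add: field_simps)
    qed

    obtain M where M: "finite M" "card M = card K" "\<forall>m\<in>M. odd m" "1 \<notin> M" "pairwise coprime M"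
      "\<forall>m\<in>M. m \<le> 2 ^ L \<and> 2 ^ L \<le> m\<^sup>2" "\<forall>m\<in>M. \<forall>q. prime q \<longrightarrow> q dvd m \<longrightarrow> q \<le> P0"
      using prime_power_moduli[OF K(1) Kprime c1] by blast
    have V: "n \<le> \<Prod>M"
    proof -
      have "(2 ^ (L * (2 * T)))\<^sup>2 = (\<Prod>m\<in>M. 2 ^ L :: nat)"
        by (simp add: M(2) K(2) flip: power_mult)
      also have "\<dots> \<le> (\<Prod>m\<in>M. m\<^sup>2)" using M(6) by (intro prod_mono) auto
      also have "\<dots> = (\<Prod>M)\<^sup>2" by (simp add: prod_power_distrib)
      finally have V2: "2 ^ (L * (2 * T)) \<le> \<Prod>M" by (rule power2_le_imp_le) simp
      have "T \<le> L * T" using L(2) by simp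
      moreover have "(L + 1) * T = L * T + T" "L * (2 * T) = L * T + L * T" by simp_all
      ultimately have "N + 1 \<le> L * (2 * T)" using NLT by linarith
      then have "(2::nat) ^ (N + 1) \<le> 2 ^ (L * (2 * T))" by (rule power_increasing) simp
      then show ?thesis using N(2) V2 by linarith
    qed

    define y where "y = n div 2 ^ (4 * L)"
    define P where "P = {p. prime p \<and> P0 < p \<and> p \<le> y}"
    have finP: "finite P" by (rule finite_subset[of _ "{..y}"]) (auto simp: P_def)
    have Pprop: "prime p \<and> P0 < p \<and> p \<le> \<Prod>M \<and> p * 2 ^ (4 * L) \<le> n" if "p \<in> P" for p
    proof -
      have p: "prime p" "P0 < p" "p \<le> y" using that by (auto simp: P_def)
      have "p * 2 ^ (4 * L) \<le> y * 2 ^ (4 * L)" using p(3) by (rule mult_le_mono1)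
      also have "\<dots> \<le> n" unfolding y_def by (rule div_times_less_eq_dividend)
      finally have "p * 2 ^ (4 * L) \<le> n" .
      moreover have "y \<le> n" unfolding y_def by (rule div_le_dividend)
      then have "p \<le> \<Prod>M" using p(3) V by (meson order_trans)
      ultimately show ?thesis using p by blast
    qed
    have Wn: "W * 2 ^ (4 * L) \<le> n"
    proof -
      have "W * 2 ^ (4 * L) \<le> 2 ^ L * 2 ^ (4 * L)" using c2 by (rule mult_le_mono1)
      also have "\<dots> = 2 ^ (L + 4 * L)" by (simp only: power_add)
      also have "\<dots> \<le> 2 ^ N" using L8 by (intro power_increasing) auto
      also note N(1)
      finally show ?thesis .
    qed
    have small: "(\<Sum>b\<in>{b\<in>{1..n}. 2 ^ L dvd b}. 1 / real b) \<le> 1 / (4 * real W)"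
    proof -
      have "(\<Sum>b\<in>{b\<in>{1..n}. 2 ^ L dvd b}. 1 / real b) \<le> real (N + 1) / real (2 ^ L)"
        using N(2) by (rule sum_inverse_multiples_le) simp
      then show ?thesis using c5 by simp
    qed

    \<comment> \<open>Every number a completion may use is excluded, at the cost of density
      \<open>1 / 2 ^ L + 1 / W\<close>. Then \<open>A\<close> is the intersection of
      \<open>A \<union> C A\<close> with \<open>Y\<close>, which makes the completion map
      injective.\<close>
    define Y where "Y = {a\<in>{1..n}. a dvd W * \<Prod>P \<and> \<not> 2 ^ L dvd a \<and> \<not> W dvd a}"
    have Y1: "Y \<subseteq> {1..n}" by (auto simp: Y_def)
    have Y2: "real (card ({1..n} - Y)) \<le> \<delta> * real n"
    proof -
      define X1 where "X1 = {a\<in>{1..n}. \<not> a dvd (d * fact P0 ^ e) * \<Prod>{p. prime p \<and> P0 < p \<and> p \<le> n div 2 ^ (4 * L)}}"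
      define X2 where "X2 = {a\<in>{1..n}. 2 ^ L dvd a}"
      define X3 where "X3 = {a\<in>{1..n}. W dvd a}"
      have "{1..n} - Y \<subseteq> X1 \<union> X2 \<union> X3"
        unfolding Y_def X1_def X2_def X3_def W_def P_def y_def by blast
      then have "card ({1..n} - Y) \<le> card (X1 \<union> X2 \<union> X3)"
        by (intro card_mono) (auto simp: X1_def X2_def X3_def)
      also have "\<dots> \<le> card (X1 \<union> X2) + card X3" by (rule card_Un_le)
      also have "\<dots> \<le> card X1 + card X2 + card X3" by (intro add_right_mono card_Un_le)
      finally have "real (card ({1..n} - Y)) \<le> real (card X1) + real (card X2) + real (card X3)" by linarith
      moreover have "real (card X1) \<le> real n * (20 / real T + 1 / real P0 + real P0 / 2 ^ (e + 1))"
        unfolding X1_def using P0(1) by (intro card_not_dvd_smooth_le[OF N T TN L_def]) (use d in linarith)+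
      moreover have "real (card X2) \<le> real n / real (2 ^ L)" unfolding X2_def by (rule card_multiples_le)
      moreover have "real (card X3) \<le> real n / real W" unfolding X3_def by (rule card_multiples_le)
      ultimately have "real (card ({1..n} - Y)) \<le> real n * (20 / real T + 1 / real P0 + real P0 / 2 ^ (e + 1) + 1 / 2 ^ L + 1 / real W)"
        by (simp add: distrib_left)
      also have "\<dots> \<le> real n * \<delta>"
      proof (rule mult_left_mono)
        have "1 / real P0 \<le> \<delta> / 8" using P0r(1) \<delta>(1) P0(1) by (simp add: field_simps)
        then show "20 / real T + 1 / real P0 + real P0 / 2 ^ (e + 1) + 1 / 2 ^ L + 1 / real W \<le> \<delta>"
          using T1 e1 c4 W1 \<delta>(1) by linarith
      qed simp
      finally show ?thesis by (simp add: mult.commute)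
    qed

    define F where "F = {A. A \<subseteq> Y \<and> x - 1 / real W \<le> (\<Sum>a\<in>A. 1 / real a) \<and> (\<Sum>a\<in>A. 1 / real a) \<le> x - 1 / (2 * real W)}"
    have F: "exp (real n * (growth_const x * ln 2 - \<delta> * ln 2 - 2 / (x * real W))) / 2 \<le> real (card F)"
      unfolding F_def
    proof (rule card_subset_sum_interval_ge[OF x(1) s_def _ \<delta>(2) _ _ n2(1) _ Y1 Y2])
      show "3 / (2 * x) \<le> real W" using P0r(2) WP0r by linarith
      show "64 * (real W)\<^sup>2 \<le> s\<^sup>2 * real n" using n2(2) s0 by (simp add: field_simps)
    qed (use \<delta>(1) W0 in auto)
    have "\<exists>B\<subseteq>{1..n}. (\<forall>b\<in>B. 2 ^ L dvd b \<or> W dvd b) \<and> (\<Sum>a\<in>A. 1 / real a) + (\<Sum>b\<in>B. 1 / real b) = x"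
      if "A \<in> F" for A
    proof (rule unit_fraction_completion[OF finP Pprop M(1) _ M(4,5) _ W0 Wn xW P0(1) Wprimes])
      have A: "A \<subseteq> Y" using that by (simp add: F_def)
      then show "finite A" using Y1 by (meson finite_atLeastAtMost finite_subset)
      show "a dvd W * \<Prod>P" if "a \<in> A" for a using A that by (auto simp: Y_def)
      show "x - 1 / real W \<le> (\<Sum>a\<in>A. 1 / real a)" "(\<Sum>a\<in>A. 1 / real a) \<le> x - 1 / real (2 * W)"
        using that by (simp_all add: F_def)
      show "(\<Sum>b\<in>{b\<in>{1..n}. 2 ^ L dvd b}. 1 / real b) \<le> 1 / real (4 * W)" using small by simp
      show "4 * card M \<le> 2 ^ L" using c3 by (simp add: M(2) K(2))
    qed (use M(3,6,7) in blast)+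
    then have "\<forall>A\<in>F. \<exists>B. B \<subseteq> {1..n} \<and> (\<forall>b\<in>B. 2 ^ L dvd b \<or> W dvd b) \<and> (\<Sum>a\<in>A. 1 / real a) + (\<Sum>b\<in>B. 1 / real b) = x"
      by blast
    then obtain C where C: "\<forall>A\<in>F. C A \<subseteq> {1..n} \<and> (\<forall>b\<in>C A. 2 ^ L dvd b \<or> W dvd b) \<and> (\<Sum>a\<in>A. 1 / real a) + (\<Sum>b\<in>C A. 1 / real b) = x"
      by (rule bchoice[THEN exE])
    have CY: "C A \<inter> Y = {}" if "A \<in> F" for A using bspec[OF C that] by (auto simp: Y_def)
    have AY: "A \<subseteq> Y" if "A \<in> F" for A using that by (simp add: F_def)
    have "inj_on (\<lambda>A. A \<union> C A) F"
    proof (rule inj_onI)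
      fix A A' assume "A \<in> F" "A' \<in> F" "A \<union> C A = A' \<union> C A'"
      then show "A = A'" using CY[of A] CY[of A'] AY[of A] AY[of A'] by blast
    qed
    then have "card F = card ((\<lambda>A. A \<union> C A) ` F)" by (rule card_image[symmetric])
    also have "\<dots> \<le> card (unit_fraction_sets x n)"
    proof (rule card_mono)
      show "finite (unit_fraction_sets x n)" unfolding unit_fraction_sets_def by simp
      show "(\<lambda>A. A \<union> C A) ` F \<subseteq> unit_fraction_sets x n"
      proof
        fix Z assume "Z \<in> (\<lambda>A. A \<union> C A) ` F"
        then obtain A where A: "A \<in> F" "Z = A \<union> C A" by blast
        have CA: "C A \<subseteq> {1..n}" "(\<Sum>a\<in>A. 1 / real a) + (\<Sum>b\<in>C A. 1 / real b) = x"
          using bspec[OF C A(1)] by blast+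
        have "A \<subseteq> {1..n}" using AY[OF A(1)] Y1 by (rule order_trans)
        moreover from this CA(1) have "finite A" "finite (C A)" by (meson finite_atLeastAtMost finite_subset)+
        moreover have "A \<inter> C A = {}" using CY[OF A(1)] AY[OF A(1)] by blast
        ultimately show "Z \<in> unit_fraction_sets x n"
          using CA unfolding A(2) unit_fraction_sets_def by (simp add: sum.union_disjoint)
      qed
    qed
    finally have FU: "real (card F) \<le> real (card (unit_fraction_sets x n))" by simp

    have "2 powr ((growth_const x - \<eta>) * real n) = exp (real n * (growth_const x * ln 2 - \<eta> * ln 2))"
      by (simp add: powr_def algebra_simps)
    also have "\<dots> \<le> exp (real n * (growth_const x * ln 2 - \<delta> * ln 2 - 2 / (x * real W)) - ln 2)"
    proof -
      \<comment> \<open>Budget: the missing denominators and the shift of the target by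
        \<open>1 / W\<close> each cost at most a quarter of \<eta>; the remaining half absorbs the
        factor \<open>1 / 2\<close> from Chebyshev.\<close>
      have "\<delta> * ln 2 \<le> \<eta> / 4 * ln 2" using \<delta>(3) by (intro mult_right_mono) auto
      moreover have "2 / (x * real W) \<le> \<eta> / 4 * ln 2"
      proof -
        have "8 / (x * \<eta> * ln 2) \<le> real W" using P0r(3) WP0r by linarith
        then show ?thesis using x(1) \<eta> W0 by (simp add: field_simps)
      qed
      ultimately have "\<delta> * ln 2 + 2 / (x * real W) \<le> \<eta> / 4 * ln 2 + \<eta> / 4 * ln 2" by (rule add_mono)
      also have "\<dots> = \<eta> / 2 * ln 2" by simp
      finally have "real n * (\<delta> * ln 2 + 2 / (x * real W)) \<le> real n * (\<eta> / 2 * ln 2)"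
        by (rule mult_left_mono) simp
      moreover have "ln 2 \<le> real n * (\<eta> / 2 * ln 2)"
      proof -
        have "1 \<le> real n * (\<eta> / 2)" using n2(3) \<eta> by (simp add: field_simps)
        then have "1 * ln 2 \<le> real n * (\<eta> / 2) * ln (2::real)" by (intro mult_right_mono) auto
        then show ?thesis by (simp only: mult_1 mult.assoc)
      qed
      moreover have "real n * (growth_const x * ln 2 - \<eta> * ln 2)
          = real n * (growth_const x * ln 2) - (real n * (\<eta> / 2 * ln 2) + real n * (\<eta> / 2 * ln 2))"
        by (simp add: algebra_simps)
      moreover have "real n * (growth_const x * ln 2 - \<delta> * ln 2 - 2 / (x * real W))
          = real n * (growth_const x * ln 2) - real n * (\<delta> * ln 2 + 2 / (x * real W))"
        by (simp add: algebra_simps)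
      moreover have "p \<le> q - l" if "a \<le> b" "l \<le> b" "p = g - (b + b)" "q = g - a" for a b g l p q :: real
        using that by linarith
      ultimately show ?thesis unfolding exp_le_cancel_iff by blast
    qed
    also have "\<dots> = exp (real n * (growth_const x * ln 2 - \<delta> * ln 2 - 2 / (x * real W))) / 2"
      by (simp add: exp_diff)
    also note F
    also note FU
    finally show ?thesis .
  qed
  then show ?thesis unfolding eventually_sequentially by blast
qed

lemma card_unit_fraction_sets_asymp:
  assumes x: "x > 0" "x \<in> \<rat>"
  shows "\<exists>e :: nat \<Rightarrow> real. e \<in> o(\<lambda>n. real n) \<and>
         (\<forall>\<^sub>F n in sequentially. real (card (unit_fraction_sets x n)) = 2 powr (growth_const x * real n + e n))"
proof -
  define u where "u n = real (card (unit_fraction_sets x n))" for n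
  define e where "e n = log 2 (u n) - growth_const x * real n" for n
  have pos: "\<forall>\<^sub>F n in sequentially. u n > 0"
    using card_unit_fraction_sets_ge[OF x zero_less_one]
  proof eventually_elim
    case (elim n)
    have "0 < 2 powr ((growth_const x - 1) * real n)" by simp
    then show ?case using elim unfolding u_def by linarith
  qed
  have "e \<in> o(\<lambda>n. real n)"
  proof (rule landau_o.smallI)
    fix c :: real assume c: "c > 0"
    show "\<forall>\<^sub>F n in sequentially. norm (e n) \<le> c * norm (real n)"
      using card_unit_fraction_sets_ge[OF x c] pos eventually_ge_at_top[of "nat \<lceil>1 / c\<rceil> + 1"]
    proof eventually_elim
      case (elim n)
      have "n > 0" "1 / c \<le> real n" using elim(3) real_nat_ceiling_ge[of "1 / c"] by linarith+
      then have cn: "1 \<le> c * real n" using c by (simp add: field_simps)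
      have "(growth_const x - c) * real n = log 2 (2 powr ((growth_const x - c) * real n))" by simp
      also have "\<dots> \<le> log 2 (u n)" using elim by (subst log_le_cancel_iff) (auto simp: u_def)
      finally have "- (c * real n) \<le> e n" by (simp add: e_def algebra_simps)
      moreover have "log 2 (u n) \<le> log 2 (2 powr (1 + growth_const x * real n))"
        using card_unit_fraction_sets_le[OF x(1) \<open>n > 0\<close>] elim(2)
        by (subst log_le_cancel_iff) (auto simp: u_def powr_add)
      then have "e n \<le> c * real n" using cn by (simp add: e_def)
      ultimately show ?case by simp
    qed
  qed
  moreover have "\<forall>\<^sub>F n in sequentially. u n = 2 powr (growth_const x * real n + e n)"
    using pos by eventually_elim (simp add: e_def)
  ultimately show ?thesis unfolding u_def by blast
qed

section \<open>The growth constant at 1\<close>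

text \<open>The Fermi function, a solution of \<open>q' = - q * (1 - q)\<close>. Numerical
  enclosures are obtained from this equation instead of from expansions of
  \<open>exp\<close>.\<close>

definition fermi :: "real \<Rightarrow> real" where
  "fermi t = 1 / (1 + exp t)"

lemma mult_fun_fermi: "mult_fun l y = fermi (l / y) / y"
  by (simp add: mult_fun_def fermi_def)

section \<open>Comparison with polynomial sub- and supersolutions\<close>

text \<open>A supersolution that starts above stays above. The substitution
  \<open>ln ((1 - q) / q)\<close> linearises the equation: \<open>g\<close> is identically
  \<open>0\<close> for \<open>fermi\<close> itself, has derivative
  \<open>(q' + q * (1 - q)) / (q * (1 - q))\<close>, and its sign tells on which side of
  \<open>fermi\<close> the function \<open>q\<close> lies.\<close>

lemma fermi_upper:
  fixes q q' :: "real \<Rightarrow> real"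
  assumes "a \<le> t" "\<And>s. a \<le> s \<Longrightarrow> s \<le> t \<Longrightarrow> (q has_real_derivative q' s) (at s)"
    and "\<And>s. a \<le> s \<Longrightarrow> s \<le> t \<Longrightarrow> 0 < q s \<and> q s < 1 \<and> 0 \<le> q' s + q s * (1 - q s)"
    and "fermi a \<le> q a"
  shows "fermi t \<le> q t"
proof -
  define g where "g s = s - ln ((1 - q s) / q s)" for s
  have "g a \<le> g t"
  proof (rule DERIV_nonneg_imp_nondecreasing[OF assms(1)])
    fix s assume s: "a \<le> s" "s \<le> t"
    have q: "0 < q s" "q s < 1" "0 \<le> q' s + q s * (1 - q s)" using assms(3)[OF s] by auto
    have "(g has_real_derivative 1 + q' s / (q s * (1 - q s))) (at s)"
      unfolding g_def using q assms(2)[OF s]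
      by (auto intro!: derivative_eq_intros simp: divide_simps) (simp add: algebra_simps)
    moreover have "1 + q' s / (q s * (1 - q s)) = (q' s + q s * (1 - q s)) / (q s * (1 - q s))"
      using q by (simp add: add_divide_distrib)
    ultimately show "\<exists>y. (g has_real_derivative y) (at s) \<and> 0 \<le> y" using q by auto
  qed
  moreover have "g a \<ge> 0"
  proof -
    have q: "0 < q a" "q a < 1" using assms(3)[of a] assms(1) by auto
    have "1 \<le> q a * (1 + exp a)" using assms(4) by (simp add: fermi_def field_simps add_pos_pos)
    then have "(1 - q a) / q a \<le> exp a" using q by (simp add: field_simps)
    then have "ln ((1 - q a) / q a) \<le> ln (exp a)" using q by (intro ln_mono) auto
    then show ?thesis by (simp add: g_def)
  qed
  ultimately have "ln ((1 - q t) / q t) \<le> t" by (simp add: g_def)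
  moreover have q: "0 < q t" "q t < 1" using assms(3)[of t] assms(1) by auto
  ultimately have "(1 - q t) / q t \<le> exp t" by (metis diff_gt_0_iff_gt divide_pos_pos exp_le_cancel_iff exp_ln)
  then have "1 \<le> q t * (1 + exp t)" using q by (simp add: field_simps)
  then show ?thesis by (simp add: fermi_def field_simps add_pos_pos)
qed

lemma fermi_lower:
  fixes q q' :: "real \<Rightarrow> real"
  assumes "a \<le> t" "\<And>s. a \<le> s \<Longrightarrow> s \<le> t \<Longrightarrow> (q has_real_derivative q' s) (at s)"
    and "\<And>s. a \<le> s \<Longrightarrow> s \<le> t \<Longrightarrow> 0 < q s \<and> q s < 1 \<and> q' s + q s * (1 - q s) \<le> 0"
    and "q a \<le> fermi a"
  shows "q t \<le> fermi t"
proof -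
  define g where "g s = s - ln ((1 - q s) / q s)" for s
  have "g t \<le> g a"
  proof (rule DERIV_nonpos_imp_nonincreasing[OF assms(1)])
    fix s assume s: "a \<le> s" "s \<le> t"
    have q: "0 < q s" "q s < 1" "q' s + q s * (1 - q s) \<le> 0" using assms(3)[OF s] by auto
    have "(g has_real_derivative 1 + q' s / (q s * (1 - q s))) (at s)"
      unfolding g_def using q assms(2)[OF s]
      by (auto intro!: derivative_eq_intros simp: divide_simps) (simp add: algebra_simps)
    moreover have "1 + q' s / (q s * (1 - q s)) = (q' s + q s * (1 - q s)) / (q s * (1 - q s))"
      using q by (simp add: add_divide_distrib)
    moreover have "(q' s + q s * (1 - q s)) / (q s * (1 - q s)) \<le> 0"
      using q by (intro divide_nonpos_pos) auto
    ultimately show "\<exists>y. (g has_real_derivative y) (at s) \<and> y \<le> 0" by auto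
  qed
  moreover have "g a \<le> 0"
  proof -
    have q: "0 < q a" "q a < 1" using assms(3)[of a] assms(1) by auto
    have "q a * (1 + exp a) \<le> 1" using assms(4) by (simp add: fermi_def field_simps add_pos_pos)
    then have "exp a \<le> (1 - q a) / q a" using q by (simp add: field_simps)
    then have "ln (exp a) \<le> ln ((1 - q a) / q a)" by (intro ln_mono) auto
    then show ?thesis by (simp add: g_def)
  qed
  ultimately have "t \<le> ln ((1 - q t) / q t)" by (simp add: g_def)
  moreover have q: "0 < q t" "q t < 1" using assms(3)[of t] assms(1) by auto
  ultimately have "exp t \<le> (1 - q t) / q t" by (simp add: ln_ge_iff)
  then have "q t * (1 + exp t) \<le> 1" using q by (simp add: field_simps)
  then show ?thesis by (simp add: fermi_def field_simps add_pos_pos)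
qed

text \<open>Horner form of the sum of the \<open>\<bar>c_i\<bar> * h ^ i\<close>, so that the
  simplifier can evaluate it on explicit coefficient lists.\<close>

primrec abs_poly_bound :: "real \<Rightarrow> real list \<Rightarrow> real" where
  "abs_poly_bound h [] = 0"
| "abs_poly_bound h (c # cs) = \<bar>c\<bar> + h * abs_poly_bound h cs"

lemma abs_poly_le:
  assumes "\<bar>s\<bar> \<le> h" shows "\<bar>poly (Poly cs) s\<bar> \<le> abs_poly_bound h cs"
proof (induction cs)
  case (Cons c cs)
  have "\<bar>poly (Poly (c # cs)) s\<bar> \<le> \<bar>c\<bar> + \<bar>s\<bar> * \<bar>poly (Poly cs) s\<bar>"
    using abs_triangle_ineq[of c "s * poly (Poly cs) s"] by (simp add: abs_mult)
  also have "\<bar>s\<bar> * \<bar>poly (Poly cs) s\<bar> \<le> h * abs_poly_bound h cs"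
    using assms Cons by (intro mult_mono) auto
  finally show ?case by simp
qed simp

text \<open>Certifies the sign of a polynomial on a whole interval: it suffices that the constant
  coefficient outweighs the bound on the rest.\<close>

lemma abs_poly_Cons_le:
  assumes "\<bar>s\<bar> \<le> h" shows "\<bar>poly (Poly (c # cs)) s - c\<bar> \<le> h * abs_poly_bound h cs"
proof -
  have "\<bar>poly (Poly (c # cs)) s - c\<bar> = \<bar>s\<bar> * \<bar>poly (Poly cs) s\<bar>" by (simp add: abs_mult)
  also have "\<dots> \<le> h * abs_poly_bound h cs"
    using assms abs_poly_le[OF assms, of cs] by (intro mult_mono) auto
  finally show ?thesis .
qed

text \<open>\<open>Poly (p0 # ps)\<close> approximates \<open>fermi\<close> on \<open>{a..a + 1}\<close> in the variable \<open>t - a - 1 / 2\<close>, and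
  \<open>Poly (r0 # rs)\<close> is its residual in the equation \<open>fermi' + fermi - fermi\<^sup>2 = 0\<close>.\<close>

lemma fermi_poly_upper:
  assumes R: "Poly (r0 # rs) = pderiv (Poly (p0 # ps)) + Poly (p0 # ps) - Poly (p0 # ps) * Poly (p0 # ps)"
    and "1 / 2 * abs_poly_bound (1 / 2) rs \<le> r0"
    and "1 / 2 * abs_poly_bound (1 / 2) ps < p0" "p0 + 1 / 2 * abs_poly_bound (1 / 2) ps < 1"
    and "fermi a \<le> poly (Poly (p0 # ps)) (- 1 / 2)" and t: "a \<le> t" "t \<le> a + 1"
  shows "fermi t \<le> poly (Poly (p0 # ps)) (t - (a + 1 / 2))"
proof (rule fermi_upper[where q = "\<lambda>t. poly (Poly (p0 # ps)) (t - (a + 1 / 2))"])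
  show "((\<lambda>t. poly (Poly (p0 # ps)) (t - (a + 1 / 2))) has_real_derivative
      poly (pderiv (Poly (p0 # ps))) (s - (a + 1 / 2))) (at s)" for s
  proof -
    have "((\<lambda>t. t - (a + 1 / 2)) has_real_derivative 1) (at s)" by (auto intro!: derivative_eq_intros)
    from DERIV_chain2[OF poly_DERIV[of "Poly (p0 # ps)"] this] show ?thesis by (simp only: mult_1_right)
  qed
  fix s assume s: "a \<le> s" "s \<le> t"
  define z where "z = s - (a + 1 / 2)"
  have z: "\<bar>z\<bar> \<le> 1 / 2" using s t unfolding z_def abs_le_iff by linarith
  have "poly (Poly (r0 # rs)) z = poly (pderiv (Poly (p0 # ps))) z + poly (Poly (p0 # ps)) z * (1 - poly (Poly (p0 # ps)) z)"
    unfolding R by (simp add: algebra_simps del: Poly.simps)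
  then show "0 < poly (Poly (p0 # ps)) (s - (a + 1 / 2)) \<and> poly (Poly (p0 # ps)) (s - (a + 1 / 2)) < 1 \<and>
    0 \<le> poly (pderiv (Poly (p0 # ps))) (s - (a + 1 / 2)) + poly (Poly (p0 # ps)) (s - (a + 1 / 2)) * (1 - poly (Poly (p0 # ps)) (s - (a + 1 / 2)))"
    using abs_poly_Cons_le[OF z, of r0 rs] abs_poly_Cons_le[OF z, of p0 ps] assms(2-4)
    unfolding z_def[symmetric] abs_le_iff by linarith
qed (use assms in \<open>auto simp del: Poly.simps\<close>)

lemma fermi_poly_lower:
  assumes R: "Poly (r0 # rs) = pderiv (Poly (p0 # ps)) + Poly (p0 # ps) - Poly (p0 # ps) * Poly (p0 # ps)"
    and "1 / 2 * abs_poly_bound (1 / 2) rs \<le> - r0"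
    and "1 / 2 * abs_poly_bound (1 / 2) ps < p0" "p0 + 1 / 2 * abs_poly_bound (1 / 2) ps < 1"
    and "poly (Poly (p0 # ps)) (- 1 / 2) \<le> fermi a" and t: "a \<le> t" "t \<le> a + 1"
  shows "poly (Poly (p0 # ps)) (t - (a + 1 / 2)) \<le> fermi t"
proof (rule fermi_lower[where q = "\<lambda>t. poly (Poly (p0 # ps)) (t - (a + 1 / 2))"])
  show "((\<lambda>t. poly (Poly (p0 # ps)) (t - (a + 1 / 2))) has_real_derivative
      poly (pderiv (Poly (p0 # ps))) (s - (a + 1 / 2))) (at s)" for s
  proof -
    have "((\<lambda>t. t - (a + 1 / 2)) has_real_derivative 1) (at s)" by (auto intro!: derivative_eq_intros)
    from DERIV_chain2[OF poly_DERIV[of "Poly (p0 # ps)"] this] show ?thesis by (simp only: mult_1_right)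
  qed
  fix s assume s: "a \<le> s" "s \<le> t"
  define z where "z = s - (a + 1 / 2)"
  have z: "\<bar>z\<bar> \<le> 1 / 2" using s t unfolding z_def abs_le_iff by linarith
  have "poly (Poly (r0 # rs)) z = poly (pderiv (Poly (p0 # ps))) z + poly (Poly (p0 # ps)) z * (1 - poly (Poly (p0 # ps)) z)"
    unfolding R by (simp add: algebra_simps del: Poly.simps)
  then show "0 < poly (Poly (p0 # ps)) (s - (a + 1 / 2)) \<and> poly (Poly (p0 # ps)) (s - (a + 1 / 2)) < 1 \<and>
    poly (pderiv (Poly (p0 # ps))) (s - (a + 1 / 2)) + poly (Poly (p0 # ps)) (s - (a + 1 / 2)) * (1 - poly (Poly (p0 # ps)) (s - (a + 1 / 2))) \<le> 0"
    using abs_poly_Cons_le[OF z, of r0 rs] abs_poly_Cons_le[OF z, of p0 ps] assms(2-4)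
    unfolding z_def[symmetric] abs_le_iff by linarith
qed (use assms in \<open>auto simp del: Poly.simps\<close>)

section \<open>Integrating the bounds after substituting \<open>t = l / y\<close>\<close>

text \<open>The substitution turns the integrand into \<open>p (t - c) / t\<close>. The hypothesis
  on \<open>v\<close> is division of \<open>p\<close> by \<open>t\<close>, in the shifted variable:
  the remainder \<open>A\<close> produces the logarithm and the quotient \<open>pderiv v\<close>
  integrates to \<open>v\<close>.\<close>

lemma has_integral_poly_over_y:
  fixes p v :: "real poly"
  assumes l: "l > 0" and ab: "0 < a" "a \<le> b" and v: "p = [:A:] + [:c, 1:] * pderiv v"
  shows "((\<lambda>y. poly p (l / y - c) / y) has_integral (A * ln (b / a) + poly v (b - c) - poly v (a - c))) {l / b..l / a}"
proof -
  define g where "g y = A * ln y - poly v (l / y - c)" for y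
  have "(g has_vector_derivative poly p (l / y - c) / y) (at y within {l / b..l / a})" if y: "y \<in> {l / b..l / a}" for y
  proof -
    have "0 < l / b" using l ab by simp
    then have y0: "y > 0" using y by auto
    have "((\<lambda>y. l / y - c) has_real_derivative - (l / y\<^sup>2)) (at y)"
      using y0 by (auto intro!: derivative_eq_intros simp: power2_eq_square)
    from DERIV_chain2[OF poly_DERIV[of v] this]
    have "((\<lambda>y. poly v (l / y - c)) has_real_derivative poly (pderiv v) (l / y - c) * - (l / y\<^sup>2)) (at y)" .
    moreover have "((\<lambda>y. A * ln y) has_real_derivative A * (1 / y)) (at y)"
      using y0 by (auto intro!: derivative_eq_intros)
    ultimately have "(g has_real_derivative A * (1 / y) - poly (pderiv v) (l / y - c) * - (l / y\<^sup>2)) (at y)"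
      unfolding g_def by (intro DERIV_diff)
    also have "A * (1 / y) - poly (pderiv v) (l / y - c) * - (l / y\<^sup>2) = poly p (l / y - c) / y"
      unfolding v using y0 by (simp add: field_simps power2_eq_square)
    finally show ?thesis
      by (simp add: has_real_derivative_iff_has_vector_derivative has_vector_derivative_at_within)
  qed
  then have "((\<lambda>y. poly p (l / y - c) / y) has_integral (g (l / a) - g (l / b))) {l / b..l / a}"
    using l ab by (intro fundamental_theorem_of_calculus) (auto intro: divide_left_mono)
  also have "g (l / a) - g (l / b) = A * ln (b / a) + poly v (b - c) - poly v (a - c)"
    using l ab by (simp add: g_def ln_div algebra_simps)
  finally show ?thesis .
qed

lemma integral_mult_fun_upper:
  fixes p v :: "real poly"
  assumes l: "l > 0" and ab: "0 < a" "a \<le> b" and v: "p = [:A:] + [:c, 1:] * pderiv v"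
    and p: "\<And>t. a \<le> t \<Longrightarrow> t \<le> b \<Longrightarrow> fermi t \<le> poly p (t - c)"
  shows "integral {l / b..l / a} (mult_fun l) \<le> A * ln (b / a) + poly v (b - c) - poly v (a - c)"
proof (rule has_integral_le[OF integrable_integral has_integral_poly_over_y[OF l ab v]])
  show "mult_fun l integrable_on {l / b..l / a}" using l ab by (intro mult_fun_integrable) auto
  fix y assume y: "y \<in> {l / b..l / a}"
  have "0 < l / b" using l ab by simp
  then have "y > 0" using y by auto
  moreover have "a \<le> l / y" "l / y \<le> b" using y l ab \<open>y > 0\<close> by (auto simp: field_simps)
  ultimately show "mult_fun l y \<le> poly p (l / y - c) / y"
    unfolding mult_fun_fermi by (intro divide_right_mono p) auto
qed

lemma integral_mult_fun_lower:
  fixes p v :: "real poly"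
  assumes l: "l > 0" and ab: "0 < a" "a \<le> b" and v: "p = [:A:] + [:c, 1:] * pderiv v"
    and p: "\<And>t. a \<le> t \<Longrightarrow> t \<le> b \<Longrightarrow> poly p (t - c) \<le> fermi t"
  shows "A * ln (b / a) + poly v (b - c) - poly v (a - c) \<le> integral {l / b..l / a} (mult_fun l)"
proof (rule has_integral_le[OF has_integral_poly_over_y[OF l ab v] integrable_integral])
  show "mult_fun l integrable_on {l / b..l / a}" using l ab by (intro mult_fun_integrable) auto
  fix y assume y: "y \<in> {l / b..l / a}"
  have "0 < l / b" using l ab by simp
  then have "y > 0" using y by auto
  moreover have "a \<le> l / y" "l / y \<le> b" using y l ab \<open>y > 0\<close> by (auto simp: field_simps)
  ultimately show "poly p (l / y - c) / y \<le> mult_fun l y"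
    unfolding mult_fun_fermi by (intro divide_right_mono p) auto
qed

text \<open>The antiderivative is \<open>U (l / y)\<close>; the exponential bound lets it extend
  continuously by \<open>0\<close> to \<open>y = 0\<close>, the image of \<open>t\<close> at
  infinity.\<close>

lemma has_integral_tail:
  fixes U U' :: "real \<Rightarrow> real"
  assumes l: "l > 0" and T: "T > 0" and U: "\<And>t. T < t \<Longrightarrow> (U has_real_derivative U' t) (at t)"
    and cont: "continuous_on {T..} U" and bound: "\<And>t. T \<le> t \<Longrightarrow> \<bar>U t\<bar> \<le> exp (- t)"
  shows "((\<lambda>y. - U' (l / y) * (l / y\<^sup>2)) has_integral U T) {0..l / T}"
proof -
  define g where "g y = (if y = 0 then 0 else U (l / y))" for y
  have ge: "T \<le> l / y" if "0 < y" "y \<le> l / T" for y using that l T by (simp add: field_simps)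
  have "continuous_on {0..l / T} g"
  proof (rule continuous_on_linear_vanish)
    have "continuous_on {0<..l / T} (\<lambda>y. U (l / y))"
      using ge by (intro continuous_on_compose2[OF cont] continuous_intros) auto
    then show "continuous_on {0<..l / T} g" by (rule continuous_on_eq) (auto simp: g_def)
    fix y assume y: "0 < y" "y \<le> l / T"
    have "\<bar>g y\<bar> \<le> exp (- (l / y))" using y bound[OF ge[OF y]] by (simp add: g_def)
    also have "\<dots> \<le> 2 / (l / y)\<^sup>2" using y l by (intro exp_neg_le_quadratic) auto
    also have "\<dots> = 2 / l\<^sup>2 * y * y" by (simp add: power2_eq_square)
    also have "\<dots> \<le> 2 / l\<^sup>2 * y * (l / T)" using y by (intro mult_left_mono) auto
    finally show "\<bar>g y\<bar> \<le> 2 / l\<^sup>2 * (l / T) * y" by (simp add: mult_ac)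
  qed (simp add: g_def)
  moreover have "(g has_vector_derivative - U' (l / y) * (l / y\<^sup>2)) (at y)" if y: "y \<in> {0<..<l / T}" for y
  proof -
    have "T < l / y" using y l T by (simp add: field_simps)
    moreover have "((\<lambda>y. l / y) has_real_derivative - (l / y\<^sup>2)) (at y)"
      using y by (auto intro!: derivative_eq_intros simp: power2_eq_square)
    ultimately have D: "((\<lambda>y. U (l / y)) has_real_derivative U' (l / y) * - (l / y\<^sup>2)) (at y)"
      by (intro DERIV_chain2[OF U])
    have "\<forall>\<^sub>F z in nhds y. z \<in> {0<..}" using y by (intro eventually_nhds_in_open) auto
    then have ev: "\<forall>\<^sub>F z in nhds y. U (l / z) = g z"
      by eventually_elim (simp add: g_def)
    have "(g has_real_derivative U' (l / y) * - (l / y\<^sup>2)) (at y)"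
      using D DERIV_cong_ev[OF refl ev refl, of "U' (l / y) * - (l / y\<^sup>2)"] by simp
    then show ?thesis by (simp add: has_real_derivative_iff_has_vector_derivative)
  qed
  ultimately have "((\<lambda>y. - U' (l / y) * (l / y\<^sup>2)) has_integral (g (l / T) - g 0)) {0..l / T}"
    using l T by (intro fundamental_theorem_of_calculus_interior) auto
  then show ?thesis using l T by (simp add: g_def)
qed

lemma fermi_le_exp: "fermi t \<le> exp (- t)"
  unfolding fermi_def by (rule inverse_one_plus_exp_le)

text \<open>The tail is at most the exponential integral of \<open>exp (- t) / t\<close> from
  \<open>T\<close> on. \<open>U\<close> is the third convergent
  \<open>exp (- t) / (t + 1 / (1 + 1 / t))\<close> of its continued fraction, and
  \<open>- U'\<close> exceeds \<open>exp (- t) / t\<close>.\<close>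

lemma tail_upper:
  assumes l: "l > 0" and T1: "T \<ge> 1"
  shows "integral {0..l / T} (mult_fun l) \<le> exp (- T) * (T + 1) / (T * (T + 2))"
proof -
  have T: "T > 0" using T1 by simp
  define U where "U t = exp (- t) * (t + 1) / (t * (t + 2))" for t :: real
  define U' where "U' t = - (exp (- t) * (t ^ 3 + 4 * t\<^sup>2 + 4 * t + 2) / (t * (t + 2))\<^sup>2)" for t :: real
  have int: "((\<lambda>y. - U' (l / y) * (l / y\<^sup>2)) has_integral U T) {0..l / T}"
  proof (rule has_integral_tail[OF l T])
    show "(U has_real_derivative U' t) (at t)" if "T < t" for t
      unfolding U_def U'_def using that T
      by (auto intro!: derivative_eq_intros simp: power2_eq_square power3_eq_cube) (simp add: divide_simps, simp add: algebra_simps)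
    show "continuous_on {T..} U" unfolding U_def using T by (intro continuous_intros) auto
    show "\<bar>U t\<bar> \<le> exp (- t)" if "T \<le> t" for t
    proof -
      have t: "1 \<le> t" using that T1 by simp
      then have "1 * 1 \<le> t * t" by (intro mult_mono) auto
      then have "t + 1 \<le> t * (t + 2)" using t by (simp add: algebra_simps)
      then have "(t + 1) / (t * (t + 2)) \<le> 1" using t by simp
      then have "exp (- t) * ((t + 1) / (t * (t + 2))) \<le> exp (- t) * 1" by (intro mult_left_mono) auto
      then show ?thesis using t by (simp add: U_def)
    qed
  qed
  have "mult_fun l integrable_on {0..l / T}" using l T by (intro mult_fun_integrable) auto
  then have "integral {0..l / T} (mult_fun l) \<le> U T"
  proof (rule has_integral_le[OF integrable_integral int])
    fix y assume y: "y \<in> {0..l / T}"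
    show "mult_fun l y \<le> - U' (l / y) * (l / y\<^sup>2)"
    proof (cases "y = 0")
      case False
      define t where "t = l / y"
      have t: "t > 0" "y > 0" using y False l by (auto simp: t_def)
      have "1 / t \<le> (t ^ 3 + 4 * t\<^sup>2 + 4 * t + 2) / (t * (t + 2))\<^sup>2"
        using t(1) by (simp add: divide_simps) (simp add: algebra_simps power2_eq_square power3_eq_cube)
      then have "exp (- t) * (1 / t) \<le> exp (- t) * ((t ^ 3 + 4 * t\<^sup>2 + 4 * t + 2) / (t * (t + 2))\<^sup>2)"
        by (intro mult_left_mono) auto
      then have "exp (- t) * (1 / t) \<le> - U' t" by (simp add: U'_def)
      moreover have "fermi t * (1 / t) \<le> exp (- t) * (1 / t)" using t fermi_le_exp by (intro mult_right_mono) auto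
      ultimately have "fermi t * (1 / t) * (l / y\<^sup>2) \<le> - U' t * (l / y\<^sup>2)"
        using l by (intro mult_right_mono) auto
      moreover have "z * (1 / t) * (l / y\<^sup>2) = z / y" for z
        using t l by (simp add: t_def power2_eq_square)
      ultimately show ?thesis unfolding mult_fun_fermi t_def[symmetric] by simp
    qed (simp add: mult_fun_def)
  qed
  then show ?thesis by (simp add: U_def)
qed

text \<open>For \<open>t \<ge> T\<close> one has
  \<open>fermi t \<ge> (1 - exp (- T)) * exp (- t)\<close>; the factor \<open>1 / (t + 1)\<close> in
  \<open>U\<close> is the second convergent for the exponential integral, a lower bound.\<close>

lemma tail_lower:
  assumes l: "l > 0" and T: "T > 0"
  shows "(1 - exp (- T)) * exp (- T) / (T + 1) \<le> integral {0..l / T} (mult_fun l)"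
proof -
  define k where "k = 1 - exp (- T)"
  have k: "0 \<le> k" "k \<le> 1" using T by (auto simp: k_def)
  define U where "U t = k * exp (- t) / (t + 1)" for t :: real
  define U' where "U' t = - (k * exp (- t) * (t + 2) / (t + 1)\<^sup>2)" for t :: real
  have int: "((\<lambda>y. - U' (l / y) * (l / y\<^sup>2)) has_integral U T) {0..l / T}"
  proof (rule has_integral_tail[OF l T])
    show "(U has_real_derivative U' t) (at t)" if "T < t" for t
      unfolding U_def U'_def using that T
      by (auto intro!: derivative_eq_intros simp: power2_eq_square) (simp add: divide_simps, simp add: algebra_simps)
    show "continuous_on {T..} U" unfolding U_def using T by (intro continuous_intros) auto
    show "\<bar>U t\<bar> \<le> exp (- t)" if "T \<le> t" for t
    proof -
      have "k * exp (- t) / (t + 1) \<le> 1 * exp (- t) / 1"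
        using that T k by (intro frac_le mult_right_mono) auto
      then show ?thesis using that T k by (simp add: U_def)
    qed
  qed
  have int': "mult_fun l integrable_on {0..l / T}" using l T by (intro mult_fun_integrable) auto
  have "U T \<le> integral {0..l / T} (mult_fun l)"
  proof (rule has_integral_le[OF int integrable_integral[OF int']])
    fix y assume y: "y \<in> {0..l / T}"
    show "- U' (l / y) * (l / y\<^sup>2) \<le> mult_fun l y"
    proof (cases "y = 0")
      case False
      define t where "t = l / y"
      have t: "t > 0" "y > 0" "T \<le> t" using y False l T by (auto simp: t_def field_simps)
      have "(t + 2) / (t + 1)\<^sup>2 \<le> 1 / t"
        using t(1) by (simp add: divide_simps) (simp add: algebra_simps power2_eq_square)
      then have "k * exp (- t) * ((t + 2) / (t + 1)\<^sup>2) \<le> k * exp (- t) * (1 / t)"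
        using k by (intro mult_left_mono) auto
      then have "- U' t \<le> k * exp (- t) * (1 / t)" by (simp add: U'_def)
      also have "k * exp (- t) \<le> fermi t"
      proof -
        have "k \<le> 1 - exp (- t)" using t by (simp add: k_def)
        also have "\<dots> \<le> 1 / (1 + exp (- t))"
        proof -
          have "(1 - z) * (1 + z) \<le> 1" for z :: real by (simp add: algebra_simps)
          then show ?thesis by (simp add: field_simps add_pos_pos)
        qed
        finally have "k * exp (- t) \<le> 1 / (1 + exp (- t)) * exp (- t)" by (intro mult_right_mono) auto
        also have "\<dots> = fermi t" by (simp add: fermi_def exp_minus field_simps)
        finally show ?thesis .
      qed
      finally have "- U' t \<le> fermi t * (1 / t)" using t by (simp add: divide_right_mono)
      then have "- U' t * (l / y\<^sup>2) \<le> fermi t * (1 / t) * (l / y\<^sup>2)"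
        using l by (intro mult_right_mono) auto
      moreover have "z * (1 / t) * (l / y\<^sup>2) = z / y" for z
        using t l by (simp add: t_def power2_eq_square)
      ultimately show ?thesis unfolding mult_fun_fermi t_def[symmetric] by simp
    qed (simp add: mult_fun_def)
  qed
  then show ?thesis by (simp add: U_def k_def)
qed

lemma fermi_0: "fermi 0 = 1 / 2"
  by (simp add: fermi_def)

section \<open>Certified upper bounds on the unit intervals of \<open>t\<close> up to 6\<close>

lemma ln_2_bounds: "69314717/100000000 \<le> (ln (2) :: real)" "ln (2) \<le> (693147181/1000000000 :: real)"
  using ln_approx_bounds[of "2" 7] by (simp_all add: eval_nat_numeral)

lemma ln_3_2_bounds: "25341569/62500000 \<le> (ln (3/2) :: real)" "ln (3/2) \<le> (405465109/1000000000 ::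
    real)"
  using ln_approx_bounds[of "3/2" 5] by (simp_all add: eval_nat_numeral)

lemma ln_4_3_bounds: "143841033/500000000 \<le> (ln (4/3) :: real)" "ln (4/3) \<le> (287682073/1000000000 ::
    real)"
  using ln_approx_bounds[of "4/3" 4] by (simp_all add: eval_nat_numeral)

lemma ln_5_4_bounds: "4462871/20000000 \<le> (ln (5/4) :: real)" "ln (5/4) \<le> (1743309/7812500 :: real)"
  using ln_approx_bounds[of "5/4" 4] by (simp_all add: eval_nat_numeral)

lemma ln_6_5_bounds: "45580389/250000000 \<le> (ln (6/5) :: real)" "ln (6/5) \<le> (182321557/1000000000 ::
    real)"
  using ln_approx_bounds[of "6/5" 4] by (simp_all add: eval_nat_numeral)

text \<open>The coefficients are close to the Taylor coefficients of \<open>fermi\<close> at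
  \<open>1 / 2\<close>, with the linear one raised by a few millionths so that the residual
  \<open>r0 # rs\<close> is positive. Each later interval takes its initial inequality from the
  right end of the preceding one.\<close>

lemma fermi_upper_0_1:
  assumes "0 \<le> t" "t \<le> 1"
  shows "fermi t \<le> poly (Poly [377543/1000000, -4699989/20000000, 14389/500000, 16059/1000000,
      -873/200000, -113/100000, 271/500000, 29/500000]) (t - (0 + 1 / 2))"
  by (rule fermi_poly_upper[where ?r0.0 = "4833151/1000000000000" and rs = "[13447027/10000000000000,
      157436679/400000000000000, -6488649/5000000000000, 4894411/10000000000000, -235929/400000000000,
      98509/100000000000, 2370888829/5000000000000, 8315437/625000000000, -956597/31250000000,
      397979/250000000000, 86563/50000000000, -40671/250000000000, -7859/125000000000, -841/250000000000]"])
    (use assms fermi_0 in \<open>simp_all add: pderiv_pCons\<close>)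

text \<open>The only piece whose size depends on \<open>l\<close>, since \<open>t = l / y\<close>
  runs over \<open>{l..1}\<close>. The coefficient of the logarithm is the value of the polynomial
  at \<open>t = 0\<close>, close to \<open>fermi 0 = 1 / 2\<close>.\<close>

lemma integral_upper_0_1:
  assumes "0 < l" "l \<le> 1"
  shows "integral {l..1} (mult_fun l) \<le> 160000117/320000000 * ln (1 / l) + poly (Poly [0,
      -39186357/160000000, 317289/32000000, 143159/24000000, -14687/16000000, -2773/10000000, 171/2000000,
      29/3500000]) (1 - (0 + 1 / 2)) - poly (Poly [0, -39186357/160000000, 317289/32000000, 143159/24000000,
      -14687/16000000, -2773/10000000, 171/2000000, 29/3500000]) (l - (0 + 1 / 2))"
proof -
  let ?v = "Poly [0, -39186357/160000000, 317289/32000000, 143159/24000000, -14687/16000000, -2773/10000000,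
      171/2000000, 29/3500000] :: real poly"
  have v: "Poly [377543/1000000, -4699989/20000000, 14389/500000, 16059/1000000, -873/200000, -113/100000,
      271/500000, 29/500000] = [:160000117/320000000:] + [:0 + 1 / 2, 1:] * pderiv ?v" by (simp add:
      pderiv_pCons)
  have "integral {l / 1..l / l} (mult_fun l) \<le> 160000117/320000000 * ln (1 / l) + poly ?v (1 - (0 + 1 /
      2)) - poly ?v (l - (0 + 1 / 2))"
  proof (rule integral_mult_fun_upper[OF _ _ _ v])
    fix t assume "l \<le> t" "t \<le> 1"
    then have "0 \<le> t" "t \<le> 1" using assms by linarith+
    then show "fermi t \<le> poly (Poly [377543/1000000, -4699989/20000000, 14389/500000, 16059/1000000,
        -873/200000, -113/100000, 271/500000, 29/500000]) (t - (0 + 1 / 2))" by (rule fermi_upper_0_1)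
  qed (use assms in simp_all)
  moreover have "{l / 1..l / l} = {l..1}" using assms by simp
  ultimately show ?thesis by (simp only:)
qed

lemma fermi_upper_1_2:
  assumes "1 \<le> t" "t \<le> 2"
  shows "fermi t \<le> poly (Poly [182431/1000000, -2982919/20000000, 9473/200000, -2613/1000000,
      -3117/1000000, 1001/1000000, 1/125000, -17/200000]) (t - (1 + 1 / 2))"
  by (rule fermi_poly_upper[where ?r0.0 = "3980239/1000000000000" and rs = "[17396089/10000000000000,
      -81212561/400000000000000, 1960499/2000000000000, 23948943/10000000000000, 15267757/10000000000000,
      -28830631/10000000000000, -406786417/2500000000000, -61194229/2000000000000, 3583523/250000000000,
      -1396339/1000000000000, -272953/500000000000, 85053/500000000000, 17/12500000000, -289/40000000000]"])
    (use assms fermi_upper_0_1[of 1] in \<open>simp_all add: pderiv_pCons\<close>)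

text \<open>In the variable \<open>t\<close> this is the integral of \<open>fermi t / t\<close> over
  \<open>{1..2}\<close>, hence a bound independent of \<open>l\<close>, reusable for both test
  values of \<open>l\<close>.\<close>

lemma integral_upper_1_2:
  assumes "0 < l"
  shows "integral {l / 2..l / 1} (mult_fun l) \<le> 3379607/25000000"
proof -
  let ?v = "Poly [0, -67684549/320000000, 1330523/64000000, 20573/16000000, -34509/32000000, 3191/20000000,
      271/12000000, -17/1400000] :: real poly"
  have v: "Poly [182431/1000000, -2982919/20000000, 9473/200000, -2613/1000000, -3117/1000000, 1001/1000000,
      1/125000, -17/200000] = [:319809487/640000000:] + [:1 + 1 / 2, 1:] * pderiv ?v" by (simp add:
      pderiv_pCons)
  have "integral {l / 2..l / 1} (mult_fun l) \<le> 319809487/640000000 * ln (2 / 1) + poly ?v (2 - (1 + 1 /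
      2)) - poly ?v (1 - (1 + 1 / 2))"
    by (rule integral_mult_fun_upper[OF assms _ _ v fermi_upper_1_2]) simp_all
  moreover have "poly ?v (2 - (1 + 1 / 2)) - poly ?v (1 - (1 + 1 / 2)) \<le> (-10559149/50000000 :: real)"
    by simp
  moreover have "319809487/640000000 * ln (2 / 1) \<le> (17318363/50000000 :: real)" using ln_2_bounds by simp
  ultimately show ?thesis by linarith
qed

lemma fermi_upper_2_3:
  assumes "2 \<le> t" "t \<le> 3"
  shows "fermi t \<le> poly (Poly [9483/125000, -1402079/20000000, 14867/500000, -6769/1000000, 393/1000000,
      3/10000, -119/1000000]) (t - (2 + 1 / 2))"
  by (rule fermi_poly_upper[where ?r0.0 = "293969/62500000000" and rs = "[977657/1250000000000,
      382336959/400000000000000, -5057347/5000000000000, 1928649/10000000000000, -18778033/10000000000000,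
      -128072283/1000000000000, -292047061/10000000000000, 10983643/1000000000000, -923411/500000000000,
      1767/500000000000, 357/5000000000, -14161/1000000000000]"])
    (use assms fermi_upper_1_2[of 2] in \<open>simp_all add: pderiv_pCons\<close>)

lemma integral_upper_2_3:
  assumes "0 < l"
  shows "integral {l / 3..l / 2} (mult_fun l) \<le> 3274939/100000000"
proof -
  let ?v = "Poly [0, -27127357/160000000, 636429/32000000, -32137/24000000, -4403/16000000, 239/2000000,
      -119/6000000] :: real poly"
  have v: "Poly [9483/125000, -1402079/20000000, 14867/500000, -6769/1000000, 393/1000000, 3/10000,
      -119/1000000] = [:31982653/64000000:] + [:2 + 1 / 2, 1:] * pderiv ?v" by (simp add: pderiv_pCons)
  have "integral {l / 3..l / 2} (mult_fun l) \<le> 31982653/64000000 * ln (3 / 2) + poly ?v (3 - (2 + 1 /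
      2)) - poly ?v (2 - (2 + 1 / 2))"
    by (rule integral_mult_fun_upper[OF assms _ _ v fermi_upper_2_3]) simp_all
  moreover have "poly ?v (3 - (2 + 1 / 2)) - poly ?v (2 - (2 + 1 / 2)) \<le> (-16987327/100000000 :: real)"
    by simp
  moreover have "31982653/64000000 * ln (3 / 2) \<le> (10131133/50000000 :: real)" using ln_3_2_bounds by simp
  ultimately show ?thesis by linarith
qed

lemma fermi_upper_3_4:
  assumes "3 \<le> t" "t \<le> 4"
  shows "fermi t \<le> poly (Poly [14659/500000, -569059/20000000, 837/62500, -3933/1000000, 147/200000,
      -29/500000]) (t - (3 + 1 / 2))"
  by (rule fermi_poly_upper[where ?r0.0 = "1376219/250000000000" and rs = "[-2914119/5000000000000,
      -729470281/400000000000000, -375999/1250000000000, -12540287/10000000000000, 185136393/2000000000000,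
      -48069089/1250000000000, 3667491/500000000000, -996453/1000000000000, 4263/50000000000,
      -841/250000000000]"])
    (use assms fermi_upper_2_3[of 3] in \<open>simp_all add: pderiv_pCons\<close>)

lemma integral_upper_3_4:
  assumes "0 < l"
  shows "integral {l / 4..l / 3} (mult_fun l) \<le> 895981/100000000"
proof -
  let ?v = "Poly [0, -3274419/20000000, 4831/250000, -451/187500, 469/2000000, -29/2500000] :: real poly"
  have v: "Poly [14659/500000, -569059/20000000, 837/62500, -3933/1000000, 147/200000, -29/500000] =
      [:24093653/40000000:] + [:3 + 1 / 2, 1:] * pderiv ?v" by (simp add: pderiv_pCons)
  have "integral {l / 4..l / 3} (mult_fun l) \<le> 24093653/40000000 * ln (4 / 3) + poly ?v (4 - (3 + 1 /
      2)) - poly ?v (3 - (3 + 1 / 2))"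
    by (rule integral_mult_fun_upper[OF assms _ _ v fermi_upper_3_4]) simp_all
  moreover have "poly ?v (4 - (3 + 1 / 2)) - poly ?v (3 - (3 + 1 / 2)) \<le> (-164323/1000000 :: real)"
    by simp
  moreover have "24093653/40000000 * ln (4 / 3) \<le> (17328281/100000000 :: real)" using ln_4_3_bounds by
      simp
  ultimately show ?thesis by linarith
qed

lemma fermi_upper_4_5:
  assumes "4 \<le> t" "t \<le> 5"
  shows "fermi t \<le> poly (Poly [10993/1000000, -217319/20000000, 2657/500000, -1693/1000000, 77/200000,
      -31/500000]) (t - (4 + 1 / 2))"
  by (rule fermi_poly_upper[where ?r0.0 = "6203951/1000000000000" and rs = "[9487767/10000000000000,
      39010639/400000000000000, -1471927/5000000000000, 15046873/10000000000000, -13710753/400000000000,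
      -20763517/2500000000000, 981273/500000000000, -358157/1000000000000, 2387/50000000000,
      -961/250000000000]"])
    (use assms fermi_upper_3_4[of 4] in \<open>simp_all add: pderiv_pCons\<close>)

lemma integral_upper_4_5:
  assumes "0 < l"
  shows "integral {l / 5..l / 4} (mult_fun l) \<le> 8123/3125000"
proof -
  let ?v = "Poly [0, -323923/2500000, 52757/4000000, -4681/3000000, 83/500000, -31/2500000] :: real poly"
  have v: "Poly [10993/1000000, -217319/20000000, 2657/500000, -1693/1000000, 77/200000, -31/500000] =
      [:92821/156250:] + [:4 + 1 / 2, 1:] * pderiv ?v" by (simp add: pderiv_pCons)
  have "integral {l / 5..l / 4} (mult_fun l) \<le> 92821/156250 * ln (5 / 4) + poly ?v (5 - (4 + 1 / 2)) -
      poly ?v (4 - (4 + 1 / 2))"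
    by (rule integral_mult_fun_upper[OF assms _ _ v fermi_upper_4_5]) simp_all
  moreover have "poly ?v (5 - (4 + 1 / 2)) - poly ?v (4 - (4 + 1 / 2)) \<le> (-2599201/20000000 :: real)"
    by simp
  moreover have "92821/156250 * ln (5 / 4) \<le> (13255941/100000000 :: real)" using ln_5_4_bounds by simp
  ultimately show ?thesis by linarith
qed

lemma fermi_upper_5_6:
  assumes "5 \<le> t" "t \<le> 6"
  shows "fermi t \<le> poly (Poly [4079/1000000, -10131/2500000, 201/100000, -659/1000000, 159/1000000]) (t
      - (5 + 1 / 2))"
  by (rule fermi_poly_upper[where ?r0.0 = "9961759/1000000000000" and rs = "[824349/1250000000000,
      281991/1562500000000, -133323/100000000000, 370804287/2500000000000, 76911/19531250000,
      -1073461/1000000000000, 104781/500000000000, -25281/1000000000000]"])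
    (use assms fermi_upper_4_5[of 5] in \<open>simp_all add: pderiv_pCons\<close>)

lemma integral_upper_5_6:
  assumes "0 < l"
  shows "integral {l / 6..l / 5} (mult_fun l) \<le> 9827/12500000"
proof -
  let ?v = "Poly [0, -2459831/40000000, 41777/8000000, -3067/6000000, 159/4000000] :: real poly"
  have v: "Poly [4079/1000000, -10131/2500000, 201/100000, -659/1000000, 159/1000000] =
      [:27384461/80000000:] + [:5 + 1 / 2, 1:] * pderiv ?v" by (simp add: pderiv_pCons)
  have "integral {l / 6..l / 5} (mult_fun l) \<le> 27384461/80000000 * ln (6 / 5) + poly ?v (6 - (5 + 1 /
      2)) - poly ?v (5 - (5 + 1 / 2))"
    by (rule integral_mult_fun_upper[OF assms _ _ v fermi_upper_5_6]) simp_all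
  moreover have "poly ?v (6 - (5 + 1 / 2)) - poly ?v (5 - (5 + 1 / 2)) \<le> (-1540589/25000000 :: real)"
    by simp
  moreover have "27384461/80000000 * ln (6 / 5) \<le> (1560243/25000000 :: real)" using ln_6_5_bounds by simp
  ultimately show ?thesis by linarith
qed

section \<open>Certified lower bounds on the same intervals\<close>

lemma fermi_lower_0_1:
  assumes "0 \<le> t" "t \<le> 1"
  shows "poly (Poly [377537/1000000, -4700197/20000000, 14389/500000, 16059/1000000, -873/200000,
      -113/100000, 271/500000, 29/500000]) (t - (0 + 1 / 2)) \<le> fermi t"
  by (rule fermi_poly_lower[where ?r0.0 = "-7036369/1000000000000" and rs = "[-40225211/10000000000000,
      -1659667609/400000000000000, -2532197/5000000000000, 7710883/10000000000000, -1388349/2000000000000,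
      96809/100000000000, 2370948677/5000000000000, 8316191/625000000000, -956597/31250000000,
      397979/250000000000, 86563/50000000000, -40671/250000000000, -7859/125000000000, -841/250000000000]"])
    (use assms fermi_0 in \<open>simp_all add: pderiv_pCons\<close>)

lemma integral_lower_0_1:
  assumes "0 < l" "l \<le> 1"
  shows "159999861/320000000 * ln (1 / l) + poly (Poly [0, -39188021/160000000, 317289/32000000,
      143159/24000000, -14687/16000000, -2773/10000000, 171/2000000, 29/3500000]) (1 - (0 + 1 / 2)) - poly
      (Poly [0, -39188021/160000000, 317289/32000000, 143159/24000000, -14687/16000000, -2773/10000000,
      171/2000000, 29/3500000]) (l - (0 + 1 / 2)) \<le> integral {l..1} (mult_fun l)"
proof -
  let ?v = "Poly [0, -39188021/160000000, 317289/32000000, 143159/24000000, -14687/16000000, -2773/10000000,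
      171/2000000, 29/3500000] :: real poly"
  have v: "Poly [377537/1000000, -4700197/20000000, 14389/500000, 16059/1000000, -873/200000, -113/100000,
      271/500000, 29/500000] = [:159999861/320000000:] + [:0 + 1 / 2, 1:] * pderiv ?v" by (simp add:
      pderiv_pCons)
  have "159999861/320000000 * ln (1 / l) + poly ?v (1 - (0 + 1 / 2)) - poly ?v (l - (0 + 1 / 2)) \<le>
      integral {l / 1..l / l} (mult_fun l)"
  proof (rule integral_mult_fun_lower[OF _ _ _ v])
    fix t assume "l \<le> t" "t \<le> 1"
    then have "0 \<le> t" "t \<le> 1" using assms by linarith+
    then show "poly (Poly [377537/1000000, -4700197/20000000, 14389/500000, 16059/1000000, -873/200000,
        -113/100000, 271/500000, 29/500000]) (t - (0 + 1 / 2)) \<le> fermi t" by (rule fermi_lower_0_1)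
  qed (use assms in simp_all)
  moreover have "{l / 1..l / l} = {l..1}" using assms by simp
  ultimately show ?thesis by (simp only:)
qed

lemma fermi_lower_1_2:
  assumes "1 \<le> t" "t \<le> 2"
  shows "poly (Poly [182419/1000000, -2982921/20000000, 9473/200000, -2613/1000000, -3117/1000000,
      1001/1000000, 1/125000, -17/200000]) (t - (1 + 1 / 2)) \<le> fermi t"
  by (rule fermi_poly_lower[where ?r0.0 = "-3741561/1000000000000" and rs = "[-19034101/10000000000000,
      361559759/400000000000000, 1854021/2000000000000, 23195637/10000000000000, 15501763/10000000000000,
      -28826709/10000000000000, -406791513/2500000000000, -61194263/2000000000000, 3583523/250000000000,
      -1396339/1000000000000, -272953/500000000000, 85053/500000000000, 17/12500000000, -289/40000000000]"])
    (use assms fermi_lower_0_1[of 1] in \<open>simp_all add: pderiv_pCons\<close>)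

lemma integral_lower_1_2:
  assumes "0 < l"
  shows "6758797/50000000 \<le> integral {l / 2..l / 1} (mult_fun l)"
proof -
  let ?v = "Poly [0, -67684581/320000000, 1330523/64000000, 20573/16000000, -34509/32000000, 3191/20000000,
      271/12000000, -17/1400000] :: real poly"
  have v: "Poly [182419/1000000, -2982921/20000000, 9473/200000, -2613/1000000, -3117/1000000, 1001/1000000,
      1/125000, -17/200000] = [:319801903/640000000:] + [:1 + 1 / 2, 1:] * pderiv ?v" by (simp add:
      pderiv_pCons)
  have "319801903/640000000 * ln (2 / 1) + poly ?v (2 - (1 + 1 / 2)) - poly ?v (1 - (1 + 1 / 2)) \<le>
      integral {l / 2..l / 1} (mult_fun l)"
    by (rule integral_mult_fun_lower[OF assms _ _ v fermi_lower_1_2]) simp_all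
  moreover have "(-21118309/100000000 :: real) \<le> poly ?v (2 - (1 + 1 / 2)) - poly ?v (1 - (1 + 1 / 2))"
    by simp
  moreover have "(34635903/100000000 :: real) \<le> 319801903/640000000 * ln (2 / 1)" using ln_2_bounds by
      simp
  ultimately show ?thesis by linarith
qed

lemma fermi_lower_2_3:
  assumes "2 \<le> t" "t \<le> 3"
  shows "poly (Poly [75851/1000000, -1402081/20000000, 14867/500000, -6769/1000000, 393/1000000, 3/10000,
      -119/1000000]) (t - (2 + 1 / 2)) \<le> fermi t"
  by (rule fermi_poly_lower[where ?r0.0 = "-6424201/1000000000000" and rs = "[-11254069/10000000000000,
      685962239/400000000000000, -5907583/5000000000000, 2017291/10000000000000, -18699247/10000000000000,
      -128075317/1000000000000, -292047299/10000000000000, 10983643/1000000000000, -923411/500000000000,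
      1767/500000000000, 357/5000000000, -14161/1000000000000]"])
    (use assms fermi_lower_1_2[of 2] in \<open>simp_all add: pderiv_pCons\<close>)

lemma integral_lower_2_3:
  assumes "0 < l"
  shows "327441/10000000 \<le> integral {l / 3..l / 2} (mult_fun l)"
proof -
  let ?v = "Poly [0, -27127373/160000000, 636429/32000000, -32137/24000000, -4403/16000000, 239/2000000,
      -119/6000000] :: real poly"
  have v: "Poly [75851/1000000, -1402081/20000000, 14867/500000, -6769/1000000, 393/1000000, 3/10000,
      -119/1000000] = [:31981837/64000000:] + [:2 + 1 / 2, 1:] * pderiv ?v" by (simp add: pderiv_pCons)
  have "31981837/64000000 * ln (3 / 2) + poly ?v (3 - (2 + 1 / 2)) - poly ?v (2 - (2 + 1 / 2)) \<le>
      integral {l / 3..l / 2} (mult_fun l)"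
    by (rule integral_mult_fun_lower[OF assms _ _ v fermi_lower_2_3]) simp_all
  moreover have "(-8493669/50000000 :: real) \<le> poly ?v (3 - (2 + 1 / 2)) - poly ?v (2 - (2 + 1 / 2))"
    by simp
  moreover have "(5065437/25000000 :: real) \<le> 31981837/64000000 * ln (3 / 2)" using ln_3_2_bounds by simp
  ultimately show ?thesis by linarith
qed

lemma fermi_lower_3_4:
  assumes "3 \<le> t" "t \<le> 4"
  shows "poly (Poly [3663/125000, -569061/20000000, 837/62500, -3933/1000000, 147/200000, -29/500000]) (t -
      (3 + 1 / 2)) \<le> fermi t"
  by (rule fermi_poly_lower[where ?r0.0 = "-485901/62500000000" and rs = "[-1842057/1250000000000,
      -581756121/400000000000000, -255153/625000000000, -12342353/10000000000000, 185133439/2000000000000,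
      -96138207/2500000000000, 3667491/500000000000, -996453/1000000000000, 4263/50000000000,
      -841/250000000000]"])
    (use assms fermi_lower_2_3[of 3] in \<open>simp_all add: pderiv_pCons\<close>)

lemma integral_lower_3_4:
  assumes "0 < l"
  shows "35823/4000000 \<le> integral {l / 4..l / 3} (mult_fun l)"
proof -
  let ?v = "Poly [0, -3274421/20000000, 4831/250000, -451/187500, 469/2000000, -29/2500000] :: real poly"
  have v: "Poly [3663/125000, -569061/20000000, 837/62500, -3933/1000000, 147/200000, -29/500000] =
      [:24093107/40000000:] + [:3 + 1 / 2, 1:] * pderiv ?v" by (simp add: pderiv_pCons)
  have "24093107/40000000 * ln (4 / 3) + poly ?v (4 - (3 + 1 / 2)) - poly ?v (3 - (3 + 1 / 2)) \<le>
      integral {l / 4..l / 3} (mult_fun l)"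
    by (rule integral_mult_fun_lower[OF assms _ _ v fermi_lower_3_4]) simp_all
  moreover have "(-16432311/100000000 :: real) \<le> poly ?v (4 - (3 + 1 / 2)) - poly ?v (3 - (3 + 1 / 2))"
    by simp
  moreover have "(8663943/50000000 :: real) \<le> 24093107/40000000 * ln (4 / 3)" using ln_4_3_bounds by simp
  ultimately show ?thesis by linarith
qed

lemma fermi_lower_4_5:
  assumes "4 \<le> t" "t \<le> 5"
  shows "poly (Poly [5489/500000, -217321/20000000, 2657/500000, -1693/1000000, 77/200000, -31/500000]) (t -
      (4 + 1 / 2)) \<le> fermi t"
  by (rule fermi_poly_lower[where ?r0.0 = "-2141621/250000000000" and rs = "[2624969/5000000000000,
      101909359/400000000000000, -1720563/5000000000000, 15158987/10000000000000, -68557331/2000000000000,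
      -5190887/625000000000, 981273/500000000000, -358157/1000000000000, 2387/50000000000,
      -961/250000000000]"])
    (use assms fermi_lower_3_4[of 4] in \<open>simp_all add: pderiv_pCons\<close>)

lemma integral_lower_4_5:
  assumes "0 < l"
  shows "649/250000 \<le> integral {l / 5..l / 4} (mult_fun l)"
proof -
  let ?v = "Poly [0, -1295693/10000000, 52757/4000000, -4681/3000000, 83/500000, -31/2500000] :: real poly"
  have v: "Poly [5489/500000, -217321/20000000, 2657/500000, -1693/1000000, 77/200000, -31/500000] =
      [:11880797/20000000:] + [:4 + 1 / 2, 1:] * pderiv ?v" by (simp add: pderiv_pCons)
  have "11880797/20000000 * ln (5 / 4) + poly ?v (5 - (4 + 1 / 2)) - poly ?v (4 - (4 + 1 / 2)) \<le>
      integral {l / 5..l / 4} (mult_fun l)"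
    by (rule integral_mult_fun_lower[OF assms _ _ v fermi_lower_4_5]) simp_all
  moreover have "(-812251/6250000 :: real) \<le> poly ?v (5 - (4 + 1 / 2)) - poly ?v (4 - (4 + 1 / 2))"
    by simp
  moreover have "(207119/1562500 :: real) \<le> 11880797/20000000 * ln (5 / 4)" using ln_5_4_bounds by simp
  ultimately show ?thesis by linarith
qed

lemma fermi_lower_5_6:
  assumes "5 \<le> t" "t \<le> 6"
  shows "poly (Poly [4061/1000000, -20277/5000000, 201/100000, -659/1000000, 159/1000000]) (t - (5 + 1 / 2))
      \<le> fermi t"
  by (rule fermi_poly_lower[where ?r0.0 = "-10891721/1000000000000" and rs = "[-6155103/2500000000000,
      5712771/25000000000000, -672447/500000000000, 46351089/312500000000, 9846993/2500000000000,
      -1073461/1000000000000, 104781/500000000000, -25281/1000000000000]"])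
    (use assms fermi_lower_4_5[of 5] in \<open>simp_all add: pderiv_pCons\<close>)

lemma integral_lower_5_6:
  assumes "0 < l"
  shows "78287/100000000 \<le> integral {l / 6..l / 5} (mult_fun l)"
proof -
  let ?v = "Poly [0, -2459951/40000000, 41777/8000000, -3067/6000000, 159/4000000] :: real poly"
  have v: "Poly [4061/1000000, -20277/5000000, 201/100000, -659/1000000, 159/1000000] =
      [:27384341/80000000:] + [:5 + 1 / 2, 1:] * pderiv ?v" by (simp add: pderiv_pCons)
  have "27384341/80000000 * ln (6 / 5) + poly ?v (6 - (5 + 1 / 2)) - poly ?v (5 - (5 + 1 / 2)) \<le>
      integral {l / 6..l / 5} (mult_fun l)"
    by (rule integral_mult_fun_lower[OF assms _ _ v fermi_lower_5_6]) simp_all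
  moreover have "(-6162657/100000000 :: real) \<le> poly ?v (6 - (5 + 1 / 2)) - poly ?v (5 - (5 + 1 / 2))"
    by simp
  moreover have "(390059/6250000 :: real) \<le> 27384341/80000000 * ln (6 / 5)" using ln_6_5_bounds by simp
  ultimately show ?thesis by linarith
qed

section \<open>Assembling the enclosure of the multiplier and of the growth constant at 1\<close>

text \<open>Read off from the enclosure of \<open>fermi 6\<close> at the end of the chain: below
  through \<open>fermi 6 \<le> exp (- 6)\<close>, above by solving \<open>1 / (1 + exp 6)\<close>
  for \<open>exp 6\<close>.\<close>

lemma exp_neg_6_bounds: "24633/10000000 \<le> (exp (- 6) :: real)" "exp (- 6) \<le> (24891/10000000 :: real)"
proof -
  show "24633/10000000 \<le> exp (- 6 :: real)"
    using fermi_lower_5_6[of 6] fermi_le_exp[of 6] by simp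
  have "1 / (1 + exp 6) \<le> (248287/100000000 :: real)" using fermi_upper_5_6[of 6] by (simp add: fermi_def)
  then have "1 / (248287/100000000) - 1 \<le> (exp 6 :: real)" by (simp add: field_simps add_pos_pos)
  then have "inverse (exp 6) \<le> inverse (1 / (248287/100000000) - 1 :: real)"
    by (intro le_imp_inverse_le) simp_all
  then show "exp (- 6) \<le> (24891/10000000 :: real)" by (simp add: exp_minus)
qed

text \<open>The break points are where \<open>l / y\<close> is an integer; at 6 the two tail bounds
  are only about \<open>1.2 * 10^-5\<close> apart.\<close>

lemma mult_int_split:
  assumes "0 < l" "l \<le> 1"
  shows "mult_int l = integral {0..l / 6} (mult_fun l) + integral {l / 6..l / 5} (mult_fun l)
    + integral {l / 5..l / 4} (mult_fun l) + integral {l / 4..l / 3} (mult_fun l)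
    + integral {l / 3..l / 2} (mult_fun l) + integral {l / 2..l / 1} (mult_fun l) + integral {l..1}
        (mult_fun l)"
proof -
  have split: "integral {0..b} (mult_fun l) = integral {0..a} (mult_fun l) + integral {a..b} (mult_fun l)"
    if "0 \<le> a" "a \<le> b" for a b
    using that assms by (intro Henstock_Kurzweil_Integration.integral_combine[symmetric]
        mult_fun_integrable) auto
  show ?thesis
    unfolding mult_int_def using assms
      split[of l 1] split[of "l / 2" l] split[of "l / 3" "l / 2"] split[of "l / 4" "l / 3"]
      split[of "l / 5" "l / 4"] split[of "l / 6" "l / 5"] by simp
qed

text \<open>\<open>636/625\<close> is \<open>8 * l\<close> for \<open>l = 159/1250\<close>.
  Splitting off the power of two leaves a logarithm close to \<open>0\<close>, where two terms of
  the series suffice; \<open>6359/6250\<close> plays the same role for the other test value.\<close>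

lemma ln_636_625_bounds: "17446913/1000000000 \<le> (ln (636/625) :: real)" "ln (636/625) \<le>
    (8723457/500000000 :: real)"
  using ln_approx_bounds[of "636/625" 2] by (simp_all add: eval_nat_numeral)

lemma mult_int_upper: "mult_int (159/1250) < 1"
proof -
  define l :: real where "l = 159/1250"
  have l: "0 < l" "l \<le> 1" by (simp_all add: l_def)
  have "ln (1 / l) = 3 * ln 2 - ln (636/625)"
  proof -
    have eq: "1 / l = 2 ^ 3 / (636/625)" by (simp add: l_def)
    have gen: "ln (2 ^ 3 / z) = 3 * ln 2 - ln z" if "z > 0" for z :: real
      using that ln_realpow[of "2::real" 3] by (simp add: ln_div)
    have "ln (2 ^ 3 / (636/625) :: real) = 3 * ln 2 - ln (636/625)" by (rule gen) simp
    then show ?thesis unfolding eq .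
  qed
  then have l': "515498649/250000000 \<le> ln (1 / l)" "ln (1 / l) \<le> 206199463/100000000"
    using ln_2_bounds ln_636_625_bounds by linarith+
  let ?v = "Poly [0, -39186357/160000000, 317289/32000000, 143159/24000000, -14687/16000000, -2773/10000000,
      171/2000000, 29/3500000] :: real poly"
  have "160000117/320000000 * ln (1 / l) \<le> 103099807/100000000" using l' by simp
  moreover have "poly ?v (1 - (0 + 1 / 2)) - poly ?v (l - (0 + 1 / 2)) \<le> -21165523/100000000"
    by (simp add: l_def)
  ultimately have "integral {l..1} (mult_fun l) \<le> 20483571/25000000"
    using integral_upper_0_1[OF l] by linarith
  moreover
  have "integral {0..l / 6} (mult_fun l) \<le> 363/1000000"
    using tail_upper[OF l(1), of 6] exp_neg_6_bounds by simp
  ultimately have "mult_int l \<le> 24999621/25000000"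
    using mult_int_split[OF l] integral_upper_1_2[OF l(1)] integral_upper_2_3[OF l(1)] integral_upper_3_4[OF
        l(1)]
      integral_upper_4_5[OF l(1)] integral_upper_5_6[OF l(1)] by linarith
  then show ?thesis by (simp add: l_def)
qed

lemma ln_6359_6250_bounds: "4322417/250000000 \<le> (ln (6359/6250) :: real)" "ln (6359/6250) \<le>
    (17289669/1000000000 :: real)"
  using ln_approx_bounds[of "6359/6250" 2] by (simp_all add: eval_nat_numeral)

lemma mult_int_lower: "1 < mult_int (6359/50000)"
proof -
  define l :: real where "l = 6359/50000"
  have l: "0 < l" "l \<le> 1" by (simp_all add: l_def)
  have "ln (1 / l) = 3 * ln 2 - ln (6359/6250)"
  proof -
    have eq: "1 / l = 2 ^ 3 / (6359/6250)" by (simp add: l_def)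
    have gen: "ln (2 ^ 3 / z) = 3 * ln 2 - ln z" if "z > 0" for z :: real
      using that ln_realpow[of "2::real" 3] by (simp add: ln_div)
    have "ln (2 ^ 3 / (6359/6250) :: real) = 3 * ln 2 - ln (6359/6250)" by (rule gen) simp
    then show ?thesis unfolding eq .
  qed
  then have l': "2062151841/1000000000 \<le> ln (1 / l)" "ln (1 / l) \<le> 3299443/1600000"
    using ln_2_bounds ln_6359_6250_bounds by linarith+
  let ?v = "Poly [0, -39188021/160000000, 317289/32000000, 143159/24000000, -14687/16000000, -2773/10000000,
      171/2000000, 29/3500000] :: real poly"
  have "51553751/50000000 \<le> 159999861/320000000 * ln (1 / l)" using l' by simp
  moreover have "-21166931/100000000 \<le> poly ?v (1 - (0 + 1 / 2)) - poly ?v (l - (0 + 1 / 2))"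
    by (simp add: l_def)
  ultimately have "81940571/100000000 \<le> integral {l..1} (mult_fun l)"
    using integral_lower_0_1[OF l] by linarith
  moreover
  have "integral {0..l / 6} (mult_fun l) \<ge> 17551/50000000"
  proof -
    have "(1 - 24891/10000000) * (24633/10000000) \<le> (1 - exp (- 6)) * (exp (- 6) :: real)"
      using exp_neg_6_bounds by (intro mult_mono) simp_all
    then show ?thesis using tail_lower[OF l(1), of 6] by simp
  qed
  ultimately have "100001139/100000000 \<le> mult_int l"
    using mult_int_split[OF l] integral_lower_1_2[OF l(1)] integral_lower_2_3[OF l(1)] integral_lower_3_4[OF
        l(1)]
      integral_lower_4_5[OF l(1)] integral_lower_5_6[OF l(1)] by linarith
  then show ?thesis by (simp add: l_def)
qed

text \<open>Rational stand-ins for exponentials: \<open>ln (762/671)\<close> is just below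
  \<open>0.12718\<close> and \<open>ln (1507/1327)\<close> just above \<open>0.1272\<close>, so that
  \<open>1327/1507 < exp (- l) < 671/762\<close> for the multiplier \<open>l\<close> of 1.\<close>

lemma ln_762_671_bounds: "127177417/1000000000 \<le> (ln (762/671) :: real)" "ln (762/671) \<le>
    (127177419/1000000000 :: real)"
  using ln_approx_bounds[of "762/671" 3] by (simp_all add: eval_nat_numeral)

lemma ln_1507_1327_bounds: "127200163/1000000000 \<le> (ln (1507/1327) :: real)" "ln (1507/1327) \<le>
    (25440033/200000000 :: real)"
  using ln_approx_bounds[of "1507/1327" 3] by (simp_all add: eval_nat_numeral)

lemma ln_1524_1433_bounds: "15392077/250000000 \<le> (ln (1524/1433) :: real)" "ln (1524/1433) \<le>
    (61568309/1000000000 :: real)"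
  using ln_approx_bounds[of "1524/1433" 3] by (simp_all add: eval_nat_numeral)

lemma ln_1507_1417_bounds: "30789479/500000000 \<le> (ln (1507/1417) :: real)" "ln (1507/1417) \<le>
    (61578959/1000000000 :: real)"
  using ln_approx_bounds[of "1507/1417" 3] by (simp_all add: eval_nat_numeral)

lemma growth_const_1_approx: "\<bar>growth_const 1 - 0.91117\<bar> < 1 / 10 ^ 5"
proof -
  define l where "l = multiplier 1"
  have l: "l > 0" "mult_int l = 1" using multiplier[of 1] by (simp_all add: l_def)
  have c: "growth_const 1 * ln 2 = ln (1 + exp (- l))"
    by (simp add: growth_const_eq l_def log_def)
  have "l < 159/1250"
  proof (rule ccontr)
    assume "\<not> l < 159/1250"
    then have "mult_int l \<le> mult_int (159/1250)"
      by (intro mult_int_antimono) simp_all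
    then show False using l mult_int_upper by simp
  qed
  moreover have "6359/50000 < l"
  proof (rule ccontr)
    assume "\<not> 6359/50000 < l"
    then have "mult_int (6359/50000) \<le> mult_int l"
      using l by (intro mult_int_antimono) simp_all
    then show False using l mult_int_lower by simp
  qed
  moreover have "ln (671/762 :: real) = - ln (762/671)" "ln (1327/1507 :: real) = - ln (1507/1327)"
    by (simp_all add: ln_div)
  ultimately have "- l < ln (671/762)" "ln (1327/1507) < - l"
    using ln_762_671_bounds ln_1507_1327_bounds by linarith+
  then have "exp (- l) < exp (ln (671/762))" "exp (ln (1327/1507)) < exp (- l)"
    by (simp_all only: exp_less_cancel_iff)
  then have "1 + exp (- l) < 1433/762" "2834/1507 < 1 + exp (- l)" by simp_all
  then have "ln (1 + exp (- l)) < ln (1433/762)" "ln (2834/1507) < ln (1 + exp (- l))"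
    by (simp_all add: add_pos_pos)
  \<comment> \<open>Adding \<open>1\<close> to \<open>671/762\<close> and to
    \<open>1327/1507\<close> gives these arguments; factoring out \<open>2\<close> again leaves
    logarithms near \<open>0\<close>.\<close>
  moreover have "ln (1433/762 :: real) = ln 2 - ln (1524/1433)" "ln (2834/1507 :: real) = ln 2 - ln
      (1507/1417)"
  proof -
    have "ln (2 / z) = ln 2 - ln z" if "z > 0" for z :: real using that by (simp add: ln_div)
    from this[of "1524/1433"] this[of "1507/1417"]
    show "ln (1433/762 :: real) = ln 2 - ln (1524/1433)" "ln (2834/1507 :: real) = ln 2 - ln (1507/1417)" by
        simp_all
  qed
  ultimately have "growth_const 1 * ln 2 < 91118 / 100000 * ln 2" "91116 / 100000 * ln 2 < growth_const 1 *
      ln 2"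
    unfolding c using ln_2_bounds ln_1524_1433_bounds ln_1507_1417_bounds by linarith+
  moreover have "ln (2::real) > 0" by simp
  ultimately have "growth_const 1 < 91118 / 100000" "91116 / 100000 < growth_const 1"
    by (simp_all only: mult_less_cancel_right_pos)
  then have "growth_const 1 - 0.91117 < 1 / 10 ^ 5" "- (growth_const 1 - 0.91117) < 1 / 10 ^ 5" by simp_all
  then show ?thesis unfolding abs_less_iff by blast
qed

theorem theorem1:
  "(\<forall>x::real. x > 0 \<longrightarrow> (\<exists>!l::real. is_multiplier x l)) \<and>
   (\<forall>x::real. x \<in> \<rat> \<and> x > 0 \<longrightarrow>
      (\<exists>e :: nat \<Rightarrow> real. e \<in> o(\<lambda>n. real n) \<and>
         (\<forall>\<^sub>F n in sequentially.
            real (card (unit_fraction_sets x n)) = 2 powr (growth_const x * real n + e n)))) \<and>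
   strict_mono_on {0<..} growth_const \<and>
   (growth_const \<longlongrightarrow> 0) (at_right 0) \<and>
   \<bar>growth_const 1 - 0.91117\<bar> < 1 / 10 ^ 5 \<and>
   (growth_const \<longlongrightarrow> 1) at_top"
  using multiplier_ex1 card_unit_fraction_sets_asymp growth_const_strict_mono growth_const_tendsto_0
    growth_const_1_approx growth_const_tendsto_1
  by blast

end
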